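(* Let $X\subset\mathbb{R}^m$, $Y\subset\mathbb{R}^n$ and $\Xi\subset\mathbb{R}^p$ be open, and let $H_1\in\mathcal{G}_{ps}(X\times\Xi)$ and $H_2\in\mathcal{G}_{ps}(\Xi\times Y)$. Then the operators $\widehat{H}_1:\mathcal{G}(\Xi)\to\mathcal{G}(X)$ and $\widehat{H}_2:\mathcal{G}(Y)\to\mathcal{G}(\Xi)$ can be composed, and $\widehat{H}_1\circ\widehat{H}_2:\mathcal{G}(Y)\to\mathcal{G}(X)$ is a generalized integral operator whose kernel is $L$, defined by $$L(\cdot_1,\cdot_2)=\int_\Xi H_1(\cdot_1,\xi)H_2(\xi,\cdot_2)\,\mathrm{d}\xi ;$$ moreover $L\in\mathcal{G}_{ps}(X\times Y)$.
   Context: For $\Omega\subset\mathbb{R}^d$ open, $K\Subset\Omega$ means that $K$ is a compact subset of $\Omega$, and $p_{K,l}(f)=\sup_{x\in K,|\alpha|\le l}|\partial^\alpha f(x)|$ for $l\in\mathbb{N}$, $f\in\mathcal{C}^\infty(\Omega)$. $\mathcal{E}_M(\Omega)$ is the set of nets $(u_\varepsilon)_{\varepsilon\in(0,1]}$ in $\mathcal{C}^\infty(\Omega)$ such that for all $K\Subset\Omega$, $l\in\mathbb{N}$ there is $n\in\mathbb{N}$ with $p_{K,l}(u_\varepsilon)=O(\varepsilon^{-n})$ as $\varepsilon\to0$; $\mathcal{I}(\Omega)$ is the set of nets such that for all $K,l,n$, $p_{K,l}(u_\varepsilon)=O(\varepsilon^{n})$. $\mathcal{G}(\Omega)=\mathcal{E}_M(\Omega)/\mathcal{I}(\Omega)$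 (a sheaf of algebras); $Cl(u_\varepsilon)_\varepsilon$ is the class. The support of $u\in\mathcal{G}(\Omega)$ is the complement of the largest open subset on which $u$ restricts to $0$. For open sets $X\subset\mathbb{R}^m$, $Y\subset\mathbb{R}^n$, $\mathcal{G}_{ps}(X\times Y)$ is the set of properly supported $g\in\mathcal{G}(X\times Y)$: for every relatively compact open subset $O_1$ of $X$ there is $K_2\Subset Y$ with $\mathrm{supp}\,g\cap(O_1\times Y)\subset O_1\times K_2$. For such $g=Cl(g_\varepsilon)_\varepsilon$, $\int_Y g(\cdot,y)\,\mathrm{d}y$ denotes the unique $G\in\mathcal{G}(X)$ such that, for each relatively compact open $O_1\subset X$ and each relatively compact open $W\subset Y$ with $\mathrm{supp}\,g\cap(O_1\times Y)\subset O_1\times W$, $G|_{O_1}$ is the class of $x\mapsto\int_W g_\varepsilon(x,y)\,\mathrm{d}y$ (well defined). In the definition of $L$, this is applied to $(x,y,\xi)\mapsto H_1(x,\xi)H_2(\xi,y)$ on $(X\times Y)\times\Xi$, the integration variable being $\xi$. The generalized integral operator with kernel $H\in\mathcal{G}_{ps}(X\times Y)$ is $\widehat H:\mathcal{G}(Y)\to\mathcal{G}(X)$, $\widehat H(f)=\int_Y H(\cdot,y)f(y)\,\mathrm{d}y$. *)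

theory Defs
  imports "HOL-Analysis.Analysis" "HOL-Library.Landau_Symbols"
begin

text \<open>
  The scalars are a type \<open>'k :: {real_normed_field, euclidean_space}\<close>; up to isomorphism the only
  such normed fields are \<open>\<real>\<close> and \<open>\<complex>\<close>. Abstract Euclidean spaces play the role of the
  \<open>\<real>\<^sup>d\<close>, so that \<open>\<real>\<^sup>m \<times> \<real>\<^sup>n\<close> is a product type.
\<close>

definition partial_deriv :: "'a::euclidean_space \<Rightarrow> ('a \<Rightarrow> 'k::real_normed_vector) \<Rightarrow> 'a \<Rightarrow> 'k" where
  "partial_deriv b f x = frechet_derivative f (at x) b"

text \<open>
  A multi-index of order \<open>k\<close> is encoded as a list of \<open>k\<close> basis vectors, the directions of
  differentiation. On smooth functions the order of the list is immaterial.
\<close>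

definition multi_indices :: "'a::euclidean_space list set" where
  "multi_indices = lists Basis"

definition iter_deriv :: "'a::euclidean_space list \<Rightarrow> ('a \<Rightarrow> 'k::real_normed_vector) \<Rightarrow> 'a \<Rightarrow> 'k" where
  "iter_deriv \<alpha> f = foldr partial_deriv \<alpha> f"

definition smooth_on :: "'a::euclidean_space set \<Rightarrow> ('a \<Rightarrow> 'k::real_normed_vector) \<Rightarrow> bool" where
  "smooth_on \<Omega> f \<longleftrightarrow> (\<forall>\<alpha>\<in>multi_indices. iter_deriv \<alpha> f differentiable_on \<Omega>)"

text \<open>The element \<open>0\<close> is inserted only to make the supremum over \<open>K = {}\<close> equal to \<open>0\<close>.\<close>

definition seminorm :: "'a::euclidean_space set \<Rightarrow> nat \<Rightarrow> ('a \<Rightarrow> 'k::real_normed_vector) \<Rightarrow> real" where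
  "seminorm K l f =
     Sup (insert 0 {norm (iter_deriv \<alpha> f x) | x \<alpha>. x \<in> K \<and> \<alpha> \<in> multi_indices \<and> length \<alpha> \<le> l})"

text \<open>
  Nets are total functions, but only their values at \<open>\<epsilon> \<in> (0,1]\<close> and \<open>x \<in> \<Omega>\<close> matter
  (\<open>\<Omega>\<close> being open): nets that agree there fall into the same class below.
\<close>

type_synonym ('a, 'k) net = "real \<Rightarrow> 'a \<Rightarrow> 'k"

definition smooth_nets :: "'a::euclidean_space set \<Rightarrow> ('a, 'k::real_normed_vector) net set" where
  "smooth_nets \<Omega> = {u. \<forall>\<epsilon>\<in>{0<..1}. smooth_on \<Omega> (u \<epsilon>)}"

definition moderate_nets :: "'a::euclidean_space set \<Rightarrow> ('a, 'k::real_normed_vector) net set" where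
  "moderate_nets \<Omega> = {u \<in> smooth_nets \<Omega>. \<forall>K l. compact K \<and> K \<subseteq> \<Omega> \<longrightarrow>
     (\<exists>n::nat. (\<lambda>\<epsilon>. seminorm K l (u \<epsilon>)) \<in> O[at_right 0](\<lambda>\<epsilon>. 1 / \<epsilon> ^ n))}"

definition negligible_nets :: "'a::euclidean_space set \<Rightarrow> ('a, 'k::real_normed_vector) net set" where
  "negligible_nets \<Omega> = {u \<in> smooth_nets \<Omega>. \<forall>K l. compact K \<and> K \<subseteq> \<Omega> \<longrightarrow>
     (\<forall>n::nat. (\<lambda>\<epsilon>. seminorm K l (u \<epsilon>)) \<in> O[at_right 0](\<lambda>\<epsilon>. \<epsilon> ^ n))}"

definition net_rel ::
    "'a::euclidean_space set \<Rightarrow> (('a, 'k::real_normed_vector) net \<times> ('a, 'k) net) set" where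
  "net_rel \<Omega> = {(u, v). u \<in> moderate_nets \<Omega> \<and> v \<in> moderate_nets \<Omega> \<and>
     (\<lambda>\<epsilon> x. u \<epsilon> x - v \<epsilon> x) \<in> negligible_nets \<Omega>}"

type_synonym ('a, 'k) genfun = "('a, 'k) net set"

definition colombeau :: "'a::euclidean_space set \<Rightarrow> ('a, 'k::real_normed_vector) genfun set" where
  "colombeau \<Omega> = moderate_nets \<Omega> // net_rel \<Omega>"

definition Cl :: "'a::euclidean_space set \<Rightarrow> ('a, 'k::real_normed_vector) net \<Rightarrow> ('a, 'k) genfun" where
  "Cl \<Omega> u = net_rel \<Omega> `` {u}"

text \<open>
  The next three operations act on all representatives at once; taking the image under
  \<open>net_rel\<close> saturates the result to a full equivalence class on the target domain.
\<close>

definition gf_restrict ::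
    "'a::euclidean_space set \<Rightarrow> ('a, 'k::real_normed_vector) genfun \<Rightarrow> ('a, 'k) genfun" where
  "gf_restrict V g = net_rel V `` g"

definition gf_pullback ::
    "'a::euclidean_space set \<Rightarrow> ('a \<Rightarrow> 'b) \<Rightarrow> ('b::euclidean_space, 'k::real_normed_vector) genfun
      \<Rightarrow> ('a, 'k) genfun" where
  "gf_pullback \<Omega> \<phi> g = net_rel \<Omega> `` ((\<lambda>u \<epsilon> z. u \<epsilon> (\<phi> z)) ` g)"

definition gf_mult ::
    "'a::euclidean_space set \<Rightarrow> ('a, 'k::real_normed_field) genfun \<Rightarrow> ('a, 'k) genfun
      \<Rightarrow> ('a, 'k) genfun" where
  "gf_mult \<Omega> g h = net_rel \<Omega> `` {\<lambda>\<epsilon> x. u \<epsilon> x * v \<epsilon> x | u v. u \<in> g \<and> v \<in> h}"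

definition gf_supp ::
    "'a::euclidean_space set \<Rightarrow> ('a, 'k::real_normed_vector) genfun \<Rightarrow> 'a set" where
  "gf_supp \<Omega> g =
     \<Omega> - (GREATEST V. open V \<and> V \<subseteq> \<Omega> \<and> gf_restrict V g = Cl V (\<lambda>\<epsilon> x. 0))"

definition rel_compact_open :: "'a::euclidean_space set \<Rightarrow> 'a set \<Rightarrow> bool" where
  "rel_compact_open V \<Omega> \<longleftrightarrow> open V \<and> compact (closure V) \<and> closure V \<subseteq> \<Omega>"

definition colombeau_ps ::
    "'a::euclidean_space set \<Rightarrow> 'b::euclidean_space set
      \<Rightarrow> ('a \<times> 'b, 'k::real_normed_vector) genfun set" where
  "colombeau_ps X Y = {g \<in> colombeau (X \<times> Y). \<forall>O\<^sub>1. rel_compact_open O\<^sub>1 X \<longrightarrow>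
     (\<exists>K\<^sub>2. compact K\<^sub>2 \<and> K\<^sub>2 \<subseteq> Y \<and> gf_supp (X \<times> Y) g \<inter> (O\<^sub>1 \<times> Y) \<subseteq> O\<^sub>1 \<times> K\<^sub>2)}"

definition gf_integral ::
    "'a::euclidean_space set \<Rightarrow> 'b::euclidean_space set
      \<Rightarrow> ('a \<times> 'b, 'k::{real_normed_field, euclidean_space}) genfun \<Rightarrow> ('a, 'k) genfun" where
  "gf_integral X Y g = (THE G. G \<in> colombeau X \<and>
     (\<forall>u\<in>g. \<forall>O\<^sub>1 W. rel_compact_open O\<^sub>1 X \<and> rel_compact_open W Y \<and>
        gf_supp (X \<times> Y) g \<inter> (O\<^sub>1 \<times> Y) \<subseteq> O\<^sub>1 \<times> W \<longrightarrow>
        gf_restrict O\<^sub>1 G = Cl O\<^sub>1 (\<lambda>\<epsilon> x. LINT y:W|lborel. u \<epsilon> (x, y))))"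

definition integral_op ::
    "'a::euclidean_space set \<Rightarrow> 'b::euclidean_space set
      \<Rightarrow> ('a \<times> 'b, 'k::{real_normed_field, euclidean_space}) genfun
      \<Rightarrow> ('b, 'k) genfun \<Rightarrow> ('a, 'k) genfun" where
  "integral_op X Y H f = gf_integral X Y (gf_mult (X \<times> Y) H (gf_pullback (X \<times> Y) snd f))"

definition kernel_comp ::
    "'a::euclidean_space set \<Rightarrow> 'c::euclidean_space set \<Rightarrow> 'b::euclidean_space set
      \<Rightarrow> ('a \<times> 'c, 'k::{real_normed_field, euclidean_space}) genfun \<Rightarrow> ('c \<times> 'b, 'k) genfun
      \<Rightarrow> ('a \<times> 'b, 'k) genfun" where
  "kernel_comp X \<Xi> Y H\<^sub>1 H\<^sub>2 = gf_integral (X \<times> Y) \<Xi>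
     (gf_mult ((X \<times> Y) \<times> \<Xi>)
        (gf_pullback ((X \<times> Y) \<times> \<Xi>) (\<lambda>((x, y), \<xi>). (x, \<xi>)) H\<^sub>1)
        (gf_pullback ((X \<times> Y) \<times> \<Xi>) (\<lambda>((x, y), \<xi>). (\<xi>, y)) H\<^sub>2))"

end

theory Submission
  imports Defs
begin

text \<open>
  A net belongs to the moderate or the negligible nets iff each iterated derivative has the
  corresponding growth, uniformly on compact sets; explicit formulas for the iterated derivatives
  of products, pullbacks along projections and parameter integrals turn all closure properties
  into estimates. Off the support of \<open>u\<close> the net is negligible, so \<open>\<integral>\<^sub>W u\<^sub>\<epsilon>(x, y) dy\<close> does not
  depend on \<open>W\<close> up to a negligible net, and the local integrals glue to a unique generalized
  function. For the composition, the representatives of \<open>H\<^sub>2\<close> applied to \<open>f\<close> and of \<open>L\<close> are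
  replaced by explicit integrals over relatively compact sets; these agree with the glued nets up
  to negligible ones on slightly larger sets, and the two sides then coincide by Fubini.
\<close>

section \<open>Iterated partial derivatives\<close>

text \<open>A class has no preferred representative, and \<open>gf_integral\<close> describes its
  value only through integrals over sets \<open>W\<close> that vary with the relatively compact open
  set on which one looks. A representative of the inner generalized function is therefore known only
  locally and up to a negligible net, whereas Fubini needs an honest integral over a fixed domain.
  Negligibility is tested on compact sets, so a difference may be dropped under an integral once it
  is negligible on a set containing the closure of the domain of integration; hence the nested pairs
  of sets in the composition argument. Gluing local integrals usually takes cutoff functions. A net,
  however, is only asked to be smooth for each \<epsilon>, with no regularity in \<epsilon>, and
  this freedom is what the gluing exploits. Since support and integral are given by
  \<open>GREATEST\<close> and \<open>THE\<close>, nothing can be said about them before existence is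
  settled; the later lemmas therefore hand over a representative net together with its local
  description.\<close>

lemma iter_deriv_Nil [simp]: "iter_deriv [] f = f"
  by (simp add: iter_deriv_def)

lemma iter_deriv_Cons [simp]: "iter_deriv (b # \<alpha>) f = partial_deriv b (iter_deriv \<alpha> f)"
  by (simp add: iter_deriv_def)

lemma multi_indices_Nil [simp]: "[] \<in> multi_indices"
  by (simp add: multi_indices_def)

lemma multi_indices_Cons [simp]: "b # \<alpha> \<in> multi_indices \<longleftrightarrow> b \<in> Basis \<and> \<alpha> \<in> multi_indices"
  by (simp add: multi_indices_def)

lemma finite_multi_indices: "finite {\<alpha> \<in> multi_indices. length \<alpha> \<le> l}"
  by (rule finite_subset[OF _ finite_lists_length_le[OF finite_Basis, of l]])
    (auto simp: multi_indices_def)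

lemma partial_deriv_eq: "(f has_derivative D) (at x) \<Longrightarrow> partial_deriv b f x = D b"
  unfolding partial_deriv_def using frechet_derivative_at by metis

text \<open>No differentiability is assumed: \<open>frechet_derivative\<close> chooses among all
  derivatives, and near \<open>x\<close> the candidates for \<open>f\<close> and \<open>g\<close>
  are the same, so even the arbitrary values agree.\<close>

lemma partial_deriv_cong:
  assumes "open S" "x \<in> S" "\<And>y. y \<in> S \<Longrightarrow> f y = g y"
  shows "partial_deriv b f x = partial_deriv b g x"
proof -
  have "(f has_derivative D) (at x) \<longleftrightarrow> (g has_derivative D) (at x)" for D
    using has_derivative_transform_within_open[OF _ assms(1,2)] assms(3) by metis
  then show ?thesis by (simp add: partial_deriv_def frechet_derivative_def)
qed

lemma iter_deriv_cong:
  assumes "open S" "\<And>y. y \<in> S \<Longrightarrow> f y = g y" "x \<in> S"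
  shows "iter_deriv \<alpha> f x = iter_deriv \<alpha> g x"
  using assms(3)
proof (induction \<alpha> arbitrary: x)
  case (Cons b \<alpha>)
  show ?case using partial_deriv_cong[OF assms(1) Cons.prems Cons.IH] by simp
qed (simp add: assms)

lemma smooth_on_has_derivative:
  assumes "smooth_on S f" "open S" "\<alpha> \<in> multi_indices" "x \<in> S"
  shows "(iter_deriv \<alpha> f has_derivative frechet_derivative (iter_deriv \<alpha> f) (at x)) (at x)"
  using assms unfolding smooth_on_def
  by (metis at_within_open differentiable_on_def frechet_derivative_works)

lemma smooth_on_continuous:
  "smooth_on S f \<Longrightarrow> \<alpha> \<in> multi_indices \<Longrightarrow> continuous_on S (iter_deriv \<alpha> f)"
  unfolding smooth_on_def using differentiable_imp_continuous_on by blast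

lemma smooth_on_subset: "smooth_on S f \<Longrightarrow> T \<subseteq> S \<Longrightarrow> smooth_on T f"
  unfolding smooth_on_def using differentiable_on_subset by blast

text \<open>
  A family indexed by multi-indices which is closed under differentiation is the family of iterated
  derivatives of its first member; every differentiation rule below is an instance of this.
\<close>

lemma iter_deriv_family:
  assumes S: "open S" and Nil: "\<And>x. x \<in> S \<Longrightarrow> T [] x = f x"
    and step: "\<And>\<alpha> x. \<alpha> \<in> multi_indices \<Longrightarrow> x \<in> S \<Longrightarrow>
      \<exists>D. (T \<alpha> has_derivative D) (at x) \<and> (\<forall>b\<in>Basis. D b = T (b # \<alpha>) x)"
  shows "smooth_on S f"
    and "\<And>\<alpha> x. \<alpha> \<in> multi_indices \<Longrightarrow> x \<in> S \<Longrightarrow> iter_deriv \<alpha> f x = T \<alpha> x"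
proof -
  have eq: "\<forall>x\<in>S. iter_deriv \<alpha> f x = T \<alpha> x" if "\<alpha> \<in> multi_indices" for \<alpha>
    using that
  proof (induction \<alpha>)
    case (Cons b \<alpha>)
    show ?case
    proof
      fix x assume x: "x \<in> S"
      obtain D where "(T \<alpha> has_derivative D) (at x)" "D b = T (b # \<alpha>) x"
        using step[of \<alpha> x] Cons.prems x by auto
      moreover have "partial_deriv b (iter_deriv \<alpha> f) x = partial_deriv b (T \<alpha>) x"
        using Cons by (intro partial_deriv_cong[OF S x]) auto
      ultimately show "iter_deriv (b # \<alpha>) f x = T (b # \<alpha>) x"
        by (simp add: partial_deriv_eq)
    qed
  qed (simp add: Nil)
  then show "\<And>\<alpha> x. \<alpha> \<in> multi_indices \<Longrightarrow> x \<in> S \<Longrightarrow> iter_deriv \<alpha> f x = T \<alpha> x" by blast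
  show "smooth_on S f"
    unfolding smooth_on_def differentiable_on_def
  proof (intro ballI)
    fix \<alpha> :: "'a list" and x assume \<alpha>: "\<alpha> \<in> multi_indices" and x: "x \<in> S"
    obtain D where D: "(T \<alpha> has_derivative D) (at x)" using step \<alpha> x by blast
    have "(iter_deriv \<alpha> f has_derivative D) (at x)"
      by (rule has_derivative_transform_within_open[OF D S x]) (use eq[OF \<alpha>] in auto)
    then show "iter_deriv \<alpha> f differentiable at x within S"
      using differentiable_at_withinI differentiableI by blast
  qed
qed

lemma smooth_on_cong:
  assumes "open S" "smooth_on S f" "\<And>x. x \<in> S \<Longrightarrow> f x = g x"
  shows "smooth_on S g"
proof (rule iter_deriv_family(1)[where T = "\<lambda>\<alpha>. iter_deriv \<alpha> f"])
  fix \<alpha> :: "'a list" and x assume "\<alpha> \<in> multi_indices" "x \<in> S"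
  then show "\<exists>D. (iter_deriv \<alpha> f has_derivative D) (at x) \<and> (\<forall>b\<in>Basis. D b = iter_deriv (b # \<alpha>) f x)"
    by (intro exI[of _ "frechet_derivative (iter_deriv \<alpha> f) (at x)"] conjI
        smooth_on_has_derivative[OF assms(2,1)]) (simp_all add: partial_deriv_def)
qed (use assms in auto)

section \<open>Differentiation rules for differences, products and pullbacks\<close>

lemma iter_deriv_zero:
  assumes "\<alpha> \<in> multi_indices"
  shows "iter_deriv \<alpha> (\<lambda>x. 0) x = 0"
  by (rule iter_deriv_family(2)[where T = "\<lambda>\<alpha> x. 0" and S = UNIV])
    (use assms in \<open>auto intro!: exI[of _ "\<lambda>_. 0"]\<close>)

lemma smooth_on_zero: "smooth_on S (\<lambda>x. 0)"
proof -
  have "smooth_on UNIV (\<lambda>x. 0)"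
    by (rule iter_deriv_family(1)[where T = "\<lambda>\<alpha> x. 0" and S = UNIV])
      (auto intro!: exI[of _ "\<lambda>_. 0"])
  then show ?thesis using smooth_on_subset by blast
qed

lemma
  assumes S: "open S" and f: "smooth_on S f" and g: "smooth_on S g"
  shows smooth_on_diff: "smooth_on S (\<lambda>x. f x - g x)"
    and iter_deriv_diff: "\<And>\<alpha> x. \<alpha> \<in> multi_indices \<Longrightarrow> x \<in> S \<Longrightarrow>
      iter_deriv \<alpha> (\<lambda>x. f x - g x) x = iter_deriv \<alpha> f x - iter_deriv \<alpha> g x"
proof -
  let ?T = "\<lambda>\<alpha> x. iter_deriv \<alpha> f x - iter_deriv \<alpha> g x"
  have "\<exists>D. (?T \<alpha> has_derivative D) (at x) \<and> (\<forall>b\<in>Basis. D b = ?T (b # \<alpha>) x)"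
    if "\<alpha> \<in> multi_indices" "x \<in> S" for \<alpha> x
    by (rule exI, rule conjI, rule has_derivative_diff[OF smooth_on_has_derivative[OF f S that]
        smooth_on_has_derivative[OF g S that]]) (simp add: partial_deriv_def)
  note * = iter_deriv_family[where T = ?T and f = "\<lambda>x. f x - g x", OF S _ this]
  show "smooth_on S (\<lambda>x. f x - g x)" by (rule *) auto
  show "iter_deriv \<alpha> (\<lambda>x. f x - g x) x = iter_deriv \<alpha> f x - iter_deriv \<alpha> g x"
    if "\<alpha> \<in> multi_indices" "x \<in> S" for \<alpha> x by (rule *) (use that in auto)
qed

text \<open>The pairs of complementary sublists of a multi-index are the terms of the Leibniz rule.\<close>

fun splits :: "'a list \<Rightarrow> ('a list \<times> 'a list) list" where
  "splits [] = [([], [])]"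
| "splits (b # \<alpha>) = map (\<lambda>(\<beta>, \<gamma>). (b # \<beta>, \<gamma>)) (splits \<alpha>) @ map (\<lambda>(\<beta>, \<gamma>). (\<beta>, b # \<gamma>)) (splits \<alpha>)"

lemma splits_multi_indices:
  "\<alpha> \<in> multi_indices \<Longrightarrow> i \<in> set (splits \<alpha>) \<Longrightarrow> fst i \<in> multi_indices \<and> snd i \<in> multi_indices"
proof (induction \<alpha> arbitrary: i)
  case (Cons b \<alpha>)
  then show ?case by (auto simp: case_prod_beta)
qed simp

lemma has_derivative_sum_list:
  assumes "\<And>i. i \<in> set xs \<Longrightarrow> (f i has_derivative D i) F"
  shows "((\<lambda>x. \<Sum>i\<leftarrow>xs. f i x) has_derivative (\<lambda>h. \<Sum>i\<leftarrow>xs. D i h)) F"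
  using assms by (induction xs) (auto intro!: has_derivative_add)

lemma
  fixes f g :: "'a::euclidean_space \<Rightarrow> 'k::real_normed_field"
  assumes S: "open S" and f: "smooth_on S f" and g: "smooth_on S g"
  shows smooth_on_mult: "smooth_on S (\<lambda>x. f x * g x)"
    and iter_deriv_mult: "\<And>\<alpha> x. \<alpha> \<in> multi_indices \<Longrightarrow> x \<in> S \<Longrightarrow>
      iter_deriv \<alpha> (\<lambda>x. f x * g x) x = (\<Sum>i\<leftarrow>splits \<alpha>. iter_deriv (fst i) f x * iter_deriv (snd i) g x)"
proof -
  let ?T = "\<lambda>\<alpha> x. \<Sum>i\<leftarrow>splits \<alpha>. iter_deriv (fst i) f x * iter_deriv (snd i) g x"
  have "\<exists>D. (?T \<alpha> has_derivative D) (at x) \<and> (\<forall>b\<in>Basis. D b = ?T (b # \<alpha>) x)"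
    if \<alpha>: "\<alpha> \<in> multi_indices" and x: "x \<in> S" for \<alpha> x
  proof (intro exI conjI ballI)
    let ?D = "\<lambda>i h. iter_deriv (fst i) f x * frechet_derivative (iter_deriv (snd i) g) (at x) h
        + frechet_derivative (iter_deriv (fst i) f) (at x) h * iter_deriv (snd i) g x"
    show "(?T \<alpha> has_derivative (\<lambda>h. \<Sum>i\<leftarrow>splits \<alpha>. ?D i h)) (at x)"
      using splits_multi_indices[OF \<alpha>] x
      by (intro has_derivative_sum_list has_derivative_mult smooth_on_has_derivative[OF f S]
          smooth_on_has_derivative[OF g S]) auto
    fix b :: 'a
    \<comment> \<open>The new direction \<open>b\<close> falls on the first or on the second factor;
      these are the two halves of \<open>splits (b # \<alpha>)\<close>.\<close>
    show "(\<Sum>i\<leftarrow>splits \<alpha>. ?D i b) = ?T (b # \<alpha>) x"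
      by (simp add: comp_def case_prod_beta' sum_list_addf partial_deriv_def add.commute)
  qed
  note * = iter_deriv_family[where T = ?T and f = "\<lambda>x. f x * g x", OF S _ this]
  show "smooth_on S (\<lambda>x. f x * g x)" by (rule *) auto
  show "iter_deriv \<alpha> (\<lambda>x. f x * g x) x = ?T \<alpha> x"
    if "\<alpha> \<in> multi_indices" "x \<in> S" for \<alpha> x by (rule *) (use that in auto)
qed

text \<open>Coordinates are kept, permuted or dropped, so each direction of differentiation is
  either carried to a direction downstairs or killed. The projections that occur in
  \<open>integral_op\<close> and \<open>kernel_comp\<close> are of this kind.\<close>

definition coordinate_projection :: "('a::euclidean_space \<Rightarrow> 'b::euclidean_space) \<Rightarrow> bool" where
  "coordinate_projection \<phi> \<longleftrightarrow> bounded_linear \<phi> \<and> \<phi> ` Basis \<subseteq> insert 0 Basis"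

text \<open>The chain rule for a linear map produces exactly one term. The test
  \<open>map \<phi> \<alpha> \<in> multi_indices\<close> asks whether every direction survives: a
  dropped one becomes 0, which is not a basis vector, and then the derivative vanishes.\<close>

lemma
  assumes R: "open R" and S: "open S" and \<phi>: "coordinate_projection \<phi>" and sub: "\<phi> ` S \<subseteq> R"
    and f: "smooth_on R f"
  shows smooth_on_pullback: "smooth_on S (\<lambda>x. f (\<phi> x))"
    and iter_deriv_pullback: "\<And>\<alpha> x. \<alpha> \<in> multi_indices \<Longrightarrow> x \<in> S \<Longrightarrow>
      iter_deriv \<alpha> (\<lambda>x. f (\<phi> x)) x =
        (if map \<phi> \<alpha> \<in> multi_indices then iter_deriv (map \<phi> \<alpha>) f (\<phi> x) else 0)"
proof -
  let ?T = "\<lambda>\<alpha> x. if map \<phi> \<alpha> \<in> multi_indices then iter_deriv (map \<phi> \<alpha>) f (\<phi> x) else 0"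
  have bl: "bounded_linear \<phi>" and B: "\<And>b. b \<in> Basis \<Longrightarrow> \<phi> b = 0 \<or> \<phi> b \<in> Basis"
    using \<phi> by (auto simp: coordinate_projection_def)
  have "\<exists>D. (?T \<alpha> has_derivative D) (at x) \<and> (\<forall>b\<in>Basis. D b = ?T (b # \<alpha>) x)"
    if \<alpha>: "\<alpha> \<in> multi_indices" and x: "x \<in> S" for \<alpha> x
  proof (cases "map \<phi> \<alpha> \<in> multi_indices")
    case True
    let ?D = "frechet_derivative (iter_deriv (map \<phi> \<alpha>) f) (at (\<phi> x))"
    have D: "(iter_deriv (map \<phi> \<alpha>) f has_derivative ?D) (at (\<phi> x))"
      using sub x by (intro smooth_on_has_derivative[OF f R True]) auto
    have "(?T \<alpha> has_derivative (\<lambda>h. ?D (\<phi> h))) (at x)"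
      using has_derivative_compose[OF bounded_linear_imp_has_derivative[OF bl] D] True by simp
    moreover have "?D (\<phi> b) = ?T (b # \<alpha>) x" if "b \<in> Basis" for b
      using B[OF that]
    proof
      assume "\<phi> b = 0"
      then show ?thesis using linear_0[OF has_derivative_linear[OF D]] nonzero_Basis by auto
    next
      assume "\<phi> b \<in> Basis"
      then show ?thesis using True by (simp add: partial_deriv_def)
    qed
    ultimately show ?thesis by (intro exI[of _ "\<lambda>h. ?D (\<phi> h)"] conjI ballI)
  next
    case False
    \<comment> \<open>A direction that has been dropped remains in the longer list, so both members
      of the family are identically 0.\<close>
    then show ?thesis by (intro exI[of _ "\<lambda>_. 0"]) simp
  qed
  note * = iter_deriv_family[where T = ?T and f = "\<lambda>x. f (\<phi> x)", OF S _ this]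
  show "smooth_on S (\<lambda>x. f (\<phi> x))" by (rule *) auto
  show "iter_deriv \<alpha> (\<lambda>x. f (\<phi> x)) x = ?T \<alpha> x"
    if "\<alpha> \<in> multi_indices" "x \<in> S" for \<alpha> x by (rule *) (use that in auto)
qed

section \<open>Integrals depending on a parameter\<close>

text \<open>The domain \<open>A\<close> will be an open set or a difference of open sets, on which
  continuity alone gives no integrability; it is inherited from the compact set \<open>C\<close>
  around it.\<close>

lemma set_integrable_section:
  fixes F :: "'a::euclidean_space \<times> 'b::euclidean_space \<Rightarrow> 'k::{banach, second_countable_topology}"
  assumes "continuous_on (X \<times> C) F" "compact C" "A \<subseteq> C" "A \<in> sets lborel" "x \<in> X"
  shows "set_integrable lborel A (\<lambda>y. F (x, y))"
proof (rule set_integrable_subset)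
  show "set_integrable lborel C (\<lambda>y. F (x, y))"
    unfolding set_integrable_def using assms
    by (intro borel_integrable_compact continuous_on_compose2[OF assms(1)] continuous_intros) auto
qed (use assms in auto)

lemma emeasure_subset_compact: "compact C \<Longrightarrow> A \<subseteq> C \<Longrightarrow> emeasure lborel A < \<infinity>"
  by (meson bounded_subset compact_imp_bounded emeasure_bounded_finite)

lemma norm_set_integral_le:
  fixes f :: "'b::euclidean_space \<Rightarrow> 'k::{banach, second_countable_topology}"
  assumes f: "set_integrable lborel A f" and A: "A \<in> sets lborel" "emeasure lborel A < \<infinity>"
    and B: "\<And>y. y \<in> A \<Longrightarrow> norm (f y) \<le> B"
  shows "norm (LINT y:A|lborel. f y) \<le> measure lborel A * B"
proof -
  have "norm (LINT y:A|lborel. f y) \<le> (LINT y:A|lborel. norm (f y))"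
    by (rule set_integral_norm_bound[OF f])
  also have "\<dots> \<le> (LINT y:A|lborel. B)"
    using A B f by (intro set_integral_mono set_integrable_norm) (auto simp: set_integrable_def)
  also have "\<dots> = measure lborel A * B"
    using A by (simp add: set_lebesgue_integral_def)
  finally show ?thesis .
qed

text \<open>Differentiation under the integral sign with an estimate in place of dominated
  convergence: the partial derivatives are uniformly continuous on a compact neighbourhood, so the
  mean value inequality bounds the linearization error of \<open>F\<close> uniformly in
  \<open>y\<close>, and this bound is integrated over \<open>A\<close>.\<close>

lemma has_derivative_parameter_integral:
  fixes F :: "'a::euclidean_space \<times> 'b::euclidean_space \<Rightarrow> 'k::{banach, second_countable_topology}"
  assumes X: "open X" "x \<in> X" and C: "compact C" "A \<subseteq> C" "A \<in> sets lborel"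
    and F: "continuous_on (X \<times> C) F"
    and D: "\<And>b. b \<in> Basis \<Longrightarrow> continuous_on (X \<times> C) (D b)"
    and der: "\<And>x y. x \<in> X \<Longrightarrow> y \<in> C \<Longrightarrow>
      ((\<lambda>x. F (x, y)) has_derivative (\<lambda>h. \<Sum>b\<in>Basis. (h \<bullet> b) *\<^sub>R D b (x, y))) (at x)"
  shows "((\<lambda>x. LINT y:A|lborel. F (x, y)) has_derivative
    (\<lambda>h. \<Sum>b\<in>Basis. (h \<bullet> b) *\<^sub>R (LINT y:A|lborel. D b (x, y)))) (at x)"
  unfolding has_derivative_at_alt
proof (intro conjI allI impI)
  show "bounded_linear (\<lambda>h. \<Sum>b\<in>Basis. (h \<bullet> b) *\<^sub>R (LINT y:A|lborel. D b (x, y)))"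
    by (intro bounded_linear_sum bounded_linear_scaleR_const bounded_linear_inner_left)
  fix e :: real assume "e > 0"
  define m where "m = measure lborel A"
  \<comment> \<open>The measure of \<open>A\<close> enters through the integration and
    \<open>DIM('a)\<close> through the sum over the basis; \<open>m + 1\<close> keeps the
    denominator positive when \<open>A\<close> is a null set.\<close>
  define e' where "e' = e / (m + 1) / DIM('a)"
  have m: "m \<ge> 0" by (simp add: m_def)
  have "m * (e / (m + 1)) \<le> e"
    using \<open>e > 0\<close> m by (simp add: pos_divide_le_eq mult.commute)
  then have e': "e' > 0" "m * (e' * DIM('a)) \<le> e"
    using \<open>e > 0\<close> m by (simp_all add: e'_def)
  \<comment> \<open>With a closed ball, \<open>cball x r \<times> C\<close> is compact and each
    \<open>D b\<close> is uniformly continuous on it.\<close>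
  obtain r where r: "r > 0" "cball x r \<subseteq> X" using X open_contains_cball by blast
  have "\<forall>\<^sub>F x' in nhds x. \<forall>y\<in>C. norm (D b (x', y) - D b (x, y)) \<le> e'" if b: "b \<in> Basis" for b
  proof -
    have "uniformly_continuous_on (cball x r \<times> C) (D b)"
      using C r by (intro compact_uniformly_continuous continuous_on_subset[OF D[OF b]] compact_Times) auto
    then obtain d where d: "d > 0" "\<And>z z'. z \<in> cball x r \<times> C \<Longrightarrow> z' \<in> cball x r \<times> C \<Longrightarrow>
        dist z' z < d \<Longrightarrow> dist (D b z') (D b z) < e'"
      using e'(1) unfolding uniformly_continuous_on_def by metis
    have "norm (D b (x', y) - D b (x, y)) \<le> e'" if "dist x' x < min d r" "y \<in> C" for x' y
      using d(2)[of "(x, y)" "(x', y)"] that r(1) by (auto simp: dist_Pair_Pair dist_norm norm_minus_commute)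
    then show ?thesis
      unfolding eventually_nhds_metric using d(1) r(1) by (intro exI[of _ "min d r"]) auto
  qed
  then have "\<forall>\<^sub>F x' in nhds x. \<forall>b\<in>Basis. \<forall>y\<in>C. norm (D b (x', y) - D b (x, y)) \<le> e'"
    by (simp add: eventually_ball_finite_distrib)
  then obtain d where d: "d > 0" "\<And>x' b y. dist x' x < d \<Longrightarrow> b \<in> Basis \<Longrightarrow> y \<in> C \<Longrightarrow>
      norm (D b (x', y) - D b (x, y)) \<le> e'"
    unfolding eventually_nhds_metric by blast
  let ?L = "\<lambda>h y. \<Sum>b\<in>Basis. (h \<bullet> b) *\<^sub>R D b (x, y)"
  have "norm ((LINT y:A|lborel. F (x', y)) - (LINT y:A|lborel. F (x, y))
      - (\<Sum>b\<in>Basis. ((x' - x) \<bullet> b) *\<^sub>R (LINT y:A|lborel. D b (x, y)))) \<le> e * norm (x' - x)"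
    if x': "norm (x' - x) < min d r" for x'
  proof -
    have x'X: "x' \<in> X" using x' r by (auto simp: subset_iff dist_norm norm_minus_commute)
    have bound: "norm (F (x', y) - F (x, y) - ?L (x' - x) y) \<le> e' * DIM('a) * norm (x' - x)"
      if y: "y \<in> C" for y
    proof -
      let ?S = "ball x (min d r)"
      have S: "z \<in> X" "dist z x < d" if "z \<in> ?S" for z
        using that r by (auto simp: subset_iff dist_commute)
      \<comment> \<open>The mean value inequality is applied to \<open>F\<close> minus its linear
        part at \<open>x\<close>; the derivative of this difference at \<open>z\<close> is the
        deviation of the partial derivatives at \<open>z\<close> from those at \<open>x\<close>,
        which is small on the ball.\<close>
      have "norm ((F (x', y) - ?L x' y) - (F (x, y) - ?L x y)) \<le> e' * DIM('a) * norm (x' - x)"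
      proof (rule differentiable_bound)
        show "convex ?S" by simp
        show "x' \<in> ?S" "x \<in> ?S" using x' d(1) r(1) by (auto simp: dist_norm norm_minus_commute)
        fix z assume z: "z \<in> ?S"
        show "((\<lambda>z. F (z, y) - ?L z y) has_derivative
            (\<lambda>h. (\<Sum>b\<in>Basis. (h \<bullet> b) *\<^sub>R D b (z, y)) - ?L h y)) (at z within ?S)"
          by (rule has_derivative_diff[OF has_derivative_at_withinI[OF der[OF S(1)[OF z] y]]])
            (intro bounded_linear_imp_has_derivative bounded_linear_sum
              bounded_linear_scaleR_const bounded_linear_inner_left)
        show "onorm (\<lambda>h. (\<Sum>b\<in>Basis. (h \<bullet> b) *\<^sub>R D b (z, y)) - ?L h y) \<le> e' * DIM('a)"
        proof (rule onorm_le)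
          fix h :: 'a
          have "norm ((\<Sum>b\<in>Basis. (h \<bullet> b) *\<^sub>R D b (z, y)) - ?L h y)
              = norm (\<Sum>b\<in>Basis. (h \<bullet> b) *\<^sub>R (D b (z, y) - D b (x, y)))"
            by (simp add: scaleR_diff_right sum_subtractf)
          also have "\<dots> \<le> (\<Sum>b\<in>(Basis::'a set). norm h * e')"
            using d(2)[OF S(2)[OF z] _ y] 
            by (intro sum_norm_le) (auto intro!: mult_mono simp: Basis_le_norm)
          finally show "norm ((\<Sum>b\<in>Basis. (h \<bullet> b) *\<^sub>R D b (z, y)) - ?L h y) \<le> e' * DIM('a) * norm h"
            by (simp add: ac_simps)
        qed
      qed
      then show ?thesis
        by (simp add: inner_diff_left scaleR_diff_left sum_subtractf algebra_simps)
    qed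
    have iF: "set_integrable lborel A (\<lambda>y. F (z, y))" if "z \<in> X" for z
      by (rule set_integrable_section[OF F C that])
    have iD: "set_integrable lborel A (\<lambda>y. c *\<^sub>R D b (x, y))" if "b \<in> Basis" for b c
      by (intro set_integrable_scaleR_right set_integrable_section[OF D[OF that] C X(2)])
    have iL: "set_integrable lborel A (?L h)" for h
      using iD by (simp add: set_integrable_def scaleR_sum_right)
    have "(LINT y:A|lborel. ?L h y) = (\<Sum>b\<in>Basis. (h \<bullet> b) *\<^sub>R (LINT y:A|lborel. D b (x, y)))" for h
    proof -
      have "(LINT y:A|lborel. ?L h y) = (\<Sum>b\<in>Basis. LINT y:A|lborel. (h \<bullet> b) *\<^sub>R D b (x, y))"
        unfolding set_lebesgue_integral_def scaleR_sum_right
        by (rule Bochner_Integration.integral_sum) (use iD in \<open>simp add: set_integrable_def\<close>)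
      then show ?thesis by simp
    qed
    then have "(LINT y:A|lborel. F (x', y)) - (LINT y:A|lborel. F (x, y))
        - (\<Sum>b\<in>Basis. ((x' - x) \<bullet> b) *\<^sub>R (LINT y:A|lborel. D b (x, y)))
        = (LINT y:A|lborel. F (x', y) - F (x, y) - ?L (x' - x) y)"
      using iF[OF x'X] iF[OF X(2)] iL by (simp add: set_integral_diff)
    also have "norm \<dots> \<le> m * (e' * DIM('a) * norm (x' - x))"
      unfolding m_def using iF[OF x'X] iF[OF X(2)] iL C bound
      by (intro norm_set_integral_le set_integral_diff emeasure_subset_compact[OF C(1)]) auto
    also have "\<dots> \<le> e * norm (x' - x)"
      using mult_right_mono[OF e'(2), of "norm (x' - x)"] by (simp add: ac_simps)
    finally show ?thesis .
  qed
  then show "\<exists>d>0. \<forall>x'. norm (x' - x) < d \<longrightarrow>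
      norm ((LINT y:A|lborel. F (x', y)) - (LINT y:A|lborel. F (x, y))
      - (\<Sum>b\<in>Basis. ((x' - x) \<bullet> b) *\<^sub>R (LINT y:A|lborel. D b (x, y)))) \<le> e * norm (x' - x)"
    using d(1) r(1) by (intro exI[of _ "min d r"]) auto
qed

abbreviation lift_fst :: "'a::euclidean_space list \<Rightarrow> ('a \<times> 'b::euclidean_space) list" where
  "lift_fst \<equiv> map (\<lambda>b. (b, 0))"

lemma lift_fst_multi_indices: "\<alpha> \<in> multi_indices \<Longrightarrow> lift_fst \<alpha> \<in> multi_indices"
  by (induction \<alpha>) (auto simp: Basis_prod_def)

text \<open>All derivatives of \<open>F\<close> are continuous on \<open>X \<times> C\<close>, so
  the differentiation under the integral can be repeated at every order, each direction
  \<open>b\<close> becoming \<open>(b, 0)\<close> inside the integral.\<close>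

lemma
  fixes F :: "'a::euclidean_space \<times> 'b::euclidean_space \<Rightarrow> 'k::{banach, second_countable_topology}"
  assumes X: "open X" and Y: "open Y" and C: "compact C" "A \<subseteq> C" "A \<in> sets lborel" "C \<subseteq> Y"
    and F: "smooth_on (X \<times> Y) F"
  shows smooth_on_integral: "smooth_on X (\<lambda>x. LINT y:A|lborel. F (x, y))"
    and iter_deriv_integral: "\<And>\<alpha> x. \<alpha> \<in> multi_indices \<Longrightarrow> x \<in> X \<Longrightarrow>
      iter_deriv \<alpha> (\<lambda>x. LINT y:A|lborel. F (x, y)) x = (LINT y:A|lborel. iter_deriv (lift_fst \<alpha>) F (x, y))"
proof -
  let ?T = "\<lambda>\<alpha> x. LINT y:A|lborel. iter_deriv (lift_fst \<alpha>) F (x, y)"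
  have cont: "continuous_on (X \<times> C) (iter_deriv \<alpha> F)" if "\<alpha> \<in> multi_indices" for \<alpha>
    by (rule continuous_on_subset[OF smooth_on_continuous[OF F that]]) (use C(4) in auto)
  have "\<exists>D. (?T \<alpha> has_derivative D) (at x) \<and> (\<forall>b\<in>Basis. D b = ?T (b # \<alpha>) x)"
    if \<alpha>: "\<alpha> \<in> multi_indices" and x: "x \<in> X" for \<alpha> x
  proof (intro exI conjI ballI)
    let ?G = "iter_deriv (lift_fst \<alpha>) F" and ?D = "\<lambda>b. iter_deriv (lift_fst (b # \<alpha>)) F"
    show "(?T \<alpha> has_derivative (\<lambda>h. \<Sum>b\<in>Basis. (h \<bullet> b) *\<^sub>R (LINT y:A|lborel. ?D b (x, y)))) (at x)"
    proof (rule has_derivative_parameter_integral[OF X x C(1-3)])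
      show "continuous_on (X \<times> C) ?G" by (rule cont[OF lift_fst_multi_indices[OF \<alpha>]])
      show "continuous_on (X \<times> C) (?D b)" if "b \<in> Basis" for b
        by (rule cont) (use that \<alpha> in \<open>auto intro!: lift_fst_multi_indices simp: Basis_prod_def\<close>)
      fix x y assume xy: "x \<in> X" "y \<in> C"
      let ?g = "frechet_derivative ?G (at (x, y))"
      have g: "(?G has_derivative ?g) (at (x, y))"
        using xy C(4) by (intro smooth_on_has_derivative[OF F] open_Times X Y lift_fst_multi_indices \<alpha>) auto
      have "((\<lambda>x. ?G (x, y)) has_derivative (\<lambda>h. ?g (h, 0))) (at x)"
        by (rule has_derivative_compose[where f = "\<lambda>x. (x, y)" and g = ?G, OF _ g])
          (auto intro!: derivative_eq_intros)
      \<comment> \<open>The total derivative of the integrand, restricted to horizontal vectors, is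
        expanded in the basis; its coefficients are the next members of the family.\<close>
      moreover have "?g (h, 0) = (\<Sum>b\<in>Basis. (h \<bullet> b) *\<^sub>R ?D b (x, y))" for h
      proof -
        have lin: "linear (\<lambda>h::'a. ?g (h, 0))"
          using linear_compose[OF _ has_derivative_linear[OF g], of "\<lambda>h. (h, 0)"]
          by (simp add: o_def linear_iff)
        have "?g (h, 0) = ?g ((\<Sum>b\<in>Basis. (h \<bullet> b) *\<^sub>R b), 0)" by (simp add: euclidean_representation)
        also have "\<dots> = (\<Sum>b\<in>Basis. ?g ((h \<bullet> b) *\<^sub>R b, 0))"
          by (rule linear_sum[OF lin])
        also have "\<dots> = (\<Sum>b\<in>Basis. (h \<bullet> b) *\<^sub>R ?g (b, 0))"
          by (rule sum.cong[OF refl linear_scale[OF lin]])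
        finally show ?thesis by (simp add: partial_deriv_def)
      qed
      ultimately show "((\<lambda>x. ?G (x, y)) has_derivative (\<lambda>h. \<Sum>b\<in>Basis. (h \<bullet> b) *\<^sub>R ?D b (x, y))) (at x)"
        by simp
    qed
    fix b :: 'a assume "b \<in> Basis"
    then show "(\<Sum>b'\<in>Basis. (b \<bullet> b') *\<^sub>R (LINT y:A|lborel. ?D b' (x, y))) = ?T (b # \<alpha>) x"
      by (simp add: inner_Basis if_distrib[of "\<lambda>c. c *\<^sub>R _"] cong: if_cong)
  qed
  note * = iter_deriv_family[where T = ?T and f = "\<lambda>x. LINT y:A|lborel. F (x, y)", OF X _ this]
  show "smooth_on X (\<lambda>x. LINT y:A|lborel. F (x, y))" by (rule *) auto
  show "iter_deriv \<alpha> (\<lambda>x. LINT y:A|lborel. F (x, y)) x = ?T \<alpha> x"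
    if "\<alpha> \<in> multi_indices" "x \<in> X" for \<alpha> x by (rule *) (use that in auto)
qed

section \<open>Moderate and negligible nets\<close>

text \<open>The Landau constant is missing on purpose: as \<epsilon> tends to 0, one further power
  of \<epsilon> absorbs any constant, here and in \<open>negligible_bound\<close>. Smoothness is
  left out as well, so that both notions apply to each derivative separately.\<close>

definition moderate_bound :: "'a set \<Rightarrow> (real \<Rightarrow> 'a \<Rightarrow> 'k::real_normed_vector) \<Rightarrow> bool" where
  "moderate_bound K w \<longleftrightarrow> (\<exists>n. \<forall>\<^sub>F \<epsilon> in at_right 0. \<forall>x\<in>K. norm (w \<epsilon> x) \<le> (1 / \<epsilon>) ^ n)"

definition negligible_bound :: "'a set \<Rightarrow> (real \<Rightarrow> 'a \<Rightarrow> 'k::real_normed_vector) \<Rightarrow> bool" where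
  "negligible_bound K w \<longleftrightarrow> (\<forall>n. \<forall>\<^sub>F \<epsilon> in at_right 0. \<forall>x\<in>K. norm (w \<epsilon> x) \<le> \<epsilon> ^ n)"

lemma eventually_at_right_0_le: "0 < d \<Longrightarrow> \<forall>\<^sub>F \<epsilon> in at_right (0::real). \<epsilon> \<in> {0<..d}"
  unfolding eventually_at_right_field by (intro exI[of _ d]) auto

text \<open>This is how constants are absorbed: below the threshold
  \<open>1 / (\<bar>c\<bar> + 1)\<close>, positive for every \<open>c\<close>, one factor \<epsilon>
  outweighs \<open>c\<close>.\<close>

lemma eventually_at_right_0_mult_le: "\<forall>\<^sub>F \<epsilon> in at_right (0::real). \<epsilon> \<in> {0<..1} \<and> c * \<epsilon> \<le> 1"
proof -
  have *: "c * \<epsilon> \<le> 1" if "\<epsilon> \<in> {0<..1 / (\<bar>c\<bar> + 1)}" for \<epsilon>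
  proof -
    have "c * \<epsilon> \<le> (\<bar>c\<bar> + 1) * \<epsilon>" using that by (intro mult_right_mono) auto
    also have "\<dots> \<le> (\<bar>c\<bar> + 1) * (1 / (\<bar>c\<bar> + 1))" using that by (intro mult_left_mono) auto
    finally show ?thesis by (simp add: add_nonneg_eq_0_iff)
  qed
  have "0 < 1 / (\<bar>c\<bar> + 1)" by (simp add: add_nonneg_pos)
  from eventually_at_right_0_le[OF this] eventually_at_right_0_le[OF zero_less_one] show ?thesis
    by eventually_elim (use * in blast)
qed

lemma power_inverse_mono: "0 < \<epsilon> \<Longrightarrow> \<epsilon> \<le> 1 \<Longrightarrow> n \<le> m \<Longrightarrow> (1 / \<epsilon>) ^ n \<le> (1 / \<epsilon>) ^ m" for \<epsilon> :: real
  by (intro power_increasing) (auto simp: field_simps)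

lemma moderate_boundI:
  assumes "\<forall>\<^sub>F \<epsilon> in at_right 0. \<forall>x\<in>K. norm (w \<epsilon> x) \<le> c * (1 / \<epsilon>) ^ n"
  shows "moderate_bound K w"
  unfolding moderate_bound_def
proof (rule exI[of _ "Suc n"], use assms eventually_at_right_0_mult_le[of c] in eventually_elim)
  case (elim \<epsilon>)
  then have "c * (1 / \<epsilon>) ^ n \<le> (1 / \<epsilon>) ^ Suc n"
    by (simp add: field_simps)
  with elim show ?case by (blast intro: order_trans)
qed

lemma negligible_boundI:
  assumes "\<And>n. \<forall>\<^sub>F \<epsilon> in at_right 0. \<forall>x\<in>K. norm (w \<epsilon> x) \<le> c * \<epsilon> ^ n"
  shows "negligible_bound K w"
  unfolding negligible_bound_def
proof (rule allI)
  fix n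
  show "\<forall>\<^sub>F \<epsilon> in at_right 0. \<forall>x\<in>K. norm (w \<epsilon> x) \<le> \<epsilon> ^ n"
    using assms[of "Suc n"] eventually_at_right_0_mult_le[of c]
  proof eventually_elim
    case (elim \<epsilon>)
    then have "c * \<epsilon> ^ Suc n \<le> \<epsilon> ^ n"
      using mult_right_mono[of "c * \<epsilon>" 1 "\<epsilon> ^ n"] by (simp add: ac_simps)
    with elim show ?case by (blast intro: order_trans)
  qed
qed

text \<open>The comparison is made for one \<epsilon> at a time and for an arbitrary bound
  \<open>B\<close>, so one estimate serves both moderateness and negligibility, and \<open>K\<close>
  and \<open>K'\<close> may lie in different spaces. The premise \<open>0 \<le> B\<close> is
  supplied because over an empty \<open>K\<close> it would not follow from the bound.\<close>

lemma moderate_bound_dominated: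
  assumes w: "moderate_bound K w"
    and dom: "\<And>\<epsilon> B. \<epsilon> \<in> {0<..1} \<Longrightarrow> (\<And>x. x \<in> K \<Longrightarrow> norm (w \<epsilon> x) \<le> B) \<Longrightarrow> 0 \<le> B \<Longrightarrow>
      \<forall>x\<in>K'. norm (w' \<epsilon> x) \<le> c * B"
  shows "moderate_bound K' w'"
proof -
  obtain n where "\<forall>\<^sub>F \<epsilon> in at_right 0. \<forall>x\<in>K. norm (w \<epsilon> x) \<le> (1 / \<epsilon>) ^ n"
    using w by (auto simp: moderate_bound_def)
  then have "\<forall>\<^sub>F \<epsilon> in at_right 0. \<forall>x\<in>K'. norm (w' \<epsilon> x) \<le> c * (1 / \<epsilon>) ^ n"
    using eventually_at_right_0_le[OF zero_less_one]
  proof eventually_elim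
    case (elim \<epsilon>)
    then show ?case by (intro dom) auto
  qed
  then show ?thesis by (rule moderate_boundI)
qed

lemma negligible_bound_dominated:
  assumes w: "negligible_bound K w"
    and dom: "\<And>\<epsilon> B. \<epsilon> \<in> {0<..1} \<Longrightarrow> (\<And>x. x \<in> K \<Longrightarrow> norm (w \<epsilon> x) \<le> B) \<Longrightarrow> 0 \<le> B \<Longrightarrow>
      \<forall>x\<in>K'. norm (w' \<epsilon> x) \<le> c * B"
  shows "negligible_bound K' w'"
proof (rule negligible_boundI)
  fix n
  have "\<forall>\<^sub>F \<epsilon> in at_right 0. \<forall>x\<in>K. norm (w \<epsilon> x) \<le> \<epsilon> ^ n"
    using w by (auto simp: negligible_bound_def)
  then show "\<forall>\<^sub>F \<epsilon> in at_right 0. \<forall>x\<in>K'. norm (w' \<epsilon> x) \<le> c * \<epsilon> ^ n"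
    using eventually_at_right_0_le[OF zero_less_one]
  proof eventually_elim
    case (elim \<epsilon>)
    then show ?case by (intro dom) auto
  qed
qed

lemma moderate_bound_cong:
  assumes "moderate_bound K w" "\<And>\<epsilon> x. \<epsilon> \<in> {0<..1} \<Longrightarrow> x \<in> K \<Longrightarrow> w' \<epsilon> x = w \<epsilon> x"
  shows "moderate_bound K w'"
  by (rule moderate_bound_dominated[OF assms(1), of _ _ 1]) (use assms(2) in auto)

lemma negligible_bound_cong:
  assumes "negligible_bound K w" "\<And>\<epsilon> x. \<epsilon> \<in> {0<..1} \<Longrightarrow> x \<in> K \<Longrightarrow> w' \<epsilon> x = w \<epsilon> x"
  shows "negligible_bound K w'"
  by (rule negligible_bound_dominated[OF assms(1), of _ _ 1]) (use assms(2) in auto)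

lemma negligible_bound_subset: "negligible_bound K w \<Longrightarrow> K' \<subseteq> K \<Longrightarrow> negligible_bound K' w"
  by (rule negligible_bound_dominated[of K w _ _ 1]) auto

lemma negligible_bound_zero: "negligible_bound K (\<lambda>\<epsilon> x. 0 :: 'k::real_normed_vector)"
  unfolding negligible_bound_def
proof
  fix n
  show "\<forall>\<^sub>F \<epsilon> in at_right 0. \<forall>x\<in>K. norm (0::'k) \<le> \<epsilon> ^ n"
    using eventually_at_right_0_le[OF zero_less_one] by eventually_elim simp
qed

text \<open>The two scales meet at exponent 0, where both bounds read 1.\<close>

lemma negligible_imp_moderate_bound: "negligible_bound K w \<Longrightarrow> moderate_bound K w"
  unfolding negligible_bound_def moderate_bound_def by (drule spec[of _ 0], rule exI[of _ 0]) simp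

lemma moderate_bound_add:
  assumes "moderate_bound K w" "moderate_bound K w'"
  shows "moderate_bound K (\<lambda>\<epsilon> x. w \<epsilon> x + w' \<epsilon> x)"
proof -
  obtain n n' where n: "\<forall>\<^sub>F \<epsilon> in at_right 0. \<forall>x\<in>K. norm (w \<epsilon> x) \<le> (1 / \<epsilon>) ^ n"
      "\<forall>\<^sub>F \<epsilon> in at_right 0. \<forall>x\<in>K. norm (w' \<epsilon> x) \<le> (1 / \<epsilon>) ^ n'"
    using assms by (auto simp: moderate_bound_def)
  show ?thesis
  proof (rule moderate_boundI[where c = 2 and n = "max n n'"],
      use n eventually_at_right_0_le[OF zero_less_one] in eventually_elim)
    case (elim \<epsilon>)
    then have "(1 / \<epsilon>) ^ n \<le> (1 / \<epsilon>) ^ max n n'" "(1 / \<epsilon>) ^ n' \<le> (1 / \<epsilon>) ^ max n n'"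
      by (auto intro!: power_inverse_mono)
    with elim show ?case unfolding mult_2
      by (intro ballI norm_triangle_le add_mono) (blast intro: order_trans)+
  qed
qed

lemma negligible_bound_add:
  assumes "negligible_bound K w" "negligible_bound K w'"
  shows "negligible_bound K (\<lambda>\<epsilon> x. w \<epsilon> x + w' \<epsilon> x)"
proof (rule negligible_boundI[where c = 2])
  fix n
  have "\<forall>\<^sub>F \<epsilon> in at_right 0. \<forall>x\<in>K. norm (w \<epsilon> x) \<le> \<epsilon> ^ n" "\<forall>\<^sub>F \<epsilon> in at_right 0. \<forall>x\<in>K. norm (w' \<epsilon> x) \<le> \<epsilon> ^ n"
    using assms by (auto simp: negligible_bound_def)
  then show "\<forall>\<^sub>F \<epsilon> in at_right 0. \<forall>x\<in>K. norm (w \<epsilon> x + w' \<epsilon> x) \<le> 2 * \<epsilon> ^ n"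
    unfolding mult_2 by eventually_elim (intro ballI norm_triangle_le add_mono; blast)
qed

lemma moderate_bound_minus: "moderate_bound K w \<Longrightarrow> moderate_bound K (\<lambda>\<epsilon> x. - w \<epsilon> x)"
  by (simp add: moderate_bound_def)

lemma negligible_bound_minus: "negligible_bound K w \<Longrightarrow> negligible_bound K (\<lambda>\<epsilon> x. - w \<epsilon> x)"
  by (simp add: negligible_bound_def)

lemma moderate_bound_diff:
  "moderate_bound K w \<Longrightarrow> moderate_bound K w' \<Longrightarrow> moderate_bound K (\<lambda>\<epsilon> x. w \<epsilon> x - w' \<epsilon> x)"
  using moderate_bound_add[of K w "\<lambda>\<epsilon> x. - w' \<epsilon> x"] by (simp add: moderate_bound_minus)

lemma negligible_bound_diff:
  "negligible_bound K w \<Longrightarrow> negligible_bound K w' \<Longrightarrow> negligible_bound K (\<lambda>\<epsilon> x. w \<epsilon> x - w' \<epsilon> x)"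
  using negligible_bound_add[of K w "\<lambda>\<epsilon> x. - w' \<epsilon> x"] by (simp add: negligible_bound_minus)

lemma moderate_bound_mult:
  fixes w w' :: "real \<Rightarrow> 'a \<Rightarrow> 'k::real_normed_field"
  assumes "moderate_bound K w" "moderate_bound K w'"
  shows "moderate_bound K (\<lambda>\<epsilon> x. w \<epsilon> x * w' \<epsilon> x)"
proof -
  obtain n n' where n: "\<forall>\<^sub>F \<epsilon> in at_right 0. \<forall>x\<in>K. norm (w \<epsilon> x) \<le> (1 / \<epsilon>) ^ n"
      "\<forall>\<^sub>F \<epsilon> in at_right 0. \<forall>x\<in>K. norm (w' \<epsilon> x) \<le> (1 / \<epsilon>) ^ n'"
    using assms by (auto simp: moderate_bound_def)
  show ?thesis
    unfolding moderate_bound_def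
  proof (rule exI[of _ "n + n'"], use n eventually_at_right_0_le[OF zero_less_one] in eventually_elim)
    case (elim \<epsilon>)
    then show ?case unfolding norm_mult power_add by (intro ballI mult_mono) auto
  qed
qed

lemma negligible_bound_mult:
  fixes w w' :: "real \<Rightarrow> 'a \<Rightarrow> 'k::real_normed_field"
  assumes "negligible_bound K w" "moderate_bound K w'"
  shows "negligible_bound K (\<lambda>\<epsilon> x. w \<epsilon> x * w' \<epsilon> x)"
proof -
  obtain n' where n': "\<forall>\<^sub>F \<epsilon> in at_right 0. \<forall>x\<in>K. norm (w' \<epsilon> x) \<le> (1 / \<epsilon>) ^ n'"
    using assms by (auto simp: moderate_bound_def)
  show ?thesis
    unfolding negligible_bound_def
  proof
    fix n
    \<comment> \<open>The surplus \<open>n'\<close> in the exponent pays for the growth of the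
      moderate factor.\<close>
    have "\<forall>\<^sub>F \<epsilon> in at_right 0. \<forall>x\<in>K. norm (w \<epsilon> x) \<le> \<epsilon> ^ (n + n')"
      using assms by (auto simp: negligible_bound_def)
    then show "\<forall>\<^sub>F \<epsilon> in at_right 0. \<forall>x\<in>K. norm (w \<epsilon> x * w' \<epsilon> x) \<le> \<epsilon> ^ n"
      using n' eventually_at_right_0_le[OF zero_less_one]
    proof eventually_elim
      case (elim \<epsilon>)
      then have "norm (w \<epsilon> x) * norm (w' \<epsilon> x) \<le> \<epsilon> ^ (n + n') * (1 / \<epsilon>) ^ n'" if "x \<in> K" for x
        using that by (intro mult_mono) auto
      moreover have "\<epsilon> ^ (n + n') * (1 / \<epsilon>) ^ n' = \<epsilon> ^ n"
        using elim by (simp add: power_add power_one_over)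
      ultimately show ?case by (simp add: norm_mult)
    qed
  qed
qed

lemma moderate_bound_sum_list:
  "(\<And>i. i \<in> set xs \<Longrightarrow> moderate_bound K (w i)) \<Longrightarrow> moderate_bound K (\<lambda>\<epsilon> x. \<Sum>i\<leftarrow>xs. w i \<epsilon> x)"
  by (induction xs)
    (auto intro!: moderate_bound_add intro: negligible_imp_moderate_bound negligible_bound_zero)

lemma negligible_bound_sum_list:
  "(\<And>i. i \<in> set xs \<Longrightarrow> negligible_bound K (w i)) \<Longrightarrow> negligible_bound K (\<lambda>\<epsilon> x. \<Sum>i\<leftarrow>xs. w i \<epsilon> x)"
  by (induction xs) (auto intro!: negligible_bound_add negligible_bound_zero)

section \<open>From seminorms to bounds on single derivatives\<close>

lemma norm_le_seminorm:
  assumes K: "compact K" "K \<subseteq> \<Omega>" and f: "smooth_on \<Omega> f"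
    and \<alpha>: "\<alpha> \<in> multi_indices" "length \<alpha> \<le> l" and x: "x \<in> K"
  shows "norm (iter_deriv \<alpha> f x) \<le> seminorm K l f"
  unfolding seminorm_def
proof (rule cSup_upper)
  show "norm (iter_deriv \<alpha> f x) \<in> insert 0 {norm (iter_deriv \<alpha> f x) | x \<alpha>. x \<in> K \<and> \<alpha> \<in> multi_indices \<and> length \<alpha> \<le> l}"
    using \<alpha> x by blast
  \<comment> \<open>A real supremum is an upper bound only for a set that is bounded above.
    Continuity on the compact set \<open>K\<close> bounds one derivative, and only finitely many
    lists have length at most \<open>l\<close>.\<close>
  have "bdd_above ((\<lambda>x. norm (iter_deriv \<beta> f x)) ` K)" if "\<beta> \<in> multi_indices" for \<beta>
    using K that
    by (intro bounded_imp_bdd_above compact_imp_bounded compact_continuous_image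
        continuous_on_norm continuous_on_subset[OF smooth_on_continuous[OF f]])
  then have "bdd_above (\<Union>\<beta>\<in>{\<beta> \<in> multi_indices. length \<beta> \<le> l}. (\<lambda>x. norm (iter_deriv \<beta> f x)) ` K)"
    by (subst bdd_above_UN[OF finite_multi_indices]) auto
  then have "bdd_above (insert 0 (\<Union>\<beta>\<in>{\<beta> \<in> multi_indices. length \<beta> \<le> l}. (\<lambda>x. norm (iter_deriv \<beta> f x)) ` K))"
    by simp
  then show "bdd_above (insert 0 {norm (iter_deriv \<alpha> f x) | x \<alpha>. x \<in> K \<and> \<alpha> \<in> multi_indices \<and> length \<alpha> \<le> l})"
    by (rule bdd_above_mono) auto
qed

lemma seminorm_nonneg: "compact K \<Longrightarrow> K \<subseteq> \<Omega> \<Longrightarrow> smooth_on \<Omega> f \<Longrightarrow> 0 \<le> seminorm K l f"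
proof (cases "K = {}")
  case False
  assume "compact K" "K \<subseteq> \<Omega>" "smooth_on \<Omega> f"
  moreover obtain x where "x \<in> K" using False by blast
  ultimately have "norm (f x) \<le> seminorm K l f"
    using norm_le_seminorm[of K \<Omega> f "[]" l x] by simp
  then show ?thesis by (rule order_trans[OF norm_ge_zero])
qed (simp add: seminorm_def)

lemma seminorm_le:
  assumes "\<And>x \<alpha>. x \<in> K \<Longrightarrow> \<alpha> \<in> multi_indices \<Longrightarrow> length \<alpha> \<le> l \<Longrightarrow> norm (iter_deriv \<alpha> f x) \<le> B" "0 \<le> B"
  shows "seminorm K l f \<le> B"
  unfolding seminorm_def by (rule cSup_least) (use assms in auto)

lemma seminorm_bigo_imp:
  assumes u: "u \<in> smooth_nets \<Omega>" and K: "compact K" "K \<subseteq> \<Omega>" and \<alpha>: "\<alpha> \<in> multi_indices"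
    and O: "(\<lambda>\<epsilon>. seminorm K (length \<alpha>) (u \<epsilon>)) \<in> O[at_right 0](g)"
  obtains c where "\<forall>\<^sub>F \<epsilon> in at_right 0. \<forall>x\<in>K. norm (iter_deriv \<alpha> (u \<epsilon>) x) \<le> c * norm (g \<epsilon>)"
proof -
  obtain c where "\<forall>\<^sub>F \<epsilon> in at_right 0. norm (seminorm K (length \<alpha>) (u \<epsilon>)) \<le> c * norm (g \<epsilon>)"
    using O by (auto elim: landau_o.bigE)
  then have "\<forall>\<^sub>F \<epsilon> in at_right 0. \<forall>x\<in>K. norm (iter_deriv \<alpha> (u \<epsilon>) x) \<le> c * norm (g \<epsilon>)"
    using eventually_at_right_0_le[OF zero_less_one]
  proof eventually_elim
    case (elim \<epsilon>)
    then have "smooth_on \<Omega> (u \<epsilon>)" using u by (simp add: smooth_nets_def)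
    then show ?case using norm_le_seminorm[OF K _ \<alpha>, of "u \<epsilon>"] elim by force
  qed
  then show ?thesis by (rule that)
qed

lemma seminorm_bigoI:
  assumes u: "u \<in> smooth_nets \<Omega>" and K: "compact K" "K \<subseteq> \<Omega>"
    and bd: "\<And>\<alpha>. \<alpha> \<in> multi_indices \<Longrightarrow> length \<alpha> \<le> l \<Longrightarrow>
      \<forall>\<^sub>F \<epsilon> in at_right 0. \<forall>x\<in>K. norm (iter_deriv \<alpha> (u \<epsilon>) x) \<le> norm (g \<epsilon>)"
  shows "(\<lambda>\<epsilon>. seminorm K l (u \<epsilon>)) \<in> O[at_right 0](g)"
proof (rule landau_o.bigI[of 1])
  have "\<forall>\<^sub>F \<epsilon> in at_right 0. \<forall>\<alpha>\<in>{\<alpha> \<in> multi_indices. length \<alpha> \<le> l}.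
      \<forall>x\<in>K. norm (iter_deriv \<alpha> (u \<epsilon>) x) \<le> norm (g \<epsilon>)"
    using bd by (intro eventually_ball_finite finite_multi_indices) auto
  then show "\<forall>\<^sub>F \<epsilon> in at_right 0. norm (seminorm K l (u \<epsilon>)) \<le> 1 * norm (g \<epsilon>)"
    using eventually_at_right_0_le[OF zero_less_one]
  proof eventually_elim
    case (elim \<epsilon>)
    then have "smooth_on \<Omega> (u \<epsilon>)" using u by (simp add: smooth_nets_def)
    then have "0 \<le> seminorm K l (u \<epsilon>)" by (rule seminorm_nonneg[OF K])
    moreover have "seminorm K l (u \<epsilon>) \<le> norm (g \<epsilon>)"
      by (rule seminorm_le) (use elim in auto)
    ultimately show ?case by simp
  qed
qed simp

lemma moderate_nets_iff:
  "u \<in> moderate_nets \<Omega> \<longleftrightarrow> u \<in> smooth_nets \<Omega> \<and>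
     (\<forall>K \<alpha>. compact K \<longrightarrow> K \<subseteq> \<Omega> \<longrightarrow> \<alpha> \<in> multi_indices \<longrightarrow> moderate_bound K (\<lambda>\<epsilon>. iter_deriv \<alpha> (u \<epsilon>)))"
  (is "_ \<longleftrightarrow> _ \<and> ?B")
proof (intro iffI conjI allI impI)
  assume u: "u \<in> moderate_nets \<Omega>"
  then show sm: "u \<in> smooth_nets \<Omega>" by (simp add: moderate_nets_def)
  fix K :: "'a set" and \<alpha> :: "'a list"
  assume K: "compact K" "K \<subseteq> \<Omega>" and \<alpha>: "\<alpha> \<in> multi_indices"
  obtain n where "(\<lambda>\<epsilon>. seminorm K (length \<alpha>) (u \<epsilon>)) \<in> O[at_right 0](\<lambda>\<epsilon>. 1 / \<epsilon> ^ n)"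
    using u K unfolding moderate_nets_def by blast
  from seminorm_bigo_imp[OF sm K \<alpha> this] obtain c where
    "\<forall>\<^sub>F \<epsilon> in at_right 0. \<forall>x\<in>K. norm (iter_deriv \<alpha> (u \<epsilon>) x) \<le> c * norm (1 / \<epsilon> ^ n)" by blast
  then have "\<forall>\<^sub>F \<epsilon> in at_right 0. \<forall>x\<in>K. norm (iter_deriv \<alpha> (u \<epsilon>) x) \<le> c * (1 / \<epsilon>) ^ n"
    using eventually_at_right_0_le[OF zero_less_one]
    by eventually_elim (simp add: power_one_over inverse_eq_divide)
  then show "moderate_bound K (\<lambda>\<epsilon>. iter_deriv \<alpha> (u \<epsilon>))" by (rule moderate_boundI)
next
  assume *: "u \<in> smooth_nets \<Omega> \<and> ?B"
  have "\<exists>n. (\<lambda>\<epsilon>. seminorm K l (u \<epsilon>)) \<in> O[at_right 0](\<lambda>\<epsilon>. 1 / \<epsilon> ^ n)" if K: "compact K" "K \<subseteq> \<Omega>" for K l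
  proof -
    let ?A = "{\<alpha> \<in> multi_indices. length \<alpha> \<le> l} :: 'a list set"
    have "\<forall>\<alpha>\<in>?A. \<exists>n. \<forall>\<^sub>F \<epsilon> in at_right 0. \<forall>x\<in>K. norm (iter_deriv \<alpha> (u \<epsilon>) x) \<le> (1 / \<epsilon>) ^ n"
      using * K by (simp add: moderate_bound_def)
    from bchoice[OF this] obtain n where n: "\<And>\<alpha>. \<alpha> \<in> ?A \<Longrightarrow>
        \<forall>\<^sub>F \<epsilon> in at_right 0. \<forall>x\<in>K. norm (iter_deriv \<alpha> (u \<epsilon>) x) \<le> (1 / \<epsilon>) ^ n \<alpha>"
      by auto
    \<comment> \<open>Each derivative comes with its own exponent; the sum over the finitely many of
      them dominates every single one.\<close>
    have "(\<lambda>\<epsilon>. seminorm K l (u \<epsilon>)) \<in> O[at_right 0](\<lambda>\<epsilon>. 1 / \<epsilon> ^ sum n ?A)"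
    proof (rule seminorm_bigoI[OF _ K])
      fix \<alpha> :: "'a list" assume "\<alpha> \<in> multi_indices" "length \<alpha> \<le> l"
      then have \<alpha>: "\<alpha> \<in> ?A" by simp
      then have le: "n \<alpha> \<le> sum n ?A" by (intro member_le_sum finite_multi_indices) auto
      show "\<forall>\<^sub>F \<epsilon> in at_right 0. \<forall>x\<in>K. norm (iter_deriv \<alpha> (u \<epsilon>) x) \<le> norm (1 / \<epsilon> ^ sum n ?A)"
        using n[OF \<alpha>] eventually_at_right_0_le[OF zero_less_one]
      proof eventually_elim
        case (elim \<epsilon>)
        then have "(1 / \<epsilon>) ^ n \<alpha> \<le> norm (1 / \<epsilon> ^ sum n ?A)"
          using power_inverse_mono[OF _ _ le, of \<epsilon>] by (simp add: power_one_over)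
        with elim show ?case by (blast intro: order_trans)
      qed
    qed (use * in simp)
    then show ?thesis by blast
  qed
  then show "u \<in> moderate_nets \<Omega>" using * by (simp add: moderate_nets_def)
qed

lemma negligible_nets_iff:
  "u \<in> negligible_nets \<Omega> \<longleftrightarrow> u \<in> smooth_nets \<Omega> \<and>
     (\<forall>K \<alpha>. compact K \<longrightarrow> K \<subseteq> \<Omega> \<longrightarrow> \<alpha> \<in> multi_indices \<longrightarrow> negligible_bound K (\<lambda>\<epsilon>. iter_deriv \<alpha> (u \<epsilon>)))"
  (is "_ \<longleftrightarrow> _ \<and> ?B")
proof (intro iffI conjI allI impI)
  assume u: "u \<in> negligible_nets \<Omega>"
  then show sm: "u \<in> smooth_nets \<Omega>" by (simp add: negligible_nets_def)
  fix K :: "'a set" and \<alpha> :: "'a list"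
  assume K: "compact K" "K \<subseteq> \<Omega>" and \<alpha>: "\<alpha> \<in> multi_indices"
  show "negligible_bound K (\<lambda>\<epsilon>. iter_deriv \<alpha> (u \<epsilon>))"
    unfolding negligible_bound_def
  proof
    fix n :: nat
    \<comment> \<open>The additional power of \<epsilon> is spent on the constant of the Landau
      symbol.\<close>
    have "(\<lambda>\<epsilon>. seminorm K (length \<alpha>) (u \<epsilon>)) \<in> O[at_right 0](\<lambda>\<epsilon>. \<epsilon> ^ Suc n)"
      using u K unfolding negligible_nets_def by blast
    from seminorm_bigo_imp[OF sm K \<alpha> this] obtain c where
      "\<forall>\<^sub>F \<epsilon> in at_right 0. \<forall>x\<in>K. norm (iter_deriv \<alpha> (u \<epsilon>) x) \<le> c * norm (\<epsilon> ^ Suc n)" by blast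
    then show "\<forall>\<^sub>F \<epsilon> in at_right 0. \<forall>x\<in>K. norm (iter_deriv \<alpha> (u \<epsilon>) x) \<le> \<epsilon> ^ n"
      using eventually_at_right_0_mult_le[of c]
    proof eventually_elim
      case (elim \<epsilon>)
      then have "c * norm (\<epsilon> ^ Suc n) \<le> \<epsilon> ^ n"
        using mult_right_mono[of "c * \<epsilon>" 1 "\<epsilon> ^ n"] by (simp add: ac_simps abs_mult)
      with elim show ?case by (blast intro: order_trans)
    qed
  qed
next
  assume *: "u \<in> smooth_nets \<Omega> \<and> ?B"
  have "(\<lambda>\<epsilon>. seminorm K l (u \<epsilon>)) \<in> O[at_right 0](\<lambda>\<epsilon>. \<epsilon> ^ n)" if K: "compact K" "K \<subseteq> \<Omega>" for K l n
  proof (rule seminorm_bigoI[OF _ K])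
    fix \<alpha> :: "'a list" assume "\<alpha> \<in> multi_indices"
    then have "\<forall>\<^sub>F \<epsilon> in at_right 0. \<forall>x\<in>K. norm (iter_deriv \<alpha> (u \<epsilon>) x) \<le> \<epsilon> ^ n"
      using * K by (simp add: negligible_bound_def)
    then show "\<forall>\<^sub>F \<epsilon> in at_right 0. \<forall>x\<in>K. norm (iter_deriv \<alpha> (u \<epsilon>) x) \<le> norm (\<epsilon> ^ n)"
      by eventually_elim force
  qed (use * in simp)
  then show "u \<in> negligible_nets \<Omega>" using * by (simp add: negligible_nets_def)
qed

section \<open>Closure properties of moderate and negligible nets\<close>

lemma smooth_netsD: "u \<in> smooth_nets \<Omega> \<Longrightarrow> \<epsilon> \<in> {0<..1} \<Longrightarrow> smooth_on \<Omega> (u \<epsilon>)"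
  by (simp add: smooth_nets_def)

lemma smooth_netsI: "(\<And>\<epsilon>. \<epsilon> \<in> {0<..1} \<Longrightarrow> smooth_on \<Omega> (u \<epsilon>)) \<Longrightarrow> u \<in> smooth_nets \<Omega>"
  by (simp add: smooth_nets_def)

lemma moderate_nets_smooth: "u \<in> moderate_nets \<Omega> \<Longrightarrow> u \<in> smooth_nets \<Omega>"
  by (simp add: moderate_nets_def)

lemma negligible_nets_smooth: "u \<in> negligible_nets \<Omega> \<Longrightarrow> u \<in> smooth_nets \<Omega>"
  by (simp add: negligible_nets_def)

lemma moderate_netsI:
  assumes "u \<in> smooth_nets \<Omega>"
    and "\<And>K \<alpha>. compact K \<Longrightarrow> K \<subseteq> \<Omega> \<Longrightarrow> \<alpha> \<in> multi_indices \<Longrightarrow> moderate_bound K (\<lambda>\<epsilon>. iter_deriv \<alpha> (u \<epsilon>))"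
  shows "u \<in> moderate_nets \<Omega>"
  using assms by (simp add: moderate_nets_iff)

lemma moderate_netsD:
  "u \<in> moderate_nets \<Omega> \<Longrightarrow> compact K \<Longrightarrow> K \<subseteq> \<Omega> \<Longrightarrow> \<alpha> \<in> multi_indices \<Longrightarrow>
    moderate_bound K (\<lambda>\<epsilon>. iter_deriv \<alpha> (u \<epsilon>))"
  by (simp add: moderate_nets_iff)

lemma negligible_netsI:
  assumes "u \<in> smooth_nets \<Omega>"
    and "\<And>K \<alpha>. compact K \<Longrightarrow> K \<subseteq> \<Omega> \<Longrightarrow> \<alpha> \<in> multi_indices \<Longrightarrow> negligible_bound K (\<lambda>\<epsilon>. iter_deriv \<alpha> (u \<epsilon>))"
  shows "u \<in> negligible_nets \<Omega>"
  using assms by (simp add: negligible_nets_iff)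

lemma negligible_netsD:
  "u \<in> negligible_nets \<Omega> \<Longrightarrow> compact K \<Longrightarrow> K \<subseteq> \<Omega> \<Longrightarrow> \<alpha> \<in> multi_indices \<Longrightarrow>
    negligible_bound K (\<lambda>\<epsilon>. iter_deriv \<alpha> (u \<epsilon>))"
  by (simp add: negligible_nets_iff)

lemma negligible_imp_moderate_nets: "u \<in> negligible_nets \<Omega> \<Longrightarrow> u \<in> moderate_nets \<Omega>"
  by (simp add: moderate_nets_iff negligible_nets_iff negligible_imp_moderate_bound)

lemma smooth_nets_subset:
  assumes "u \<in> smooth_nets \<Omega>" "V \<subseteq> \<Omega>"
  shows "u \<in> smooth_nets V"
  by (rule smooth_netsI) (rule smooth_on_subset[OF smooth_netsD[OF assms(1)] assms(2)])

lemma moderate_nets_subset: "u \<in> moderate_nets \<Omega> \<Longrightarrow> V \<subseteq> \<Omega> \<Longrightarrow> u \<in> moderate_nets V"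
  using smooth_nets_subset by (auto simp: moderate_nets_iff)

lemma negligible_nets_subset: "u \<in> negligible_nets \<Omega> \<Longrightarrow> V \<subseteq> \<Omega> \<Longrightarrow> u \<in> negligible_nets V"
  using smooth_nets_subset by (auto simp: negligible_nets_iff)

lemma negligible_nets_zero: "(\<lambda>\<epsilon> x. 0) \<in> negligible_nets \<Omega>"
proof (rule negligible_netsI)
  show "(\<lambda>\<epsilon> x. 0) \<in> smooth_nets \<Omega>" by (intro smooth_netsI smooth_on_zero)
  fix K :: "'a set" and \<alpha> :: "'a list" assume "\<alpha> \<in> multi_indices"
  then show "negligible_bound K (\<lambda>\<epsilon>. iter_deriv \<alpha> (\<lambda>x. 0 :: 'b))"
    by (intro negligible_bound_cong[OF negligible_bound_zero] iter_deriv_zero)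
qed

text \<open>Identities such as linearity of the integral or Fubini hold only for \<epsilon> in (0,1]
  and points of \<Omega>, while nets are total functions. Openness of \<Omega> makes the derivatives
  depend on the values inside \<Omega> only.\<close>

lemma negligible_nets_cong:
  assumes "open \<Omega>" "u \<in> negligible_nets \<Omega>" "\<And>\<epsilon> x. \<epsilon> \<in> {0<..1} \<Longrightarrow> x \<in> \<Omega> \<Longrightarrow> v \<epsilon> x = u \<epsilon> x"
  shows "v \<in> negligible_nets \<Omega>"
proof (rule negligible_netsI)
  show "v \<in> smooth_nets \<Omega>"
  proof (rule smooth_netsI)
    fix \<epsilon> :: real assume \<epsilon>: "\<epsilon> \<in> {0<..1}"
    show "smooth_on \<Omega> (v \<epsilon>)"
      by (rule smooth_on_cong[OF assms(1) smooth_netsD[OF negligible_nets_smooth[OF assms(2)] \<epsilon>]])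
        (use assms(3) \<epsilon> in auto)
  qed
  fix K :: "'a set" and \<alpha> :: "'a list"
  assume K: "compact K" "K \<subseteq> \<Omega>" and \<alpha>: "\<alpha> \<in> multi_indices"
  show "negligible_bound K (\<lambda>\<epsilon>. iter_deriv \<alpha> (v \<epsilon>))"
    by (rule negligible_bound_cong[OF negligible_netsD[OF assms(2) K \<alpha>]])
      (rule iter_deriv_cong[OF assms(1)], use assms(3) K in auto)
qed

lemma moderate_nets_diff:
  assumes \<Omega>: "open \<Omega>" and u: "u \<in> moderate_nets \<Omega>" and v: "v \<in> moderate_nets \<Omega>"
  shows "(\<lambda>\<epsilon> x. u \<epsilon> x - v \<epsilon> x) \<in> moderate_nets \<Omega>"
proof (rule moderate_netsI)
  note sm = smooth_netsD[OF moderate_nets_smooth[OF u]] smooth_netsD[OF moderate_nets_smooth[OF v]]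
  show "(\<lambda>\<epsilon> x. u \<epsilon> x - v \<epsilon> x) \<in> smooth_nets \<Omega>"
    by (intro smooth_netsI smooth_on_diff \<Omega> sm)
  fix K :: "'a set" and \<alpha> :: "'a list"
  assume K: "compact K" "K \<subseteq> \<Omega>" and \<alpha>: "\<alpha> \<in> multi_indices"
  show "moderate_bound K (\<lambda>\<epsilon>. iter_deriv \<alpha> (\<lambda>x. u \<epsilon> x - v \<epsilon> x))"
    by (rule moderate_bound_cong[OF moderate_bound_diff[OF moderate_netsD[OF u K \<alpha>] moderate_netsD[OF v K \<alpha>]]])
      (use K \<alpha> in \<open>auto intro!: iter_deriv_diff[OF \<Omega> sm]\<close>)
qed

lemma negligible_nets_diff:
  assumes \<Omega>: "open \<Omega>" and u: "u \<in> negligible_nets \<Omega>" and v: "v \<in> negligible_nets \<Omega>"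
  shows "(\<lambda>\<epsilon> x. u \<epsilon> x - v \<epsilon> x) \<in> negligible_nets \<Omega>"
proof (rule negligible_netsI)
  note sm = smooth_netsD[OF negligible_nets_smooth[OF u]] smooth_netsD[OF negligible_nets_smooth[OF v]]
  show "(\<lambda>\<epsilon> x. u \<epsilon> x - v \<epsilon> x) \<in> smooth_nets \<Omega>"
    by (intro smooth_netsI smooth_on_diff \<Omega> sm)
  fix K :: "'a set" and \<alpha> :: "'a list"
  assume K: "compact K" "K \<subseteq> \<Omega>" and \<alpha>: "\<alpha> \<in> multi_indices"
  show "negligible_bound K (\<lambda>\<epsilon>. iter_deriv \<alpha> (\<lambda>x. u \<epsilon> x - v \<epsilon> x))"
    by (rule negligible_bound_cong[OF negligible_bound_diff[OF negligible_netsD[OF u K \<alpha>] negligible_netsD[OF v K \<alpha>]]])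
      (use K \<alpha> in \<open>auto intro!: iter_deriv_diff[OF \<Omega> sm]\<close>)
qed

lemma negligible_nets_diff_commute:
  assumes "open \<Omega>" "(\<lambda>\<epsilon> x. u \<epsilon> x - v \<epsilon> x) \<in> negligible_nets \<Omega>"
  shows "(\<lambda>\<epsilon> x. v \<epsilon> x - u \<epsilon> x) \<in> negligible_nets \<Omega>"
  using negligible_nets_diff[OF assms(1) negligible_nets_zero assms(2)] by simp

lemma negligible_nets_diff_trans:
  assumes "open \<Omega>" "(\<lambda>\<epsilon> x. u \<epsilon> x - v \<epsilon> x) \<in> negligible_nets \<Omega>" "(\<lambda>\<epsilon> x. v \<epsilon> x - w \<epsilon> x) \<in> negligible_nets \<Omega>"
  shows "(\<lambda>\<epsilon> x. u \<epsilon> x - w \<epsilon> x) \<in> negligible_nets \<Omega>"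
  using negligible_nets_diff[OF assms(1,2) negligible_nets_diff_commute[OF assms(1,3)]] by simp

lemma moderate_nets_mult:
  fixes u v :: "real \<Rightarrow> 'a::euclidean_space \<Rightarrow> 'k::real_normed_field"
  assumes \<Omega>: "open \<Omega>" and u: "u \<in> moderate_nets \<Omega>" and v: "v \<in> moderate_nets \<Omega>"
  shows "(\<lambda>\<epsilon> x. u \<epsilon> x * v \<epsilon> x) \<in> moderate_nets \<Omega>"
proof (rule moderate_netsI)
  note sm = smooth_netsD[OF moderate_nets_smooth[OF u]] smooth_netsD[OF moderate_nets_smooth[OF v]]
  show "(\<lambda>\<epsilon> x. u \<epsilon> x * v \<epsilon> x) \<in> smooth_nets \<Omega>"
    by (intro smooth_netsI smooth_on_mult \<Omega> sm)
  fix K :: "'a set" and \<alpha> :: "'a list"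
  assume K: "compact K" "K \<subseteq> \<Omega>" and \<alpha>: "\<alpha> \<in> multi_indices"
  have "moderate_bound K (\<lambda>\<epsilon> x. \<Sum>i\<leftarrow>splits \<alpha>. iter_deriv (fst i) (u \<epsilon>) x * iter_deriv (snd i) (v \<epsilon>) x)"
    using splits_multi_indices[OF \<alpha>]
    by (intro moderate_bound_sum_list moderate_bound_mult moderate_netsD[OF u K] moderate_netsD[OF v K]) auto
  then show "moderate_bound K (\<lambda>\<epsilon>. iter_deriv \<alpha> (\<lambda>x. u \<epsilon> x * v \<epsilon> x))"
    by (rule moderate_bound_cong) (use K \<alpha> in \<open>auto intro!: iter_deriv_mult[OF \<Omega> sm]\<close>)
qed

text \<open>The ideal property: every term of the Leibniz sum contains a derivative of the
  negligible factor.\<close>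

lemma negligible_nets_mult:
  fixes u v :: "real \<Rightarrow> 'a::euclidean_space \<Rightarrow> 'k::real_normed_field"
  assumes \<Omega>: "open \<Omega>" and u: "u \<in> negligible_nets \<Omega>" and v: "v \<in> moderate_nets \<Omega>"
  shows "(\<lambda>\<epsilon> x. u \<epsilon> x * v \<epsilon> x) \<in> negligible_nets \<Omega>"
proof (rule negligible_netsI)
  note sm = smooth_netsD[OF negligible_nets_smooth[OF u]] smooth_netsD[OF moderate_nets_smooth[OF v]]
  show "(\<lambda>\<epsilon> x. u \<epsilon> x * v \<epsilon> x) \<in> smooth_nets \<Omega>"
    by (intro smooth_netsI smooth_on_mult \<Omega> sm)
  fix K :: "'a set" and \<alpha> :: "'a list"
  assume K: "compact K" "K \<subseteq> \<Omega>" and \<alpha>: "\<alpha> \<in> multi_indices"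
  have "negligible_bound K (\<lambda>\<epsilon> x. \<Sum>i\<leftarrow>splits \<alpha>. iter_deriv (fst i) (u \<epsilon>) x * iter_deriv (snd i) (v \<epsilon>) x)"
    using splits_multi_indices[OF \<alpha>]
    by (intro negligible_bound_sum_list negligible_bound_mult negligible_netsD[OF u K] moderate_netsD[OF v K]) auto
  then show "negligible_bound K (\<lambda>\<epsilon>. iter_deriv \<alpha> (\<lambda>x. u \<epsilon> x * v \<epsilon> x))"
    by (rule negligible_bound_cong) (use K \<alpha> in \<open>auto intro!: iter_deriv_mult[OF \<Omega> sm]\<close>)
qed

lemma negligible_nets_mult_right:
  fixes u v :: "real \<Rightarrow> 'a::euclidean_space \<Rightarrow> 'k::real_normed_field"
  assumes "open \<Omega>" "u \<in> moderate_nets \<Omega>" "v \<in> negligible_nets \<Omega>"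
  shows "(\<lambda>\<epsilon> x. u \<epsilon> x * v \<epsilon> x) \<in> negligible_nets \<Omega>"
  using negligible_nets_mult[OF assms(1,3,2)] by (simp add: mult.commute)

lemma
  fixes \<phi> :: "'a::euclidean_space \<Rightarrow> 'b::euclidean_space"
  assumes R: "open R" and S: "open S" and \<phi>: "coordinate_projection \<phi>" and sub: "\<phi> ` S \<subseteq> R"
  shows moderate_nets_pullback:
      "u \<in> moderate_nets R \<Longrightarrow> (\<lambda>\<epsilon> x. u \<epsilon> (\<phi> x)) \<in> moderate_nets S" (is "_ \<Longrightarrow> ?M")
    and negligible_nets_pullback:
      "u \<in> negligible_nets R \<Longrightarrow> (\<lambda>\<epsilon> x. u \<epsilon> (\<phi> x)) \<in> negligible_nets S" (is "_ \<Longrightarrow> ?N")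
proof -
  have sm: "(\<lambda>\<epsilon> x. u \<epsilon> (\<phi> x)) \<in> smooth_nets S" if "u \<in> smooth_nets R"
    by (intro smooth_netsI smooth_on_pullback[OF R S \<phi> sub] smooth_netsD[OF that])
  have bd: "\<forall>x\<in>K. norm (iter_deriv \<alpha> (\<lambda>x. u \<epsilon> (\<phi> x)) x) \<le> 1 * B"
    if "u \<in> smooth_nets R" "\<epsilon> \<in> {0<..1}" "K \<subseteq> S" "\<alpha> \<in> multi_indices" "0 \<le> B"
      "\<And>y. y \<in> \<phi> ` K \<Longrightarrow> norm (iter_deriv (map \<phi> \<alpha>) (u \<epsilon>) y) \<le> B" for K \<alpha> \<epsilon> B
    using that iter_deriv_pullback[OF R S \<phi> sub smooth_netsD[OF that(1,2)], of \<alpha>] by (auto simp: subset_iff)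
  have zero: "iter_deriv \<alpha> (\<lambda>x. u \<epsilon> (\<phi> x)) x = 0"
    if "u \<in> smooth_nets R" "\<epsilon> \<in> {0<..1}" "K \<subseteq> S" "\<alpha> \<in> multi_indices" "map \<phi> \<alpha> \<notin> multi_indices" "x \<in> K" for K \<alpha> \<epsilon> x
    using that iter_deriv_pullback[OF R S \<phi> sub smooth_netsD[OF that(1,2)], of \<alpha>] by auto
  have im: "compact (\<phi> ` K)" "\<phi> ` K \<subseteq> R" if "compact K" "K \<subseteq> S" for K
    using that \<phi> sub
    by (auto simp: coordinate_projection_def intro!: compact_continuous_image linear_continuous_on)
  show ?M if u: "u \<in> moderate_nets R"
  proof (rule moderate_netsI[OF sm[OF moderate_nets_smooth[OF u]]])
    fix K :: "'a set" and \<alpha> :: "'a list"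
    assume K: "compact K" "K \<subseteq> S" and \<alpha>: "\<alpha> \<in> multi_indices"
    show "moderate_bound K (\<lambda>\<epsilon>. iter_deriv \<alpha> (\<lambda>x. u \<epsilon> (\<phi> x)))"
    proof (cases "map \<phi> \<alpha> \<in> multi_indices")
      case True
      show ?thesis
        by (rule moderate_bound_dominated[OF moderate_netsD[OF u im[OF K] True]])
          (rule bd[OF moderate_nets_smooth[OF u] _ K(2) \<alpha>])
    next
      case False
      show ?thesis
        by (rule moderate_bound_cong[OF negligible_imp_moderate_bound[OF negligible_bound_zero]])
          (rule zero[OF moderate_nets_smooth[OF u] _ K(2) \<alpha> False])
    qed
  qed
  show ?N if u: "u \<in> negligible_nets R"
  proof (rule negligible_netsI[OF sm[OF negligible_nets_smooth[OF u]]])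
    fix K :: "'a set" and \<alpha> :: "'a list"
    assume K: "compact K" "K \<subseteq> S" and \<alpha>: "\<alpha> \<in> multi_indices"
    show "negligible_bound K (\<lambda>\<epsilon>. iter_deriv \<alpha> (\<lambda>x. u \<epsilon> (\<phi> x)))"
    proof (cases "map \<phi> \<alpha> \<in> multi_indices")
      case True
      show ?thesis
        by (rule negligible_bound_dominated[OF negligible_netsD[OF u im[OF K] True]])
          (rule bd[OF negligible_nets_smooth[OF u] _ K(2) \<alpha>])
    next
      case False
      show ?thesis
        by (rule negligible_bound_cong[OF negligible_bound_zero])
          (rule zero[OF negligible_nets_smooth[OF u] _ K(2) \<alpha> False])
    qed
  qed
qed

text \<open>A derivative of the integral over \<open>K\<close> is at most the measure of
  \<open>A\<close> times a bound of the lifted derivative on the compact set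
  \<open>K \<times> C\<close>. In the second statement smoothness is global but negligibility is
  required only on a set \<open>U\<close> around \<open>V \<times> C\<close>: this is what is
  available off a support, or where two representatives are compared locally.\<close>

lemma
  fixes u :: "real \<Rightarrow> 'a::euclidean_space \<times> 'b::euclidean_space \<Rightarrow> 'k::{banach, second_countable_topology}"
  assumes X: "open X" and Y: "open Y" and C: "compact C" "A \<subseteq> C" "A \<in> sets lborel" "C \<subseteq> Y"
  shows moderate_nets_integral: "u \<in> moderate_nets (X \<times> Y) \<Longrightarrow>
      (\<lambda>\<epsilon> x. LINT y:A|lborel. u \<epsilon> (x, y)) \<in> moderate_nets X" (is "_ \<Longrightarrow> ?M")
    and negligible_nets_integral: "\<And>V U. u \<in> smooth_nets (X \<times> Y) \<Longrightarrow> u \<in> negligible_nets U \<Longrightarrow>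
      V \<subseteq> X \<Longrightarrow> V \<times> C \<subseteq> U \<Longrightarrow> (\<lambda>\<epsilon> x. LINT y:A|lborel. u \<epsilon> (x, y)) \<in> negligible_nets V"
proof -
  have sm: "(\<lambda>\<epsilon> x. LINT y:A|lborel. u \<epsilon> (x, y)) \<in> smooth_nets X" if "u \<in> smooth_nets (X \<times> Y)"
    by (intro smooth_netsI smooth_on_integral[OF X Y C] smooth_netsD[OF that])
  have bd: "\<forall>x\<in>K. norm (iter_deriv \<alpha> (\<lambda>x. LINT y:A|lborel. u \<epsilon> (x, y)) x) \<le> measure lborel A * B"
    if u: "u \<in> smooth_nets (X \<times> Y)" and K: "K \<subseteq> X" and \<alpha>: "\<alpha> \<in> multi_indices"
      and \<epsilon>: "\<epsilon> \<in> {0<..1}"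
      and B: "\<And>z. z \<in> K \<times> C \<Longrightarrow> norm (iter_deriv (lift_fst \<alpha>) (u \<epsilon>) z) \<le> B" for K \<alpha> \<epsilon> B
  proof
    fix x assume x: "x \<in> K"
    have "continuous_on (X \<times> C) (iter_deriv (lift_fst \<alpha>) (u \<epsilon>))"
      by (rule continuous_on_subset[OF smooth_on_continuous[OF smooth_netsD[OF u \<epsilon>]
              lift_fst_multi_indices[OF \<alpha>]]]) (use C in auto)
    then have "set_integrable lborel A (\<lambda>y. iter_deriv (lift_fst \<alpha>) (u \<epsilon>) (x, y))"
      by (rule set_integrable_section) (use C K x in auto)
    then have "norm (LINT y:A|lborel. iter_deriv (lift_fst \<alpha>) (u \<epsilon>) (x, y)) \<le> measure lborel A * B"
      by (rule norm_set_integral_le) (use C B x emeasure_subset_compact[OF C(1,2)] in auto)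
    then show "norm (iter_deriv \<alpha> (\<lambda>x. LINT y:A|lborel. u \<epsilon> (x, y)) x) \<le> measure lborel A * B"
      using iter_deriv_integral[OF X Y C smooth_netsD[OF u \<epsilon>] \<alpha>] K x by auto
  qed
  show ?M if u: "u \<in> moderate_nets (X \<times> Y)"
  proof (rule moderate_netsI[OF sm[OF moderate_nets_smooth[OF u]]])
    fix K :: "'a set" and \<alpha> :: "'a list"
    assume K: "compact K" "K \<subseteq> X" and \<alpha>: "\<alpha> \<in> multi_indices"
    have "moderate_bound (K \<times> C) (\<lambda>\<epsilon>. iter_deriv (lift_fst \<alpha>) (u \<epsilon>))"
      using K C by (intro moderate_netsD[OF u] compact_Times lift_fst_multi_indices[OF \<alpha>]) auto
    then show "moderate_bound K (\<lambda>\<epsilon>. iter_deriv \<alpha> (\<lambda>x. LINT y:A|lborel. u \<epsilon> (x, y)))"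
      by (rule moderate_bound_dominated) (rule bd[OF moderate_nets_smooth[OF u] K(2) \<alpha>])
  qed
  show "(\<lambda>\<epsilon> x. LINT y:A|lborel. u \<epsilon> (x, y)) \<in> negligible_nets V"
    if u: "u \<in> smooth_nets (X \<times> Y)" "u \<in> negligible_nets U" and V: "V \<subseteq> X" "V \<times> C \<subseteq> U" for V U
  proof (rule negligible_netsI[OF smooth_nets_subset[OF sm[OF u(1)] V(1)]])
    fix K :: "'a set" and \<alpha> :: "'a list"
    assume K: "compact K" "K \<subseteq> V" and \<alpha>: "\<alpha> \<in> multi_indices"
    have KX: "K \<subseteq> X" using K V by auto
    have "negligible_bound (K \<times> C) (\<lambda>\<epsilon>. iter_deriv (lift_fst \<alpha>) (u \<epsilon>))"
      using K C V by (intro negligible_netsD[OF u(2)] compact_Times lift_fst_multi_indices[OF \<alpha>]) auto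
    then show "negligible_bound K (\<lambda>\<epsilon>. iter_deriv \<alpha> (\<lambda>x. LINT y:A|lborel. u \<epsilon> (x, y)))"
      by (rule negligible_bound_dominated) (rule bd[OF u(1) KX \<alpha>])
  qed
qed

text \<open>Smoothness is tested pointwise, and a compact set is covered by finitely many balls
  whose closed versions lie in the given neighbourhoods; closed balls are used because negligibility
  gives bounds on compact sets. This locality is behind both the support and the gluing.\<close>

lemma negligible_nets_local:
  assumes \<Omega>: "open \<Omega>" and loc: "\<And>x. x \<in> \<Omega> \<Longrightarrow> \<exists>V. open V \<and> x \<in> V \<and> u \<in> negligible_nets V"
  shows "u \<in> negligible_nets \<Omega>"
proof (rule negligible_netsI)
  show "u \<in> smooth_nets \<Omega>"
    unfolding smooth_nets_def smooth_on_def differentiable_on_def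
  proof (intro CollectI ballI)
    fix \<epsilon> :: real and \<alpha> :: "'a list" and x
    assume *: "\<epsilon> \<in> {0<..1}" "\<alpha> \<in> multi_indices" "x \<in> \<Omega>"
    obtain V where V: "open V" "x \<in> V" "u \<in> negligible_nets V" using loc *(3) by blast
    have "(iter_deriv \<alpha> (u \<epsilon>) has_derivative frechet_derivative (iter_deriv \<alpha> (u \<epsilon>)) (at x)) (at x)"
      by (rule smooth_on_has_derivative[OF smooth_netsD[OF negligible_nets_smooth[OF V(3)] *(1)] V(1) *(2) V(2)])
    then show "iter_deriv \<alpha> (u \<epsilon>) differentiable at x within \<Omega>"
      using differentiable_at_withinI differentiableI by blast
  qed
  fix K :: "'a set" and \<alpha> :: "'a list"
  assume K: "compact K" "K \<subseteq> \<Omega>" and \<alpha>: "\<alpha> \<in> multi_indices"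
  let ?w = "\<lambda>\<epsilon>. iter_deriv \<alpha> (u \<epsilon>)"
  have "\<forall>x\<in>K. \<exists>e>0. negligible_bound (cball x e) ?w"
  proof
    fix x assume "x \<in> K"
    then obtain V where V: "open V" "x \<in> V" "u \<in> negligible_nets V" using loc K by blast
    then obtain e where "e > 0" "cball x e \<subseteq> V" using open_contains_cball by blast
    then show "\<exists>e>0. negligible_bound (cball x e) ?w"
      using negligible_netsD[OF V(3) compact_cball _ \<alpha>] by blast
  qed
  from bchoice[OF this] obtain e where e: "\<And>x. x \<in> K \<Longrightarrow> e x > 0 \<and> negligible_bound (cball x (e x)) ?w"
    by blast
  obtain T where T: "T \<subseteq> K" "finite T" "K \<subseteq> (\<Union>x\<in>T. ball x (e x))"
    by (rule compactE_image[OF K(1), of K "\<lambda>x. ball x (e x)"]) (use e in auto)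
  show "negligible_bound K ?w"
    unfolding negligible_bound_def
  proof
    fix n
    have "\<forall>\<^sub>F \<epsilon> in at_right 0. \<forall>x\<in>T. \<forall>y\<in>cball x (e x). norm (?w \<epsilon> y) \<le> \<epsilon> ^ n"
      using e T by (intro eventually_ball_finite) (auto simp: negligible_bound_def)
    then show "\<forall>\<^sub>F \<epsilon> in at_right 0. \<forall>y\<in>K. norm (?w \<epsilon> y) \<le> \<epsilon> ^ n"
    proof eventually_elim
      case (elim \<epsilon>)
      show ?case
      proof
        fix y assume "y \<in> K"
        then obtain x where "x \<in> T" "y \<in> cball x (e x)" using T(3) by fastforce
        then show "norm (?w \<epsilon> y) \<le> \<epsilon> ^ n" using elim by blast
      qed
    qed
  qed
qed

section \<open>Generalized functions and their supports\<close>

lemma net_rel_iff: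
  "(u, v) \<in> net_rel \<Omega> \<longleftrightarrow> u \<in> moderate_nets \<Omega> \<and> v \<in> moderate_nets \<Omega> \<and>
     (\<lambda>\<epsilon> x. u \<epsilon> x - v \<epsilon> x) \<in> negligible_nets \<Omega>"
  by (simp add: net_rel_def)

lemma equiv_net_rel: "open \<Omega> \<Longrightarrow> equiv (moderate_nets \<Omega>) (net_rel \<Omega>)"
proof (rule equivI)
  assume \<Omega>: "open \<Omega>"
  show "net_rel \<Omega> \<subseteq> moderate_nets \<Omega> \<times> moderate_nets \<Omega>" by (auto simp: net_rel_iff)
  show "refl_on (moderate_nets \<Omega>) (net_rel \<Omega>)"
    by (auto simp: refl_on_def net_rel_iff negligible_nets_zero)
  show "sym (net_rel \<Omega>)"
    by (auto simp: sym_def net_rel_iff intro: negligible_nets_diff_commute[OF \<Omega>])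
  show "trans (net_rel \<Omega>)"
    by (auto simp: trans_def net_rel_iff intro: negligible_nets_diff_trans[OF \<Omega>])
qed

lemma mem_Cl_iff:
  "v \<in> Cl \<Omega> u \<longleftrightarrow> u \<in> moderate_nets \<Omega> \<and> v \<in> moderate_nets \<Omega> \<and>
     (\<lambda>\<epsilon> x. u \<epsilon> x - v \<epsilon> x) \<in> negligible_nets \<Omega>"
  by (simp add: Cl_def net_rel_iff)

lemma Cl_eq_iff:
  assumes "open \<Omega>" "u \<in> moderate_nets \<Omega>" "v \<in> moderate_nets \<Omega>"
  shows "Cl \<Omega> u = Cl \<Omega> v \<longleftrightarrow> (\<lambda>\<epsilon> x. u \<epsilon> x - v \<epsilon> x) \<in> negligible_nets \<Omega>"
  using eq_equiv_class_iff[OF equiv_net_rel[OF assms(1)] assms(2,3)] assms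
  by (simp add: Cl_def net_rel_iff)

lemma Cl_in_colombeau: "u \<in> moderate_nets \<Omega> \<Longrightarrow> Cl \<Omega> u \<in> colombeau \<Omega>"
  by (simp add: Cl_def colombeau_def quotientI)

lemma colombeauE:
  assumes "g \<in> colombeau \<Omega>"
  obtains u where "u \<in> moderate_nets \<Omega>" "g = Cl \<Omega> u"
  using assms unfolding colombeau_def Cl_def by (rule quotientE)

text \<open>Restriction, pullback and product are images of sets of representatives. By transitivity
  such an image is a single class as soon as all elements of the set are related to one of them;
  this reduces the three operations to chosen nets.\<close>

lemma Image_net_rel_eq_Cl:
  assumes "open \<Omega>" "u \<in> S" "\<And>v. v \<in> S \<Longrightarrow> (u, v) \<in> net_rel \<Omega>"
  shows "net_rel \<Omega> `` S = Cl \<Omega> u"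
proof
  show "net_rel \<Omega> `` S \<subseteq> Cl \<Omega> u"
    using assms(3) equiv_net_rel[OF assms(1)] unfolding Cl_def equiv_def by (auto dest: transD)
qed (use assms(2) in \<open>auto simp: Cl_def\<close>)

lemma gf_restrict_Cl:
  assumes "open V" "V \<subseteq> \<Omega>" "u \<in> moderate_nets \<Omega>"
  shows "gf_restrict V (Cl \<Omega> u) = Cl V u"
  unfolding gf_restrict_def
proof (rule Image_net_rel_eq_Cl[OF assms(1)])
  show "u \<in> Cl \<Omega> u" using assms by (simp add: mem_Cl_iff negligible_nets_zero)
  fix v assume "v \<in> Cl \<Omega> u"
  then show "(u, v) \<in> net_rel V"
    using assms moderate_nets_subset negligible_nets_subset by (auto simp: mem_Cl_iff net_rel_iff)
qed

lemma gf_mult_Cl: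
  fixes u v :: "real \<Rightarrow> 'a::euclidean_space \<Rightarrow> 'k::real_normed_field"
  assumes \<Omega>: "open \<Omega>" and u: "u \<in> moderate_nets \<Omega>" and v: "v \<in> moderate_nets \<Omega>"
  shows "gf_mult \<Omega> (Cl \<Omega> u) (Cl \<Omega> v) = Cl \<Omega> (\<lambda>\<epsilon> x. u \<epsilon> x * v \<epsilon> x)"
  unfolding gf_mult_def
proof (rule Image_net_rel_eq_Cl[OF \<Omega>])
  have "u \<in> Cl \<Omega> u" "v \<in> Cl \<Omega> v" using u v by (simp_all add: mem_Cl_iff negligible_nets_zero)
  then show "(\<lambda>\<epsilon> x. u \<epsilon> x * v \<epsilon> x) \<in> {\<lambda>\<epsilon> x. u' \<epsilon> x * v' \<epsilon> x | u' v'. u' \<in> Cl \<Omega> u \<and> v' \<in> Cl \<Omega> v}" by blast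
  fix w assume "w \<in> {\<lambda>\<epsilon> x. u' \<epsilon> x * v' \<epsilon> x | u' v'. u' \<in> Cl \<Omega> u \<and> v' \<in> Cl \<Omega> v}"
  then obtain u' v' where w: "w = (\<lambda>\<epsilon> x. u' \<epsilon> x * v' \<epsilon> x)"
    and u': "u' \<in> moderate_nets \<Omega>" "(\<lambda>\<epsilon> x. u \<epsilon> x - u' \<epsilon> x) \<in> negligible_nets \<Omega>"
    and v': "v' \<in> moderate_nets \<Omega>" "(\<lambda>\<epsilon> x. v \<epsilon> x - v' \<epsilon> x) \<in> negligible_nets \<Omega>"
    by (auto simp: mem_Cl_iff)
  \<comment> \<open>One factor is changed at a time, through the intermediate product of
    \<open>u'\<close> and \<open>v\<close>.\<close>
  have 1: "(\<lambda>\<epsilon> x. u \<epsilon> x * v \<epsilon> x - u' \<epsilon> x * v \<epsilon> x) \<in> negligible_nets \<Omega>"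
    using negligible_nets_mult[OF \<Omega> u'(2) v] by (simp add: algebra_simps)
  have 2: "(\<lambda>\<epsilon> x. u' \<epsilon> x * v \<epsilon> x - u' \<epsilon> x * v' \<epsilon> x) \<in> negligible_nets \<Omega>"
    using negligible_nets_mult_right[OF \<Omega> u'(1) v'(2)] by (simp add: algebra_simps)
  show "(\<lambda>\<epsilon> x. u \<epsilon> x * v \<epsilon> x, w) \<in> net_rel \<Omega>"
    unfolding net_rel_iff w
    using moderate_nets_mult[OF \<Omega> u v] moderate_nets_mult[OF \<Omega> u'(1) v'(1)]
      negligible_nets_diff_trans[OF \<Omega> 1 2] by blast
qed

lemma gf_pullback_Cl:
  assumes R: "open R" and S: "open S" and \<phi>: "coordinate_projection \<phi>" and sub: "\<phi> ` S \<subseteq> R"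
    and u: "u \<in> moderate_nets R"
  shows "gf_pullback S \<phi> (Cl R u) = Cl S (\<lambda>\<epsilon> z. u \<epsilon> (\<phi> z))"
  unfolding gf_pullback_def
proof (rule Image_net_rel_eq_Cl[OF S])
  have "u \<in> Cl R u" using u by (simp add: mem_Cl_iff negligible_nets_zero)
  then show "(\<lambda>\<epsilon> z. u \<epsilon> (\<phi> z)) \<in> (\<lambda>u \<epsilon> z. u \<epsilon> (\<phi> z)) ` Cl R u" by blast
  fix w assume "w \<in> (\<lambda>u \<epsilon> z. u \<epsilon> (\<phi> z)) ` Cl R u"
  then obtain v where w: "w = (\<lambda>\<epsilon> z. v \<epsilon> (\<phi> z))" and v: "v \<in> moderate_nets R"
    "(\<lambda>\<epsilon> x. u \<epsilon> x - v \<epsilon> x) \<in> negligible_nets R"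
    by (auto simp: mem_Cl_iff)
  show "(\<lambda>\<epsilon> z. u \<epsilon> (\<phi> z), w) \<in> net_rel S"
    unfolding net_rel_iff w
    using moderate_nets_pullback[OF R S \<phi> sub u] moderate_nets_pullback[OF R S \<phi> sub v(1)]
      negligible_nets_pullback[OF R S \<phi> sub v(2)] by blast
qed

text \<open>The greatest open set in the definition of the support exists because negligibility is local.\<close>

lemma gf_supp_Cl:
  assumes \<Omega>: "open \<Omega>" and u: "u \<in> moderate_nets \<Omega>"
  shows "gf_supp \<Omega> (Cl \<Omega> u) = \<Omega> - \<Union>{V. open V \<and> V \<subseteq> \<Omega> \<and> u \<in> negligible_nets V}"
proof -
  have iff: "gf_restrict V (Cl \<Omega> u) = Cl V (\<lambda>\<epsilon> x. 0) \<longleftrightarrow> u \<in> negligible_nets V" if "open V" "V \<subseteq> \<Omega>" for V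
    using that u
    by (simp add: gf_restrict_Cl Cl_eq_iff moderate_nets_subset[OF u] negligible_imp_moderate_nets negligible_nets_zero)
  have "(GREATEST V. open V \<and> V \<subseteq> \<Omega> \<and> gf_restrict V (Cl \<Omega> u) = Cl V (\<lambda>\<epsilon> x. 0))
      = \<Union>{V. open V \<and> V \<subseteq> \<Omega> \<and> u \<in> negligible_nets V}" (is "_ = ?N")
  proof (rule Greatest_equality)
    have "open ?N" "?N \<subseteq> \<Omega>" by auto
    moreover have "u \<in> negligible_nets ?N"
      by (rule negligible_nets_local) auto
    ultimately show "open ?N \<and> ?N \<subseteq> \<Omega> \<and> gf_restrict ?N (Cl \<Omega> u) = Cl ?N (\<lambda>\<epsilon> x. 0)"
      using iff[of ?N] by simp
    show "V \<subseteq> ?N" if "open V \<and> V \<subseteq> \<Omega> \<and> gf_restrict V (Cl \<Omega> u) = Cl V (\<lambda>\<epsilon> x. 0)" for V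
      using that iff[of V] by auto
  qed
  then show ?thesis by (simp add: gf_supp_def)
qed

lemma
  assumes \<Omega>: "open \<Omega>" and u: "u \<in> moderate_nets \<Omega>"
  shows open_compl_gf_supp: "open (\<Omega> - gf_supp \<Omega> (Cl \<Omega> u))"
    and negligible_compl_gf_supp: "u \<in> negligible_nets (\<Omega> - gf_supp \<Omega> (Cl \<Omega> u))"
proof -
  have eq: "\<Omega> - gf_supp \<Omega> (Cl \<Omega> u) = \<Union>{V. open V \<and> V \<subseteq> \<Omega> \<and> u \<in> negligible_nets V}"
    unfolding gf_supp_Cl[OF assms] by auto
  show "open (\<Omega> - gf_supp \<Omega> (Cl \<Omega> u))" unfolding eq by auto
  show "u \<in> negligible_nets (\<Omega> - gf_supp \<Omega> (Cl \<Omega> u))"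
    unfolding eq by (rule negligible_nets_local) auto
qed

section \<open>Supports of products and pullbacks\<close>

lemma not_in_gf_supp:
  assumes "open \<Omega>" "u \<in> moderate_nets \<Omega>" "open V" "V \<subseteq> \<Omega>" "u \<in> negligible_nets V" "x \<in> V"
  shows "x \<notin> gf_supp \<Omega> (Cl \<Omega> u)"
  unfolding gf_supp_Cl[OF assms(1,2)] using assms by auto

text \<open>Off the support of one factor that factor is negligible, and multiplying by the other,
  moderate one keeps it so.\<close>

lemma gf_supp_mult_subset:
  fixes u v :: "real \<Rightarrow> 'a::euclidean_space \<Rightarrow> 'k::real_normed_field"
  assumes \<Omega>: "open \<Omega>" and u: "u \<in> moderate_nets \<Omega>" and v: "v \<in> moderate_nets \<Omega>"
  shows "gf_supp \<Omega> (Cl \<Omega> (\<lambda>\<epsilon> x. u \<epsilon> x * v \<epsilon> x)) \<subseteq> gf_supp \<Omega> (Cl \<Omega> u) \<inter> gf_supp \<Omega> (Cl \<Omega> v)"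
proof
  fix x assume x: "x \<in> gf_supp \<Omega> (Cl \<Omega> (\<lambda>\<epsilon> x. u \<epsilon> x * v \<epsilon> x))"
  then have x\<Omega>: "x \<in> \<Omega>" by (simp add: gf_supp_def)
  note uv = moderate_nets_mult[OF \<Omega> u v]
  have "x \<in> gf_supp \<Omega> (Cl \<Omega> u)"
  proof (rule ccontr)
    let ?V = "\<Omega> - gf_supp \<Omega> (Cl \<Omega> u)"
    assume "x \<notin> gf_supp \<Omega> (Cl \<Omega> u)"
    then have "x \<in> ?V" using x\<Omega> by simp
    moreover have "(\<lambda>\<epsilon> x. u \<epsilon> x * v \<epsilon> x) \<in> negligible_nets ?V"
      by (rule negligible_nets_mult[OF open_compl_gf_supp[OF \<Omega> u] negligible_compl_gf_supp[OF \<Omega> u]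
            moderate_nets_subset[OF v]]) auto
    ultimately show False
      using not_in_gf_supp[OF \<Omega> uv open_compl_gf_supp[OF \<Omega> u]] x by blast
  qed
  moreover have "x \<in> gf_supp \<Omega> (Cl \<Omega> v)"
  proof (rule ccontr)
    let ?V = "\<Omega> - gf_supp \<Omega> (Cl \<Omega> v)"
    assume "x \<notin> gf_supp \<Omega> (Cl \<Omega> v)"
    then have "x \<in> ?V" using x\<Omega> by simp
    moreover have "(\<lambda>\<epsilon> x. u \<epsilon> x * v \<epsilon> x) \<in> negligible_nets ?V"
      by (rule negligible_nets_mult_right[OF open_compl_gf_supp[OF \<Omega> v] moderate_nets_subset[OF u]
            negligible_compl_gf_supp[OF \<Omega> v]]) auto
    ultimately show False
      using not_in_gf_supp[OF \<Omega> uv open_compl_gf_supp[OF \<Omega> v]] x by blast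
  qed
  ultimately show "x \<in> gf_supp \<Omega> (Cl \<Omega> u) \<inter> gf_supp \<Omega> (Cl \<Omega> v)" by simp
qed

text \<open>The preimage of the complement of the support is open because \<open>\<phi>\<close> is
  continuous, and the pullback is negligible there.\<close>

lemma gf_supp_pullback_subset:
  assumes R: "open R" and S: "open S" and \<phi>: "coordinate_projection \<phi>" and sub: "\<phi> ` S \<subseteq> R"
    and u: "u \<in> moderate_nets R" and x: "x \<in> gf_supp S (Cl S (\<lambda>\<epsilon> z. u \<epsilon> (\<phi> z)))"
  shows "\<phi> x \<in> gf_supp R (Cl R u)"
proof (rule ccontr)
  let ?U = "R - gf_supp R (Cl R u)"
  let ?V = "S \<inter> \<phi> -` ?U"
  assume "\<phi> x \<notin> gf_supp R (Cl R u)"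
  moreover have "x \<in> S" using x by (simp add: gf_supp_def)
  ultimately have "x \<in> ?V" using sub by auto
  moreover have V: "open ?V"
    using \<phi> S open_compl_gf_supp[OF R u] unfolding coordinate_projection_def
    by (intro continuous_open_preimage linear_continuous_on) auto
  moreover have "(\<lambda>\<epsilon> z. u \<epsilon> (\<phi> z)) \<in> negligible_nets ?V"
    by (rule negligible_nets_pullback[OF open_compl_gf_supp[OF R u] V \<phi> _ negligible_compl_gf_supp[OF R u]]) auto
  ultimately show False
    using not_in_gf_supp[OF S moderate_nets_pullback[OF R S \<phi> sub u], of ?V x] x by blast
qed

section \<open>Integration of properly supported generalized functions\<close>

lemma rel_compact_openD:
  assumes "rel_compact_open V \<Omega>"
  shows "open V" "compact (closure V)" "closure V \<subseteq> \<Omega>" "V \<subseteq> \<Omega>" "V \<in> sets lborel"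
  using assms closure_subset[of V] by (auto simp: rel_compact_open_def)

lemma rel_compact_open_interior:
  assumes "compact C" "C \<subseteq> \<Omega>"
  shows "rel_compact_open (interior C) \<Omega>"
proof -
  have "closure (interior C) \<subseteq> C"
    by (intro closure_minimal interior_subset compact_imp_closed assms)
  then show ?thesis
    using assms unfolding rel_compact_open_def
    by (meson bounded_subset closed_closure compact_eq_bounded_closed open_interior order_trans)
qed

text \<open>In a compact exhaustion of \<Omega> the set \<open>K\<close> is contained in some
  member, hence in the interior of the next one.\<close>

lemma rel_compact_open_superset:
  assumes "open \<Omega>" "compact K" "K \<subseteq> \<Omega>"
  obtains V where "rel_compact_open V \<Omega>" "K \<subseteq> V"
proof -
  obtain C where C: "\<And>n. compact (C n)" "\<And>n. C n \<subseteq> \<Omega>" "\<And>n. C n \<subseteq> interior (C (Suc n))"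
      "\<And>K. \<lbrakk>compact K; K \<subseteq> \<Omega>\<rbrakk> \<Longrightarrow> \<exists>N. \<forall>n\<ge>N. K \<subseteq> C n"
    using open_Union_compact_subsets[OF assms(1)] by metis
  obtain N where "K \<subseteq> C N" using C(4)[OF assms(2,3)] by blast
  then have "K \<subseteq> interior (C (Suc N))" using C(3) by blast
  with rel_compact_open_interior[OF C(1,2)] show ?thesis by (rule that)
qed

text \<open>Proper support provides compact sets, whereas the integral is described through
  relatively compact open ones; a compact set is enlarged to pass from the former to the
  latter.\<close>

lemma colombeau_ps_relcompact:
  assumes "open Y" "g \<in> colombeau_ps X Y" "rel_compact_open V X"
  obtains W where "rel_compact_open W Y" "gf_supp (X \<times> Y) g \<inter> (V \<times> Y) \<subseteq> V \<times> W"
proof -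
  obtain K where K: "compact K" "K \<subseteq> Y" "gf_supp (X \<times> Y) g \<inter> (V \<times> Y) \<subseteq> V \<times> K"
    using assms(2,3) unfolding colombeau_ps_def by blast
  obtain W where "rel_compact_open W Y" "K \<subseteq> W"
    using rel_compact_open_superset[OF assms(1) K(1,2)] by blast
  with K(3) show ?thesis by (intro that[of W]) auto
qed

text \<open>The separation principle behind all equalities of classes below: every point has a
  relatively compact open neighbourhood, and negligibility is local.\<close>

lemma Cl_eqI_relcompact:
  assumes X: "open X" and "w \<in> moderate_nets X" "w' \<in> moderate_nets X"
    and loc: "\<And>V. rel_compact_open V X \<Longrightarrow> (\<lambda>\<epsilon> x. w \<epsilon> x - w' \<epsilon> x) \<in> negligible_nets V"
  shows "Cl X w = Cl X w'"
  unfolding Cl_eq_iff[OF assms(1-3)]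
proof (rule negligible_nets_local[OF X])
  fix x assume "x \<in> X"
  then obtain V where "rel_compact_open V X" "{x} \<subseteq> V"
    using rel_compact_open_superset[OF X, of "{x}"] by auto
  then show "\<exists>V. open V \<and> x \<in> V \<and> (\<lambda>\<epsilon> x. w \<epsilon> x - w' \<epsilon> x) \<in> negligible_nets V"
    using loc rel_compact_openD(1) by blast
qed

section \<open>Integrals of nets over relatively compact sets\<close>

abbreviation net_integral ::
    "'b::euclidean_space set \<Rightarrow> (real \<Rightarrow> 'a \<times> 'b \<Rightarrow> 'k::{banach, second_countable_topology}) \<Rightarrow> real \<Rightarrow> 'a \<Rightarrow> 'k"
  where "net_integral A u \<equiv> \<lambda>\<epsilon> x. LINT y:A|lborel. u \<epsilon> (x, y)"

lemma moderate_net_integral: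
  assumes "open X" "open Y" "rel_compact_open W Y" "u \<in> moderate_nets (X \<times> Y)"
  shows "net_integral W u \<in> moderate_nets X"
  using rel_compact_openD[OF assms(3)]
  by (intro moderate_nets_integral[OF assms(1,2) _ closure_subset _ _ assms(4)]) auto

lemma set_integrable_net:
  assumes "u \<in> smooth_nets (X \<times> Y)" "\<epsilon> \<in> {0<..1}" "rel_compact_open W Y" "A \<subseteq> W" "A \<in> sets lborel" "x \<in> X"
  shows "set_integrable lborel A (\<lambda>y. u \<epsilon> (x, y) :: 'k::{banach, second_countable_topology})"
proof (rule set_integrable_section)
  note W = rel_compact_openD[OF assms(3)]
  have "continuous_on (X \<times> Y) (u \<epsilon>)"
    using smooth_on_continuous[OF smooth_netsD[OF assms(1,2)], of "[]"] by simp
  then show "continuous_on (X \<times> closure W) (u \<epsilon>)"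
    by (rule continuous_on_subset) (use W in auto)
  show "compact (closure W)" "A \<subseteq> closure W" using W assms(4) closure_subset[of W] by auto
qed (use assms in auto)

text \<open>The estimate runs over \<open>K \<times> closure W\<close> with \<open>K\<close> compact
  in \<open>V\<close>, so the two integrands have to agree up to a negligible net on all of
  \<open>V \<times> closure W\<close>.\<close>

lemma negligible_net_integral_diff:
  assumes X: "open X" and Y: "open Y" and W: "rel_compact_open W Y"
    and u: "u \<in> moderate_nets (X \<times> Y)" and v: "v \<in> moderate_nets (X \<times> Y)"
    and V: "open V" "V \<subseteq> X" and U: "(\<lambda>\<epsilon> x. u \<epsilon> x - v \<epsilon> x) \<in> negligible_nets U" "V \<times> closure W \<subseteq> U"
  shows "(\<lambda>\<epsilon> x. net_integral W u \<epsilon> x - net_integral W v \<epsilon> x) \<in> negligible_nets V"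
proof (rule negligible_nets_cong[OF V(1)])
  have "open (X \<times> Y)" using X Y by (rule open_Times)
  from moderate_nets_diff[OF this u v]
  show "net_integral W (\<lambda>\<epsilon> x. u \<epsilon> x - v \<epsilon> x) \<in> negligible_nets V"
    using rel_compact_openD[OF W] V U
    by (intro negligible_nets_integral[OF X Y _ closure_subset _ _ moderate_nets_smooth U(1)]) auto
  fix \<epsilon> :: real and x assume "\<epsilon> \<in> {0<..1}" "x \<in> V"
  then show "net_integral W u \<epsilon> x - net_integral W v \<epsilon> x = net_integral W (\<lambda>\<epsilon> x. u \<epsilon> x - v \<epsilon> x) \<epsilon> x"
    using V rel_compact_openD(5)[OF W] set_integrable_net[OF moderate_nets_smooth[OF u] _ W]
      set_integrable_net[OF moderate_nets_smooth[OF v] _ W]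
    by (subst set_integral_diff(2)) auto
qed

text \<open>Removing the open set \<open>W'\<close> from the compact \<open>closure W\<close> leaves
  a compact set, and over \<open>V\<close> this set misses the support, off which \<open>u\<close>
  is negligible.\<close>

lemma negligible_net_integral_outside_supp:
  fixes u :: "real \<Rightarrow> 'a::euclidean_space \<times> 'b::euclidean_space \<Rightarrow> 'k::{banach, second_countable_topology}"
  assumes X: "open X" and Y: "open Y" and W: "rel_compact_open W Y" and W': "open W'"
    and u: "u \<in> moderate_nets (X \<times> Y)" and V: "V \<subseteq> X"
    and supp: "gf_supp (X \<times> Y) (Cl (X \<times> Y) u) \<inter> (V \<times> Y) \<subseteq> V \<times> W'"
  shows "net_integral (W - W') u \<in> negligible_nets V"
proof (rule negligible_nets_integral[OF X Y])
  note Wp = rel_compact_openD[OF W]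
  show "compact (closure W - W')" using Wp(2) W' by (rule compact_diff)
  show "W - W' \<subseteq> closure W - W'" using closure_subset by auto
  show "W - W' \<in> sets lborel" using Wp(5) W' by auto
  show "closure W - W' \<subseteq> Y" using Wp by auto
  show "u \<in> smooth_nets (X \<times> Y)" by (rule moderate_nets_smooth[OF u])
  show "u \<in> negligible_nets (X \<times> Y - gf_supp (X \<times> Y) (Cl (X \<times> Y) u))"
    by (rule negligible_compl_gf_supp[OF open_Times[OF X Y] u])
  show "V \<times> (closure W - W') \<subseteq> X \<times> Y - gf_supp (X \<times> Y) (Cl (X \<times> Y) u)"
    using V supp Wp(3) by auto
qed (rule V)

text \<open>The common part over \<open>W \<inter> W'\<close> cancels; each of the two remaining
  differences lies outside the other domain, hence off the support over \<open>V\<close>.\<close>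

lemma negligible_net_integral_indep:
  fixes u :: "real \<Rightarrow> 'a::euclidean_space \<times> 'b::euclidean_space \<Rightarrow> 'k::{banach, second_countable_topology}"
  assumes X: "open X" and Y: "open Y" and W: "rel_compact_open W Y" and W': "rel_compact_open W' Y"
    and u: "u \<in> moderate_nets (X \<times> Y)" and V: "open V" "V \<subseteq> X"
    and supp: "gf_supp (X \<times> Y) (Cl (X \<times> Y) u) \<inter> (V \<times> Y) \<subseteq> V \<times> W"
    and supp': "gf_supp (X \<times> Y) (Cl (X \<times> Y) u) \<inter> (V \<times> Y) \<subseteq> V \<times> W'"
  shows "(\<lambda>\<epsilon> x. net_integral W u \<epsilon> x - net_integral W' u \<epsilon> x) \<in> negligible_nets V"
proof (rule negligible_nets_cong[OF V(1)])
  note Wp = rel_compact_openD[OF W] and Wp' = rel_compact_openD[OF W']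
  show "(\<lambda>\<epsilon> x. net_integral (W - W') u \<epsilon> x - net_integral (W' - W) u \<epsilon> x) \<in> negligible_nets V"
    by (intro negligible_nets_diff[OF V(1)]
        negligible_net_integral_outside_supp[OF X Y W Wp'(1) u V(2) supp']
        negligible_net_integral_outside_supp[OF X Y W' Wp(1) u V(2) supp])
  fix \<epsilon> :: real and x assume \<epsilon>: "\<epsilon> \<in> {0<..1}" and x: "x \<in> V"
  have split: "(LINT y:A|lborel. u \<epsilon> (x, y)) = (LINT y:A \<inter> B|lborel. u \<epsilon> (x, y)) + (LINT y:A - B|lborel. u \<epsilon> (x, y))"
    if A: "rel_compact_open A Y" and B: "rel_compact_open B Y" for A B
  proof -
    have "A = A \<inter> B \<union> (A - B)" by auto
    moreover have "(LINT y:A \<inter> B \<union> (A - B)|lborel. u \<epsilon> (x, y)) = (LINT y:A \<inter> B|lborel. u \<epsilon> (x, y)) + (LINT y:A - B|lborel. u \<epsilon> (x, y))"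
      using rel_compact_openD(5)[OF A] rel_compact_openD(5)[OF B] V x
      by (intro set_integral_Un set_integrable_net[OF moderate_nets_smooth[OF u] \<epsilon> A]) auto
    ultimately show ?thesis by simp
  qed
  show "net_integral W u \<epsilon> x - net_integral W' u \<epsilon> x = net_integral (W - W') u \<epsilon> x - net_integral (W' - W) u \<epsilon> x"
    using split[OF W W'] split[OF W' W] by (simp add: Int_commute)
qed

text \<open>
  Gluing along an exhaustion without a partition of unity: switch from one member of the sequence
  to the next as \<open>\<epsilon>\<close> decreases, so slowly that all differences met on the way are small.
\<close>

lemma glue_moderate_nets:
  fixes v :: "nat \<Rightarrow> real \<Rightarrow> 'a::euclidean_space \<Rightarrow> 'k::real_normed_vector"
  assumes X: "open X" and C: "\<And>n. compact (C n)" "\<And>n. C n \<subseteq> interior (C (Suc n))"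
    and CX: "\<And>n. C n \<subseteq> X" and exhaust: "\<And>K. compact K \<Longrightarrow> K \<subseteq> X \<Longrightarrow> \<exists>N. \<forall>n\<ge>N. K \<subseteq> C n"
    and v: "\<And>k. v k \<in> moderate_nets X"
    and compat: "\<And>j k. j \<le> k \<Longrightarrow> (\<lambda>\<epsilon> x. v k \<epsilon> x - v j \<epsilon> x) \<in> negligible_nets (interior (C j))"
  obtains w where "w \<in> moderate_nets X"
    and "\<And>k. (\<lambda>\<epsilon> x. w \<epsilon> x - v k \<epsilon> x) \<in> negligible_nets (interior (C k))"
proof -
  \<comment> \<open>At this \<epsilon> the member \<open>v k\<close> is close to all earlier ones,
    with precision and order of differentiation growing with \<open>k\<close>. The comparison on
    \<open>C j\<close> is with \<open>v (Suc j)\<close>, since \<open>compat\<close> speaks of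
    interiors and \<open>C j\<close> lies in the interior of \<open>C (Suc j)\<close>.\<close>
  define P where "P k \<epsilon> \<longleftrightarrow> (\<forall>j\<in>{..<k}. \<forall>\<alpha>\<in>{\<alpha> \<in> multi_indices. length \<alpha> \<le> k}. \<forall>x\<in>C j.
      norm (iter_deriv \<alpha> (\<lambda>x. v k \<epsilon> x - v (Suc j) \<epsilon> x) x) \<le> \<epsilon> ^ k)" for k \<epsilon>
  have evP: "\<forall>\<^sub>F \<epsilon> in at_right 0. P k \<epsilon>" for k
    unfolding P_def
  proof (rule eventually_ball_finite[OF finite_lessThan], rule ballI,
      rule eventually_ball_finite[OF finite_multi_indices], rule ballI)
    fix j and \<alpha> :: "'a list" assume *: "j \<in> {..<k}" "\<alpha> \<in> {\<alpha> \<in> multi_indices. length \<alpha> \<le> k}"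
    have "negligible_bound (C j) (\<lambda>\<epsilon>. iter_deriv \<alpha> (\<lambda>x. v k \<epsilon> x - v (Suc j) \<epsilon> x))"
      using * by (intro negligible_netsD[OF compat C]) auto
    then show "\<forall>\<^sub>F \<epsilon> in at_right 0. \<forall>x\<in>C j. norm (iter_deriv \<alpha> (\<lambda>x. v k \<epsilon> x - v (Suc j) \<epsilon> x) x) \<le> \<epsilon> ^ k"
      by (simp add: negligible_bound_def)
  qed
  \<comment> \<open>The condition \<open>real k * \<epsilon> \<le> 1\<close> makes
    \<open>Q \<epsilon>\<close> finite and 0 makes it nonempty, so the maximum exists. A fixed
    \<open>k\<close> still belongs to it for all small \<epsilon>, so \<open>\<kappa>\<close> tends
    to infinity.\<close>
  define Q where "Q \<epsilon> = {k. real k * \<epsilon> \<le> 1 \<and> (k = 0 \<or> P k \<epsilon>)}" for \<epsilon>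
  define \<kappa> where "\<kappa> \<epsilon> = Max (Q \<epsilon>)" for \<epsilon>
  have Q: "finite (Q \<epsilon>)" "0 \<in> Q \<epsilon>" if "\<epsilon> > 0" for \<epsilon>
  proof -
    have "Q \<epsilon> \<subseteq> {..nat \<lceil>1 / \<epsilon>\<rceil>}"
    proof
      fix k assume "k \<in> Q \<epsilon>"
      then have "real k \<le> 1 / \<epsilon>" using that by (simp add: Q_def pos_le_divide_eq)
      then show "k \<in> {..nat \<lceil>1 / \<epsilon>\<rceil>}" by (simp add: le_nat_iff) linarith
    qed
    then show "finite (Q \<epsilon>)" by (rule finite_subset) simp
  qed (simp add: Q_def)
  have ev\<kappa>: "\<forall>\<^sub>F \<epsilon> in at_right 0. \<epsilon> \<in> {0<..1} \<and> N \<le> \<kappa> \<epsilon> \<and> P (\<kappa> \<epsilon>) \<epsilon>" if "N > 0" for N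
    using evP[of N] eventually_at_right_0_mult_le[of "real N"]
  proof eventually_elim
    case (elim \<epsilon>)
    then have \<epsilon>: "\<epsilon> > 0" by simp
    have "N \<in> Q \<epsilon>" using elim by (simp add: Q_def)
    then have "N \<le> \<kappa> \<epsilon>" unfolding \<kappa>_def using Q[OF \<epsilon>] by (intro Max_ge) auto
    moreover have "\<kappa> \<epsilon> \<in> Q \<epsilon>" unfolding \<kappa>_def using Q[OF \<epsilon>] by (intro Max_in) auto
    ultimately show ?case using elim that by (auto simp: Q_def)
  qed
  \<comment> \<open>The diagonal net: smooth for each \<epsilon>, because there it equals a single
    member of the sequence.\<close>
  define w where "w \<epsilon> = v (\<kappa> \<epsilon>) \<epsilon>" for \<epsilon>
  have sv: "smooth_on X (v k \<epsilon>)" if "\<epsilon> \<in> {0<..1}" for k \<epsilon>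
    by (rule smooth_netsD[OF moderate_nets_smooth[OF v] that])
  have sw: "smooth_on X (w \<epsilon>)" if "\<epsilon> \<in> {0<..1}" for \<epsilon>
    unfolding w_def by (rule sv[OF that])
  have key: "negligible_bound (C j) (\<lambda>\<epsilon>. iter_deriv \<alpha> (\<lambda>x. w \<epsilon> x - v (Suc j) \<epsilon> x))"
    if \<alpha>: "\<alpha> \<in> multi_indices" for j \<alpha>
    unfolding negligible_bound_def
  proof
    fix n
    \<comment> \<open>Beyond this threshold \<open>\<kappa> \<epsilon>\<close> exceeds
      \<open>j\<close> and \<open>length \<alpha>\<close>, so that \<open>P\<close> covers the set
      \<open>C j\<close> and the derivative, and also \<open>n\<close>, so that the bound
      \<open>\<epsilon> ^ \<kappa> \<epsilon>\<close> is small enough.\<close>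
    have "0 < Suc (j + length \<alpha> + n)" by simp
    from ev\<kappa>[OF this]
    show "\<forall>\<^sub>F \<epsilon> in at_right 0. \<forall>x\<in>C j. norm (iter_deriv \<alpha> (\<lambda>x. w \<epsilon> x - v (Suc j) \<epsilon> x) x) \<le> \<epsilon> ^ n"
    proof eventually_elim
      case (elim \<epsilon>)
      then have "norm (iter_deriv \<alpha> (\<lambda>x. w \<epsilon> x - v (Suc j) \<epsilon> x) x) \<le> \<epsilon> ^ \<kappa> \<epsilon>" if "x \<in> C j" for x
        using that \<alpha> unfolding w_def P_def by auto
      moreover have "\<epsilon> ^ \<kappa> \<epsilon> \<le> \<epsilon> ^ n"
        using elim by (intro power_decreasing) auto
      ultimately show ?case by (blast intro: order_trans)
    qed
  qed
  have w: "w \<in> moderate_nets X"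
  proof (rule moderate_netsI)
    show "w \<in> smooth_nets X" using sw by (rule smooth_netsI)
    fix K :: "'a set" and \<alpha> :: "'a list"
    assume K: "compact K" "K \<subseteq> X" and \<alpha>: "\<alpha> \<in> multi_indices"
    obtain j where j: "K \<subseteq> C j" using exhaust[OF K] by blast
    have "moderate_bound K (\<lambda>\<epsilon> x. iter_deriv \<alpha> (\<lambda>x. w \<epsilon> x - v (Suc j) \<epsilon> x) x + iter_deriv \<alpha> (v (Suc j) \<epsilon>) x)"
      by (intro moderate_bound_add negligible_imp_moderate_bound negligible_bound_subset[OF key[OF \<alpha>] j]
          moderate_netsD[OF v K \<alpha>])
    then show "moderate_bound K (\<lambda>\<epsilon>. iter_deriv \<alpha> (w \<epsilon>))"
      by (rule moderate_bound_cong) (use iter_deriv_diff[OF X sw sv \<alpha>] K in auto)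
  qed
  have "(\<lambda>\<epsilon> x. w \<epsilon> x - v k \<epsilon> x) \<in> negligible_nets (interior (C k))" for k
  proof (rule negligible_netsI)
    have Ck: "interior (C k) \<subseteq> X" using CX interior_subset by blast
    show "(\<lambda>\<epsilon> x. w \<epsilon> x - v k \<epsilon> x) \<in> smooth_nets (interior (C k))"
      using moderate_nets_subset[OF moderate_nets_diff[OF X w v] Ck] by (rule moderate_nets_smooth)
    fix K :: "'a set" and \<alpha> :: "'a list"
    assume K: "compact K" "K \<subseteq> interior (C k)" and \<alpha>: "\<alpha> \<in> multi_indices"
    have KX: "K \<subseteq> X" using K Ck by blast
    obtain N where N: "\<forall>n\<ge>N. K \<subseteq> C n" using exhaust[OF K(1) KX] by blast
    \<comment> \<open>Large enough for \<open>C j\<close> to contain \<open>K\<close>, and not below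
      \<open>k\<close>, so that \<open>compat\<close> compares \<open>v (Suc j)\<close> with
      \<open>v k\<close> on the interior of \<open>C k\<close>.\<close>
    define j where "j = max N k"
    have j: "K \<subseteq> C j" "k \<le> Suc j" using N by (auto simp: j_def)
    have "negligible_bound K (\<lambda>\<epsilon> x. iter_deriv \<alpha> (\<lambda>x. w \<epsilon> x - v (Suc j) \<epsilon> x) x
        + iter_deriv \<alpha> (\<lambda>x. v (Suc j) \<epsilon> x - v k \<epsilon> x) x)"
      by (intro negligible_bound_add negligible_bound_subset[OF key[OF \<alpha>] j(1)]
          negligible_netsD[OF compat[OF j(2)] K \<alpha>])
    then show "negligible_bound K (\<lambda>\<epsilon>. iter_deriv \<alpha> (\<lambda>x. w \<epsilon> x - v k \<epsilon> x))"
      by (rule negligible_bound_cong)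
        (use iter_deriv_diff[OF X sw sv \<alpha>] iter_deriv_diff[OF X sv sv \<alpha>] KX in auto)
  qed
  with w show ?thesis by (rule that)
qed

text \<open>Proper support assigns a domain \<open>W n\<close> to each member of an exhaustion, and
  the integrals over these domains are compatible because the choice of domain is immaterial. The
  same independence extends the description of the glued net from the exhaustion to every admissible
  pair \<open>V\<close>, \<open>W\<close>, as \<open>V\<close> lies in the interior of some
  member.\<close>

lemma integral_net_exists:
  fixes u :: "real \<Rightarrow> 'a::euclidean_space \<times> 'b::euclidean_space \<Rightarrow> 'k::{banach, second_countable_topology}"
  assumes X: "open X" and Y: "open Y" and u: "u \<in> moderate_nets (X \<times> Y)"
    and ps: "Cl (X \<times> Y) u \<in> colombeau_ps X Y"
  obtains w where "w \<in> moderate_nets X"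
    and "\<And>V W. rel_compact_open V X \<Longrightarrow> rel_compact_open W Y \<Longrightarrow>
      gf_supp (X \<times> Y) (Cl (X \<times> Y) u) \<inter> (V \<times> Y) \<subseteq> V \<times> W \<Longrightarrow>
      (\<lambda>\<epsilon> x. w \<epsilon> x - net_integral W u \<epsilon> x) \<in> negligible_nets V"
proof -
  let ?S = "gf_supp (X \<times> Y) (Cl (X \<times> Y) u)"
  obtain C where C: "\<And>n. compact (C n)" "\<And>n. C n \<subseteq> X" "\<And>n. C n \<subseteq> interior (C (Suc n))"
      "\<And>K. \<lbrakk>compact K; K \<subseteq> X\<rbrakk> \<Longrightarrow> \<exists>N. \<forall>n\<ge>N. K \<subseteq> C n"
    using open_Union_compact_subsets[OF X] by metis
  have rc: "rel_compact_open (interior (C n)) X" for n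
    by (rule rel_compact_open_interior[OF C(1,2)])
  have "\<forall>n. \<exists>W. rel_compact_open W Y \<and> ?S \<inter> (interior (C n) \<times> Y) \<subseteq> interior (C n) \<times> W"
    using colombeau_ps_relcompact[OF Y ps rc] by blast
  from choice[OF this] obtain W where W: "\<And>n. rel_compact_open (W n) Y"
      "\<And>n. ?S \<inter> (interior (C n) \<times> Y) \<subseteq> interior (C n) \<times> W n" by blast
  have C_mono: "C j \<subseteq> C k" if "j \<le> k" for j k
    by (rule lift_Suc_mono_le[OF _ that]) (use C(3) interior_subset in blast)
  have compat: "(\<lambda>\<epsilon> x. net_integral (W k) u \<epsilon> x - net_integral (W j) u \<epsilon> x) \<in> negligible_nets (interior (C j))"
    if "j \<le> k" for j k
  proof (rule negligible_net_integral_indep[OF X Y W(1) W(1) u open_interior _ _ W(2)])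
    show "interior (C j) \<subseteq> X" using C(2) interior_subset by blast
    have "interior (C j) \<subseteq> interior (C k)" by (intro interior_mono C_mono that)
    then show "?S \<inter> (interior (C j) \<times> Y) \<subseteq> interior (C j) \<times> W k" using W(2)[of k] by blast
  qed
  obtain w where w: "w \<in> moderate_nets X"
      "\<And>k. (\<lambda>\<epsilon> x. w \<epsilon> x - net_integral (W k) u \<epsilon> x) \<in> negligible_nets (interior (C k))"
    by (rule glue_moderate_nets[OF X C(1) C(3) C(2) C(4), of "\<lambda>k. net_integral (W k) u"])
      (use moderate_net_integral[OF X Y W(1) u] compat in blast)+
  show ?thesis
  proof (rule that[OF w(1)])
    fix V W' assume V: "rel_compact_open V X" and W': "rel_compact_open W' Y"
      and supp: "?S \<inter> (V \<times> Y) \<subseteq> V \<times> W'"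
    note Vp = rel_compact_openD[OF V]
    obtain n where "closure V \<subseteq> C n" using C(4)[OF Vp(2,3)] by blast
    then have sub: "V \<subseteq> interior (C (Suc n))" using C(3) closure_subset by blast
    then have "?S \<inter> (V \<times> Y) \<subseteq> V \<times> W (Suc n)" using W(2)[of "Suc n"] by blast
    from negligible_net_integral_indep[OF X Y W(1) W' u Vp(1,4) this supp]
    show "(\<lambda>\<epsilon> x. w \<epsilon> x - net_integral W' u \<epsilon> x) \<in> negligible_nets V"
      by (rule negligible_nets_diff_trans[OF Vp(1) negligible_nets_subset[OF w(2) sub]])
  qed
qed

text \<open>This discharges the \<open>THE\<close>. Existence must hold for every representative,
  and another one changes the integral over \<open>W\<close> by a negligible net. For uniqueness,
  proper support offers an admissible \<open>W\<close> over each \<open>V\<close>, so any two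
  solutions are tied there to the same integral.\<close>

lemma gf_integralE:
  fixes u :: "real \<Rightarrow> 'a::euclidean_space \<times> 'b::euclidean_space \<Rightarrow> 'k::{real_normed_field, euclidean_space}"
  assumes X: "open X" and Y: "open Y" and u: "u \<in> moderate_nets (X \<times> Y)"
    and ps: "Cl (X \<times> Y) u \<in> colombeau_ps X Y"
  obtains w where "w \<in> moderate_nets X" "gf_integral X Y (Cl (X \<times> Y) u) = Cl X w"
    and "\<And>V W. rel_compact_open V X \<Longrightarrow> rel_compact_open W Y \<Longrightarrow>
      gf_supp (X \<times> Y) (Cl (X \<times> Y) u) \<inter> (V \<times> Y) \<subseteq> V \<times> W \<Longrightarrow>
      (\<lambda>\<epsilon> x. w \<epsilon> x - net_integral W u \<epsilon> x) \<in> negligible_nets V"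
proof -
  let ?g = "Cl (X \<times> Y) u"
  obtain w where w: "w \<in> moderate_nets X"
    and wV: "\<And>V W. rel_compact_open V X \<Longrightarrow> rel_compact_open W Y \<Longrightarrow>
      gf_supp (X \<times> Y) ?g \<inter> (V \<times> Y) \<subseteq> V \<times> W \<Longrightarrow>
      (\<lambda>\<epsilon> x. w \<epsilon> x - net_integral W u \<epsilon> x) \<in> negligible_nets V"
    by (rule integral_net_exists[OF assms]) blast
  have "gf_integral X Y ?g = Cl X w"
    unfolding gf_integral_def
  proof (rule the_equality, intro conjI ballI allI impI, goal_cases)
    case 1
    show ?case by (rule Cl_in_colombeau[OF w])
  next
    case (2 u' V W)
    then have u': "u' \<in> moderate_nets (X \<times> Y)" and neg: "(\<lambda>\<epsilon> x. u \<epsilon> x - u' \<epsilon> x) \<in> negligible_nets (X \<times> Y)"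
      and V: "rel_compact_open V X" and W: "rel_compact_open W Y"
      and supp: "gf_supp (X \<times> Y) ?g \<inter> (V \<times> Y) \<subseteq> V \<times> W"
      by (auto simp: mem_Cl_iff)
    note Vp = rel_compact_openD[OF V] and Wp = rel_compact_openD[OF W]
    have "V \<times> closure W \<subseteq> X \<times> Y" using Vp Wp by auto
    from negligible_net_integral_diff[OF X Y W u u' Vp(1,4) neg this]
    have "(\<lambda>\<epsilon> x. w \<epsilon> x - net_integral W u' \<epsilon> x) \<in> negligible_nets V"
      by (rule negligible_nets_diff_trans[OF Vp(1) wV[OF V W supp]])
    moreover have "net_integral W u' \<in> moderate_nets V"
      by (rule moderate_nets_subset[OF moderate_net_integral[OF X Y W u'] Vp(4)])
    ultimately show ?case
      unfolding gf_restrict_Cl[OF Vp(1,4) w]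
      using Cl_eq_iff[OF Vp(1) moderate_nets_subset[OF w Vp(4)]] by blast
  next
    case (3 G)
    then obtain w' where w': "w' \<in> moderate_nets X" "G = Cl X w'" by (auto elim: colombeauE)
    have "u \<in> ?g" using u by (simp add: mem_Cl_iff negligible_nets_zero)
    have "Cl X w' = Cl X w"
    proof (rule Cl_eqI_relcompact[OF X w'(1) w])
      fix V assume V: "rel_compact_open V X"
      note Vp = rel_compact_openD[OF V]
      obtain W where W: "rel_compact_open W Y" "gf_supp (X \<times> Y) ?g \<inter> (V \<times> Y) \<subseteq> V \<times> W"
        by (rule colombeau_ps_relcompact[OF Y ps V])
      have "gf_restrict V G = Cl V (net_integral W u)"
        using 3 \<open>u \<in> ?g\<close> V W by blast
      then have "Cl V w' = Cl V (net_integral W u)"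
        unfolding w'(2) gf_restrict_Cl[OF Vp(1,4) w'(1)] .
      then have "(\<lambda>\<epsilon> x. w' \<epsilon> x - net_integral W u \<epsilon> x) \<in> negligible_nets V"
        using Cl_eq_iff[OF Vp(1) moderate_nets_subset[OF w'(1) Vp(4)]
            moderate_nets_subset[OF moderate_net_integral[OF X Y W(1) u] Vp(4)]] by blast
      then show "(\<lambda>\<epsilon> x. w' \<epsilon> x - w \<epsilon> x) \<in> negligible_nets V"
        by (rule negligible_nets_diff_trans[OF Vp(1) _ negligible_nets_diff_commute[OF Vp(1) wV[OF V W]]])
    qed
    then show ?case by (simp add: w'(2))
  qed
  from that[OF w this wV] show ?thesis by blast
qed

section \<open>Kernel operators\<close>

lemma rel_compact_open_Times:
  "rel_compact_open V X \<Longrightarrow> rel_compact_open W Y \<Longrightarrow> rel_compact_open (V \<times> W) (X \<times> Y)"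
  by (auto simp: rel_compact_open_def closure_Times intro: open_Times compact_Times)

text \<open>Fubini needs integrability on the product, which comes from continuity on the compact
  set \<open>C \<times> D\<close> and is inherited by \<open>A \<times> B\<close>.\<close>

lemma set_integral_swap:
  fixes F :: "'a::euclidean_space \<times> 'b::euclidean_space \<Rightarrow> 'k::{banach, second_countable_topology}"
  assumes "compact C" "A \<subseteq> C" "A \<in> sets lborel" "compact D" "B \<subseteq> D" "B \<in> sets lborel"
    and F: "continuous_on (C \<times> D) F"
  shows "(LINT x:A|lborel. LINT y:B|lborel. F (x, y)) = (LINT y:B|lborel. LINT x:A|lborel. F (x, y))"
proof -
  let ?f = "\<lambda>x y. indicator A x *\<^sub>R indicator B y *\<^sub>R F (x, y)"
  have "set_integrable lborel (C \<times> D) F"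
    unfolding set_integrable_def by (rule borel_integrable_compact[OF compact_Times F]) (use assms in auto)
  then have "set_integrable lborel (A \<times> B) F"
  proof (rule set_integrable_subset)
    have "A \<times> B \<in> sets (lborel \<Otimes>\<^sub>M lborel)" using assms by auto
    then show "A \<times> B \<in> sets lborel" unfolding lborel_prod .
  qed (use assms in auto)
  then have "integrable (lborel \<Otimes>\<^sub>M lborel) (case_prod ?f)"
    unfolding set_integrable_def lborel_prod
    by (simp add: indicator_times case_prod_beta' del: scaleR_scaleR) (simp add: indicator_times)
  from lborel_pair.Fubini_integral[OF this]
  have "(\<integral>x. (\<integral>y. ?f x y \<partial>lborel) \<partial>lborel) = (\<integral>y. (\<integral>x. ?f x y \<partial>lborel) \<partial>lborel)" ..
  moreover have "(\<integral>x. ?f x y \<partial>lborel) = indicator B y *\<^sub>R (\<integral>x. indicator A x *\<^sub>R F (x, y) \<partial>lborel)" for y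
    by (subst scaleR_left_commute) (simp del: scaleR_scaleR)
  ultimately show ?thesis by (simp add: set_lebesgue_integral_def del: scaleR_scaleR)
qed

lemma coordinate_projection_snd: "coordinate_projection snd"
  by (auto simp: coordinate_projection_def bounded_linear_snd Basis_prod_def)

lemma coordinate_projection_outer:
  "coordinate_projection (\<lambda>z :: ('a::euclidean_space \<times> 'b::euclidean_space) \<times> 'c::euclidean_space. (fst (fst z), snd z))"
  by (auto simp: coordinate_projection_def Basis_prod_def zero_prod_def
      intro!: bounded_linear_Pair bounded_linear_snd bounded_linear_fst_comp[OF bounded_linear_fst])

lemma coordinate_projection_inner:
  "coordinate_projection (\<lambda>z :: ('a::euclidean_space \<times> 'b::euclidean_space) \<times> 'c::euclidean_space. (snd z, snd (fst z)))"
  by (auto simp: coordinate_projection_def Basis_prod_def zero_prod_def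
      intro!: bounded_linear_Pair bounded_linear_snd bounded_linear_snd_comp[OF bounded_linear_fst])

section \<open>Representatives of operators and of composed kernels\<close>

lemma colombeau_psE:
  assumes "g \<in> colombeau_ps X Y"
  obtains u where "u \<in> moderate_nets (X \<times> Y)" "g = Cl (X \<times> Y) u"
  using assms unfolding colombeau_ps_def by (auto elim: colombeauE)

text \<open>The support of the integrand is contained in that of the kernel, so proper support is
  inherited and every domain admissible for \<open>h\<close> is admissible for the product, whatever
  \<open>f\<close> is.\<close>

lemma integral_opE:
  fixes h :: "real \<Rightarrow> 'a::euclidean_space \<times> 'b::euclidean_space \<Rightarrow> 'k::{real_normed_field, euclidean_space}"
  assumes X: "open X" and Y: "open Y" and h: "h \<in> moderate_nets (X \<times> Y)"
    and ps: "Cl (X \<times> Y) h \<in> colombeau_ps X Y" and f: "f \<in> moderate_nets Y"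
  obtains w where "w \<in> moderate_nets X" "integral_op X Y (Cl (X \<times> Y) h) (Cl Y f) = Cl X w"
    and "\<And>V W. rel_compact_open V X \<Longrightarrow> rel_compact_open W Y \<Longrightarrow>
      gf_supp (X \<times> Y) (Cl (X \<times> Y) h) \<inter> (V \<times> Y) \<subseteq> V \<times> W \<Longrightarrow>
      (\<lambda>\<epsilon> x. w \<epsilon> x - net_integral W (\<lambda>\<epsilon> z. h \<epsilon> z * f \<epsilon> (snd z)) \<epsilon> x) \<in> negligible_nets V"
proof -
  let ?u = "\<lambda>\<epsilon> z. h \<epsilon> z * f \<epsilon> (snd z)"
  have XY: "open (X \<times> Y)" using X Y by (rule open_Times)
  have sub: "snd ` (X \<times> Y) \<subseteq> Y" by auto
  have fs: "(\<lambda>\<epsilon> z. f \<epsilon> (snd z)) \<in> moderate_nets (X \<times> Y)"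
    by (rule moderate_nets_pullback[OF Y XY coordinate_projection_snd sub f])
  have u: "?u \<in> moderate_nets (X \<times> Y)" by (rule moderate_nets_mult[OF XY h fs])
  have eq: "gf_mult (X \<times> Y) (Cl (X \<times> Y) h) (gf_pullback (X \<times> Y) snd (Cl Y f)) = Cl (X \<times> Y) ?u"
    unfolding gf_pullback_Cl[OF Y XY coordinate_projection_snd sub f] by (rule gf_mult_Cl[OF XY h fs])
  have supp: "gf_supp (X \<times> Y) (Cl (X \<times> Y) ?u) \<subseteq> gf_supp (X \<times> Y) (Cl (X \<times> Y) h)"
    using gf_supp_mult_subset[OF XY h fs] by blast
  have psu: "Cl (X \<times> Y) ?u \<in> colombeau_ps X Y"
    unfolding colombeau_ps_def
  proof (intro CollectI conjI allI impI Cl_in_colombeau[OF u])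
    fix V assume "rel_compact_open V X"
    then obtain K where "compact K" "K \<subseteq> Y" "gf_supp (X \<times> Y) (Cl (X \<times> Y) h) \<inter> (V \<times> Y) \<subseteq> V \<times> K"
      using ps unfolding colombeau_ps_def by blast
    then show "\<exists>K. compact K \<and> K \<subseteq> Y \<and> gf_supp (X \<times> Y) (Cl (X \<times> Y) ?u) \<inter> (V \<times> Y) \<subseteq> V \<times> K"
      using supp by (intro exI[of _ K]) blast
  qed
  obtain w where w: "w \<in> moderate_nets X" "gf_integral X Y (Cl (X \<times> Y) ?u) = Cl X w"
    and wV: "\<And>V W. rel_compact_open V X \<Longrightarrow> rel_compact_open W Y \<Longrightarrow>
      gf_supp (X \<times> Y) (Cl (X \<times> Y) ?u) \<inter> (V \<times> Y) \<subseteq> V \<times> W \<Longrightarrow>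
      (\<lambda>\<epsilon> x. w \<epsilon> x - net_integral W ?u \<epsilon> x) \<in> negligible_nets V"
    by (rule gf_integralE[OF X Y u psu]) blast
  show ?thesis
  proof (rule that[OF w(1)])
    show "integral_op X Y (Cl (X \<times> Y) h) (Cl Y f) = Cl X w"
      unfolding integral_op_def eq by (rule w(2))
    fix V W assume "rel_compact_open V X" "rel_compact_open W Y"
      "gf_supp (X \<times> Y) (Cl (X \<times> Y) h) \<inter> (V \<times> Y) \<subseteq> V \<times> W"
    then show "(\<lambda>\<epsilon> x. w \<epsilon> x - net_integral W ?u \<epsilon> x) \<in> negligible_nets V"
      using supp by (intro wV) blast+
  qed
qed

lemma integral_op_closed:
  fixes H :: "('a::euclidean_space \<times> 'b::euclidean_space, 'k::{real_normed_field, euclidean_space}) genfun"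
  assumes "open X" "open Y" "H \<in> colombeau_ps X Y"
  shows "integral_op X Y H \<in> colombeau Y \<rightarrow> colombeau X"
proof
  fix F :: "('b, 'k) genfun" assume "F \<in> colombeau Y"
  then obtain f where f: "f \<in> moderate_nets Y" "F = Cl Y f" by (rule colombeauE)
  obtain h where h: "h \<in> moderate_nets (X \<times> Y)" "H = Cl (X \<times> Y) h"
    using assms(3) by (rule colombeau_psE)
  have ps: "Cl (X \<times> Y) h \<in> colombeau_ps X Y" using assms(3) h(2) by simp
  obtain w where "w \<in> moderate_nets X" "integral_op X Y (Cl (X \<times> Y) h) (Cl Y f) = Cl X w"
    by (rule integral_opE[OF assms(1,2) h(1) ps f(1)]) blast
  then show "integral_op X Y H F \<in> colombeau X" unfolding f(2) h(2) by (simp add: Cl_in_colombeau)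
qed

abbreviation comp_net ::
    "(real \<Rightarrow> 'a \<times> 'c \<Rightarrow> 'k::real_normed_field) \<Rightarrow> (real \<Rightarrow> 'c \<times> 'b \<Rightarrow> 'k) \<Rightarrow> real \<Rightarrow> ('a \<times> 'b) \<times> 'c \<Rightarrow> 'k"
  where "comp_net h\<^sub>1 h\<^sub>2 \<equiv> \<lambda>\<epsilon> z. h\<^sub>1 \<epsilon> (fst (fst z), snd z) * h\<^sub>2 \<epsilon> (snd z, snd (fst z))"

text \<open>Compactness in the integration variable is due to the first kernel: over a relatively
  compact set of \<open>(x, y)\<close> the variable \<open>x\<close> stays in a compact set.
  Admissibility of \<open>W\<close> is phrased through both supports together, so that
  \<open>W\<close> may shrink, even to the empty set, where they do not meet.\<close>

lemma kernel_compE: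
  fixes h\<^sub>1 :: "real \<Rightarrow> 'a::euclidean_space \<times> 'c::euclidean_space \<Rightarrow> 'k::{real_normed_field, euclidean_space}"
    and h\<^sub>2 :: "real \<Rightarrow> 'c \<times> 'b::euclidean_space \<Rightarrow> 'k"
  assumes X: "open X" and Y: "open Y" and \<Xi>: "open \<Xi>"
    and h\<^sub>1: "h\<^sub>1 \<in> moderate_nets (X \<times> \<Xi>)" and h\<^sub>2: "h\<^sub>2 \<in> moderate_nets (\<Xi> \<times> Y)"
    and ps: "Cl (X \<times> \<Xi>) h\<^sub>1 \<in> colombeau_ps X \<Xi>"
  obtains l where "l \<in> moderate_nets (X \<times> Y)"
    and "kernel_comp X \<Xi> Y (Cl (X \<times> \<Xi>) h\<^sub>1) (Cl (\<Xi> \<times> Y) h\<^sub>2) = Cl (X \<times> Y) l"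
    and "comp_net h\<^sub>1 h\<^sub>2 \<in> moderate_nets ((X \<times> Y) \<times> \<Xi>)"
    and "\<And>V W. rel_compact_open V (X \<times> Y) \<Longrightarrow> rel_compact_open W \<Xi> \<Longrightarrow>
      (\<And>x y \<xi>. (x, y) \<in> V \<Longrightarrow> (x, \<xi>) \<in> gf_supp (X \<times> \<Xi>) (Cl (X \<times> \<Xi>) h\<^sub>1) \<Longrightarrow>
        (\<xi>, y) \<in> gf_supp (\<Xi> \<times> Y) (Cl (\<Xi> \<times> Y) h\<^sub>2) \<Longrightarrow> \<xi> \<in> W) \<Longrightarrow>
      (\<lambda>\<epsilon> z. l \<epsilon> z - net_integral W (comp_net h\<^sub>1 h\<^sub>2) \<epsilon> z) \<in> negligible_nets V"
proof -
  let ?\<Omega> = "(X \<times> Y) \<times> \<Xi>" and ?k = "comp_net h\<^sub>1 h\<^sub>2"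
  let ?k\<^sub>1 = "\<lambda>\<epsilon> z. h\<^sub>1 \<epsilon> (fst (fst z), snd z)" and ?k\<^sub>2 = "\<lambda>\<epsilon> z. h\<^sub>2 \<epsilon> (snd z, snd (fst z))"
  let ?S\<^sub>1 = "gf_supp (X \<times> \<Xi>) (Cl (X \<times> \<Xi>) h\<^sub>1)" and ?S\<^sub>2 = "gf_supp (\<Xi> \<times> Y) (Cl (\<Xi> \<times> Y) h\<^sub>2)"
  have XY: "open (X \<times> Y)" and X\<Xi>: "open (X \<times> \<Xi>)" and \<Xi>Y: "open (\<Xi> \<times> Y)" and \<Omega>: "open ?\<Omega>"
    using X Y \<Xi> by (auto intro: open_Times)
  have sub\<^sub>1: "(\<lambda>z. (fst (fst z), snd z)) ` ?\<Omega> \<subseteq> X \<times> \<Xi>"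
    and sub\<^sub>2: "(\<lambda>z. (snd z, snd (fst z))) ` ?\<Omega> \<subseteq> \<Xi> \<times> Y" by auto
  note p\<^sub>1 = X\<Xi> \<Omega> coordinate_projection_outer sub\<^sub>1 h\<^sub>1
    and p\<^sub>2 = \<Xi>Y \<Omega> coordinate_projection_inner sub\<^sub>2 h\<^sub>2
  have k\<^sub>1: "?k\<^sub>1 \<in> moderate_nets ?\<Omega>" by (rule moderate_nets_pullback[OF p\<^sub>1])
  have k\<^sub>2: "?k\<^sub>2 \<in> moderate_nets ?\<Omega>" by (rule moderate_nets_pullback[OF p\<^sub>2])
  have k: "?k \<in> moderate_nets ?\<Omega>" by (rule moderate_nets_mult[OF \<Omega> k\<^sub>1 k\<^sub>2])
  have "kernel_comp X \<Xi> Y (Cl (X \<times> \<Xi>) h\<^sub>1) (Cl (\<Xi> \<times> Y) h\<^sub>2) =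
      gf_integral (X \<times> Y) \<Xi> (gf_mult ?\<Omega>
        (gf_pullback ?\<Omega> (\<lambda>z. (fst (fst z), snd z)) (Cl (X \<times> \<Xi>) h\<^sub>1))
        (gf_pullback ?\<Omega> (\<lambda>z. (snd z, snd (fst z))) (Cl (\<Xi> \<times> Y) h\<^sub>2)))"
    by (simp add: kernel_comp_def case_prod_beta')
  also have "\<dots> = gf_integral (X \<times> Y) \<Xi> (Cl ?\<Omega> ?k)"
    unfolding gf_pullback_Cl[OF p\<^sub>1] gf_pullback_Cl[OF p\<^sub>2] gf_mult_Cl[OF \<Omega> k\<^sub>1 k\<^sub>2] ..
  finally have eq: "kernel_comp X \<Xi> Y (Cl (X \<times> \<Xi>) h\<^sub>1) (Cl (\<Xi> \<times> Y) h\<^sub>2) = gf_integral (X \<times> Y) \<Xi> (Cl ?\<Omega> ?k)" .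
  have supp: "(x, \<xi>) \<in> ?S\<^sub>1" "(\<xi>, y) \<in> ?S\<^sub>2" if "((x, y), \<xi>) \<in> gf_supp ?\<Omega> (Cl ?\<Omega> ?k)" for x y \<xi>
  proof -
    have "((x, y), \<xi>) \<in> gf_supp ?\<Omega> (Cl ?\<Omega> ?k\<^sub>1)" "((x, y), \<xi>) \<in> gf_supp ?\<Omega> (Cl ?\<Omega> ?k\<^sub>2)"
      using that gf_supp_mult_subset[OF \<Omega> k\<^sub>1 k\<^sub>2] by blast+
    from gf_supp_pullback_subset[OF p\<^sub>1 this(1)] gf_supp_pullback_subset[OF p\<^sub>2 this(2)]
    show "(x, \<xi>) \<in> ?S\<^sub>1" "(\<xi>, y) \<in> ?S\<^sub>2" by simp_all
  qed
  have psk: "Cl ?\<Omega> ?k \<in> colombeau_ps (X \<times> Y) \<Xi>"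
    unfolding colombeau_ps_def
  proof (intro CollectI conjI allI impI Cl_in_colombeau[OF k])
    fix V assume "rel_compact_open V (X \<times> Y)"
    note Vp = rel_compact_openD[OF this]
    \<comment> \<open>The first coordinates of \<open>V\<close> stay in a compact subset of
      \<open>X\<close>, which is enlarged to an open set where proper support of the first kernel
      applies.\<close>
    have "compact (fst ` closure V)" "fst ` closure V \<subseteq> X"
      using Vp by (auto intro!: compact_continuous_image continuous_on_fst continuous_on_id)
    then obtain O' where O': "rel_compact_open O' X" "fst ` closure V \<subseteq> O'"
      using rel_compact_open_superset[OF X] by blast
    obtain K where K: "compact K" "K \<subseteq> \<Xi>" "?S\<^sub>1 \<inter> (O' \<times> \<Xi>) \<subseteq> O' \<times> K"
      using ps O'(1) unfolding colombeau_ps_def by blast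
    have "\<xi> \<in> K" if "((x, y), \<xi>) \<in> gf_supp ?\<Omega> (Cl ?\<Omega> ?k)" "(x, y) \<in> V" "\<xi> \<in> \<Xi>" for x y \<xi>
    proof -
      have "x \<in> O'" using that(2) O'(2) closure_subset by force
      then show ?thesis using supp(1)[OF that(1)] K(3) that(3) by blast
    qed
    then show "\<exists>K. compact K \<and> K \<subseteq> \<Xi> \<and> gf_supp ?\<Omega> (Cl ?\<Omega> ?k) \<inter> (V \<times> \<Xi>) \<subseteq> V \<times> K"
      using K(1,2) by (intro exI[of _ K]) auto
  qed
  obtain l where l: "l \<in> moderate_nets (X \<times> Y)" "gf_integral (X \<times> Y) \<Xi> (Cl ?\<Omega> ?k) = Cl (X \<times> Y) l"
    and lV: "\<And>V W. rel_compact_open V (X \<times> Y) \<Longrightarrow> rel_compact_open W \<Xi> \<Longrightarrow>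
      gf_supp ?\<Omega> (Cl ?\<Omega> ?k) \<inter> (V \<times> \<Xi>) \<subseteq> V \<times> W \<Longrightarrow>
      (\<lambda>\<epsilon> z. l \<epsilon> z - net_integral W ?k \<epsilon> z) \<in> negligible_nets V"
    by (rule gf_integralE[OF XY \<Xi> k psk]) blast
  show ?thesis
  proof (rule that[OF l(1) _ k])
    show "kernel_comp X \<Xi> Y (Cl (X \<times> \<Xi>) h\<^sub>1) (Cl (\<Xi> \<times> Y) h\<^sub>2) = Cl (X \<times> Y) l"
      unfolding eq by (rule l(2))
    fix V W assume *: "rel_compact_open V (X \<times> Y)" "rel_compact_open W \<Xi>"
      and W: "\<And>x y \<xi>. (x, y) \<in> V \<Longrightarrow> (x, \<xi>) \<in> ?S\<^sub>1 \<Longrightarrow> (\<xi>, y) \<in> ?S\<^sub>2 \<Longrightarrow> \<xi> \<in> W"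
    have "gf_supp ?\<Omega> (Cl ?\<Omega> ?k) \<inter> (V \<times> \<Xi>) \<subseteq> V \<times> W"
      using W supp by auto
    then show "(\<lambda>\<epsilon> z. l \<epsilon> z - net_integral W ?k \<epsilon> z) \<in> negligible_nets V"
      by (rule lV[OF *])
  qed
qed

text \<open>Both sides are double integrals of the product of the two kernels and \<open>f\<close>,
  continuous on \<open>closure W \<times> closure B\<close>. The factor \<open>h\<^sub>1\<close>,
  constant in \<open>y\<close>, moves into the inner integral on one side; \<open>f\<close>,
  constant in \<xi>, moves out of it on the other.\<close>

lemma net_integral_Fubini:
  fixes h\<^sub>1 :: "real \<Rightarrow> 'a::euclidean_space \<times> 'c::euclidean_space \<Rightarrow> 'k::{real_normed_field, euclidean_space}"
    and h\<^sub>2 :: "real \<Rightarrow> 'c \<times> 'b::euclidean_space \<Rightarrow> 'k"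
  assumes h\<^sub>1: "h\<^sub>1 \<in> smooth_nets (X \<times> \<Xi>)" and h\<^sub>2: "h\<^sub>2 \<in> smooth_nets (\<Xi> \<times> Y)" and f: "f \<in> smooth_nets Y"
    and W: "rel_compact_open W \<Xi>" and B: "rel_compact_open B Y" and \<epsilon>: "\<epsilon> \<in> {0<..1}" and x: "x \<in> X"
  shows "net_integral W (\<lambda>\<epsilon> z. h\<^sub>1 \<epsilon> z * net_integral B (\<lambda>\<epsilon> z. h\<^sub>2 \<epsilon> z * f \<epsilon> (snd z)) \<epsilon> (snd z)) \<epsilon> x
    = net_integral B (\<lambda>\<epsilon> z. net_integral W (comp_net h\<^sub>1 h\<^sub>2) \<epsilon> z * f \<epsilon> (snd z)) \<epsilon> x"
proof -
  note Wp = rel_compact_openD[OF W] and Bp = rel_compact_openD[OF B]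
  have cont: "continuous_on S (u \<epsilon>)" if "u \<in> smooth_nets S" for S and u :: "real \<Rightarrow> 'z::euclidean_space \<Rightarrow> 'k"
    using smooth_on_continuous[OF smooth_netsD[OF that \<epsilon>], of "[]"] by simp
  have "continuous_on (closure W \<times> closure B) (\<lambda>z. h\<^sub>1 \<epsilon> (x, fst z) * (h\<^sub>2 \<epsilon> z * f \<epsilon> (snd z)))"
    using x Wp(3) Bp(3)
    by (intro continuous_intros continuous_on_compose2[OF cont[OF h\<^sub>1]] continuous_on_compose2[OF cont[OF h\<^sub>2]]
        continuous_on_compose2[OF cont[OF f]]) auto
  from set_integral_swap[OF Wp(2) closure_subset Wp(5) Bp(2) closure_subset Bp(5) this]
  show ?thesis by (simp add: mult.assoc flip: set_integral_mult_right set_integral_mult_left)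
qed

text \<open>Over \<open>V\<close> the first support forces \<xi> into \<open>W\<close>, and the
  second then forces \<open>y\<close> into \<open>K\<close>; for \<open>y\<close> outside
  \<open>K\<close> no \<xi> meets both. The sets are left general because the statement serves both
  the proper support of the kernel and, with a wider \<open>W\<close>, the choice of the domain in
  \<open>y\<close> for the composition.\<close>

lemma gf_supp_kernel_comp:
  fixes h\<^sub>1 :: "real \<Rightarrow> 'a::euclidean_space \<times> 'c::euclidean_space \<Rightarrow> 'k::{real_normed_field, euclidean_space}"
    and h\<^sub>2 :: "real \<Rightarrow> 'c \<times> 'b::euclidean_space \<Rightarrow> 'k"
  assumes X: "open X" and Y: "open Y" and \<Xi>: "open \<Xi>"
    and h\<^sub>1: "h\<^sub>1 \<in> moderate_nets (X \<times> \<Xi>)" and h\<^sub>2: "h\<^sub>2 \<in> moderate_nets (\<Xi> \<times> Y)"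
    and ps: "Cl (X \<times> \<Xi>) h\<^sub>1 \<in> colombeau_ps X \<Xi>"
    and V: "open V" "V \<subseteq> X" and K: "compact K"
    and supp\<^sub>1: "gf_supp (X \<times> \<Xi>) (Cl (X \<times> \<Xi>) h\<^sub>1) \<inter> (V \<times> \<Xi>) \<subseteq> V \<times> W"
    and supp\<^sub>2: "gf_supp (\<Xi> \<times> Y) (Cl (\<Xi> \<times> Y) h\<^sub>2) \<inter> (W \<times> Y) \<subseteq> W \<times> K"
  shows "gf_supp (X \<times> Y) (kernel_comp X \<Xi> Y (Cl (X \<times> \<Xi>) h\<^sub>1) (Cl (\<Xi> \<times> Y) h\<^sub>2)) \<inter> (V \<times> Y) \<subseteq> V \<times> K"
proof -
  let ?S\<^sub>1 = "gf_supp (X \<times> \<Xi>) (Cl (X \<times> \<Xi>) h\<^sub>1)" and ?S\<^sub>2 = "gf_supp (\<Xi> \<times> Y) (Cl (\<Xi> \<times> Y) h\<^sub>2)"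
  have XY: "open (X \<times> Y)" using X Y by (rule open_Times)
  obtain l where l: "l \<in> moderate_nets (X \<times> Y)"
      "kernel_comp X \<Xi> Y (Cl (X \<times> \<Xi>) h\<^sub>1) (Cl (\<Xi> \<times> Y) h\<^sub>2) = Cl (X \<times> Y) l"
    and lV: "\<And>V W. rel_compact_open V (X \<times> Y) \<Longrightarrow> rel_compact_open W \<Xi> \<Longrightarrow>
      (\<And>x y \<xi>. (x, y) \<in> V \<Longrightarrow> (x, \<xi>) \<in> ?S\<^sub>1 \<Longrightarrow> (\<xi>, y) \<in> ?S\<^sub>2 \<Longrightarrow> \<xi> \<in> W) \<Longrightarrow>
      (\<lambda>\<epsilon> z. l \<epsilon> z - net_integral W (comp_net h\<^sub>1 h\<^sub>2) \<epsilon> z) \<in> negligible_nets V"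
    by (rule kernel_compE[OF X Y \<Xi> h\<^sub>1 h\<^sub>2 ps]) blast
  have "(x, y) \<notin> gf_supp (X \<times> Y) (Cl (X \<times> Y) l)" if "x \<in> V" "y \<in> Y" "y \<notin> K" for x y
  proof -
    have "open (V \<times> (Y - K))" using V Y K by (intro open_Times open_Diff compact_imp_closed)
    moreover have "{(x, y)} \<subseteq> V \<times> (Y - K)" using that by auto
    ultimately obtain U where U: "rel_compact_open U (V \<times> (Y - K))" "{(x, y)} \<subseteq> U"
      using rel_compact_open_superset[of "V \<times> (Y - K)" "{(x, y)}"] by auto
    note Up = rel_compact_openD[OF U(1)]
    have U': "rel_compact_open U (X \<times> Y)"
      using U(1) V(2) unfolding rel_compact_open_def by auto
    \<comment> \<open>The integrand vanishes over \<open>U\<close>, so the integral may be taken over the empty set.\<close>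
    have "(\<lambda>\<epsilon> z. l \<epsilon> z - net_integral {} (comp_net h\<^sub>1 h\<^sub>2) \<epsilon> z) \<in> negligible_nets U"
    proof (rule lV[OF U'])
      show "rel_compact_open {} \<Xi>" by (simp add: rel_compact_open_def)
      fix x y \<xi> assume *: "(x, y) \<in> U" "(x, \<xi>) \<in> ?S\<^sub>1" "(\<xi>, y) \<in> ?S\<^sub>2"
      then have "x \<in> V" "y \<in> Y" "y \<notin> K" "\<xi> \<in> \<Xi>" using Up(4) by (auto simp: gf_supp_def)
      then show "\<xi> \<in> {}" using * supp\<^sub>1 supp\<^sub>2 by blast
    qed
    then have "l \<in> negligible_nets U" by (simp add: set_lebesgue_integral_def)
    from not_in_gf_supp[OF XY l(1) Up(1) rel_compact_openD(4)[OF U'] this] show ?thesis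
      using U(2) by blast
  qed
  then show ?thesis unfolding l(2) by auto
qed

text \<open>The two proper supports are chained: the first kernel confines \<xi> to a relatively
  compact \<open>W\<close>, over which the second confines \<open>y\<close> to a compact
  \<open>K\<close>.\<close>

lemma kernel_comp_ps:
  fixes H\<^sub>1 :: "('a::euclidean_space \<times> 'c::euclidean_space, 'k::{real_normed_field, euclidean_space}) genfun"
    and H\<^sub>2 :: "('c \<times> 'b::euclidean_space, 'k) genfun"
  assumes X: "open X" and Y: "open Y" and \<Xi>: "open \<Xi>"
    and H\<^sub>1: "H\<^sub>1 \<in> colombeau_ps X \<Xi>" and H\<^sub>2: "H\<^sub>2 \<in> colombeau_ps \<Xi> Y"
  shows "kernel_comp X \<Xi> Y H\<^sub>1 H\<^sub>2 \<in> colombeau_ps X Y"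
proof -
  obtain h\<^sub>1 where h\<^sub>1: "h\<^sub>1 \<in> moderate_nets (X \<times> \<Xi>)" "H\<^sub>1 = Cl (X \<times> \<Xi>) h\<^sub>1" using H\<^sub>1 by (rule colombeau_psE)
  obtain h\<^sub>2 where h\<^sub>2: "h\<^sub>2 \<in> moderate_nets (\<Xi> \<times> Y)" "H\<^sub>2 = Cl (\<Xi> \<times> Y) h\<^sub>2" using H\<^sub>2 by (rule colombeau_psE)
  note ps = H\<^sub>1[unfolded h\<^sub>1(2)]
  obtain l where "l \<in> moderate_nets (X \<times> Y)" "kernel_comp X \<Xi> Y H\<^sub>1 H\<^sub>2 = Cl (X \<times> Y) l"
    unfolding h\<^sub>1(2) h\<^sub>2(2) by (rule kernel_compE[OF X Y \<Xi> h\<^sub>1(1) h\<^sub>2(1) ps]) blast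
  then have "kernel_comp X \<Xi> Y H\<^sub>1 H\<^sub>2 \<in> colombeau (X \<times> Y)" by (simp add: Cl_in_colombeau)
  moreover have "\<exists>K. compact K \<and> K \<subseteq> Y \<and> gf_supp (X \<times> Y) (kernel_comp X \<Xi> Y H\<^sub>1 H\<^sub>2) \<inter> (V \<times> Y) \<subseteq> V \<times> K"
    if V: "rel_compact_open V X" for V
  proof -
    obtain W where W: "rel_compact_open W \<Xi>" "gf_supp (X \<times> \<Xi>) H\<^sub>1 \<inter> (V \<times> \<Xi>) \<subseteq> V \<times> W"
      by (rule colombeau_ps_relcompact[OF \<Xi> H\<^sub>1 V])
    obtain K where K: "compact K" "K \<subseteq> Y" "gf_supp (\<Xi> \<times> Y) H\<^sub>2 \<inter> (W \<times> Y) \<subseteq> W \<times> K"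
      using H\<^sub>2 W(1) unfolding colombeau_ps_def by blast
    have "gf_supp (X \<times> Y) (kernel_comp X \<Xi> Y H\<^sub>1 H\<^sub>2) \<inter> (V \<times> Y) \<subseteq> V \<times> K"
      unfolding h\<^sub>1(2) h\<^sub>2(2)
      by (rule gf_supp_kernel_comp[OF X Y \<Xi> h\<^sub>1(1) h\<^sub>2(1) ps rel_compact_openD(1,4)[OF V] K(1)
            W(2)[unfolded h\<^sub>1(2)] K(3)[unfolded h\<^sub>2(2)]])
    with K show ?thesis by blast
  qed
  ultimately show ?thesis unfolding colombeau_ps_def by blast
qed

lemma integral_op_comp:
  fixes H\<^sub>1 :: "('a::euclidean_space \<times> 'c::euclidean_space, 'k::{real_normed_field, euclidean_space}) genfun"
    and H\<^sub>2 :: "('c \<times> 'b::euclidean_space, 'k) genfun"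
  assumes X: "open X" and Y: "open Y" and \<Xi>: "open \<Xi>"
    and H\<^sub>1: "H\<^sub>1 \<in> colombeau_ps X \<Xi>" and H\<^sub>2: "H\<^sub>2 \<in> colombeau_ps \<Xi> Y" and F: "F \<in> colombeau Y"
  shows "integral_op X \<Xi> H\<^sub>1 (integral_op \<Xi> Y H\<^sub>2 F) = integral_op X Y (kernel_comp X \<Xi> Y H\<^sub>1 H\<^sub>2) F"
proof -
  obtain h\<^sub>1 where h\<^sub>1: "h\<^sub>1 \<in> moderate_nets (X \<times> \<Xi>)" "H\<^sub>1 = Cl (X \<times> \<Xi>) h\<^sub>1" using H\<^sub>1 by (rule colombeau_psE)
  obtain h\<^sub>2 where h\<^sub>2: "h\<^sub>2 \<in> moderate_nets (\<Xi> \<times> Y)" "H\<^sub>2 = Cl (\<Xi> \<times> Y) h\<^sub>2" using H\<^sub>2 by (rule colombeau_psE)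
  obtain f where f: "f \<in> moderate_nets Y" "F = Cl Y f" using F by (rule colombeauE)
  note ps\<^sub>1 = H\<^sub>1[unfolded h\<^sub>1(2)] and ps\<^sub>2 = H\<^sub>2[unfolded h\<^sub>2(2)]
  let ?S\<^sub>1 = "gf_supp (X \<times> \<Xi>) (Cl (X \<times> \<Xi>) h\<^sub>1)" and ?S\<^sub>2 = "gf_supp (\<Xi> \<times> Y) (Cl (\<Xi> \<times> Y) h\<^sub>2)"
  let ?k = "comp_net h\<^sub>1 h\<^sub>2"
  have XY: "open (X \<times> Y)" using X Y by (rule open_Times)
  obtain l where l: "l \<in> moderate_nets (X \<times> Y)"
      "kernel_comp X \<Xi> Y (Cl (X \<times> \<Xi>) h\<^sub>1) (Cl (\<Xi> \<times> Y) h\<^sub>2) = Cl (X \<times> Y) l"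
    and k: "?k \<in> moderate_nets ((X \<times> Y) \<times> \<Xi>)"
    and lV: "\<And>V W. rel_compact_open V (X \<times> Y) \<Longrightarrow> rel_compact_open W \<Xi> \<Longrightarrow>
      (\<And>x y \<xi>. (x, y) \<in> V \<Longrightarrow> (x, \<xi>) \<in> ?S\<^sub>1 \<Longrightarrow> (\<xi>, y) \<in> ?S\<^sub>2 \<Longrightarrow> \<xi> \<in> W) \<Longrightarrow>
      (\<lambda>\<epsilon> z. l \<epsilon> z - net_integral W ?k \<epsilon> z) \<in> negligible_nets V"
    by (rule kernel_compE[OF X Y \<Xi> h\<^sub>1(1) h\<^sub>2(1) ps\<^sub>1]) blast
  have psl: "Cl (X \<times> Y) l \<in> colombeau_ps X Y"
    using kernel_comp_ps[OF X Y \<Xi> ps\<^sub>1 ps\<^sub>2] unfolding l(2) .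
  obtain v where v: "v \<in> moderate_nets \<Xi>" "integral_op \<Xi> Y (Cl (\<Xi> \<times> Y) h\<^sub>2) (Cl Y f) = Cl \<Xi> v"
    and vV: "\<And>V W. rel_compact_open V \<Xi> \<Longrightarrow> rel_compact_open W Y \<Longrightarrow> ?S\<^sub>2 \<inter> (V \<times> Y) \<subseteq> V \<times> W \<Longrightarrow>
      (\<lambda>\<epsilon> x. v \<epsilon> x - net_integral W (\<lambda>\<epsilon> z. h\<^sub>2 \<epsilon> z * f \<epsilon> (snd z)) \<epsilon> x) \<in> negligible_nets V"
    by (rule integral_opE[OF \<Xi> Y h\<^sub>2(1) ps\<^sub>2 f(1)]) blast
  obtain w\<^sub>1 where w\<^sub>1: "w\<^sub>1 \<in> moderate_nets X" "integral_op X \<Xi> (Cl (X \<times> \<Xi>) h\<^sub>1) (Cl \<Xi> v) = Cl X w\<^sub>1"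
    and w\<^sub>1V: "\<And>V W. rel_compact_open V X \<Longrightarrow> rel_compact_open W \<Xi> \<Longrightarrow> ?S\<^sub>1 \<inter> (V \<times> \<Xi>) \<subseteq> V \<times> W \<Longrightarrow>
      (\<lambda>\<epsilon> x. w\<^sub>1 \<epsilon> x - net_integral W (\<lambda>\<epsilon> z. h\<^sub>1 \<epsilon> z * v \<epsilon> (snd z)) \<epsilon> x) \<in> negligible_nets V"
    by (rule integral_opE[OF X \<Xi> h\<^sub>1(1) ps\<^sub>1 v(1)]) blast
  obtain w\<^sub>2 where w\<^sub>2: "w\<^sub>2 \<in> moderate_nets X" "integral_op X Y (Cl (X \<times> Y) l) (Cl Y f) = Cl X w\<^sub>2"
    and w\<^sub>2V: "\<And>V W. rel_compact_open V X \<Longrightarrow> rel_compact_open W Y \<Longrightarrow>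
      gf_supp (X \<times> Y) (Cl (X \<times> Y) l) \<inter> (V \<times> Y) \<subseteq> V \<times> W \<Longrightarrow>
      (\<lambda>\<epsilon> x. w\<^sub>2 \<epsilon> x - net_integral W (\<lambda>\<epsilon> z. l \<epsilon> z * f \<epsilon> (snd z)) \<epsilon> x) \<in> negligible_nets V"
    by (rule integral_opE[OF X Y l(1) psl f(1)]) blast
  have "Cl X w\<^sub>1 = Cl X w\<^sub>2"
  proof (rule Cl_eqI_relcompact[OF X w\<^sub>1(1) w\<^sub>2(1)])
    fix V assume V: "rel_compact_open V X"
    note Vp = rel_compact_openD[OF V]
    obtain V' where V': "rel_compact_open V' X" "closure V \<subseteq> V'"
      by (rule rel_compact_open_superset[OF X Vp(2,3)])
    obtain W where W: "rel_compact_open W \<Xi>" "?S\<^sub>1 \<inter> (V' \<times> \<Xi>) \<subseteq> V' \<times> W"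
      by (rule colombeau_ps_relcompact[OF \<Xi> ps\<^sub>1 V'(1)])
    note Wp = rel_compact_openD[OF W(1)]
    obtain W' where W': "rel_compact_open W' \<Xi>" "closure W \<subseteq> W'"
      by (rule rel_compact_open_superset[OF \<Xi> Wp(2,3)])
    note Wp' = rel_compact_openD[OF W'(1)]
    \<comment> \<open>Taken for \<open>W'\<close> rather than for \<open>W\<close>: the net
      \<open>v\<close> has to be replaced by an integral over \<open>B\<close> on a set that
      contains \<open>closure W\<close>.\<close>
    obtain K where K: "compact K" "K \<subseteq> Y" "?S\<^sub>2 \<inter> (W' \<times> Y) \<subseteq> W' \<times> K"
      using ps\<^sub>2 W'(1) unfolding colombeau_ps_def by blast
    obtain B where B: "rel_compact_open B Y" "K \<subseteq> B"
      by (rule rel_compact_open_superset[OF Y K(1,2)])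
    note Bp = rel_compact_openD[OF B(1)]
    obtain B' where B': "rel_compact_open B' Y" "closure B \<subseteq> B'"
      by (rule rel_compact_open_superset[OF Y Bp(2,3)])
    note Bp' = rel_compact_openD[OF B'(1)] and Vp' = rel_compact_openD[OF V'(1)]
    have VV': "V \<subseteq> V'" and WW': "W \<subseteq> W'" using V'(2) W'(2) closure_subset by blast+
    \<comment> \<open>Explicit stand-ins for \<open>v\<close> and \<open>l\<close>: integrals over
      fixed domains, to which Fubini applies for each \<epsilon>.\<close>
    let ?a = "net_integral B (\<lambda>\<epsilon> z. h\<^sub>2 \<epsilon> z * f \<epsilon> (snd z))" and ?b = "net_integral W ?k"
    have fs: "(\<lambda>\<epsilon> z. f \<epsilon> (snd z)) \<in> moderate_nets (S \<times> Y)" if "open S" for S :: "'z::euclidean_space set"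
      by (rule moderate_nets_pullback[OF Y open_Times[OF that Y] coordinate_projection_snd _ f(1)]) auto
    have snds: "(\<lambda>\<epsilon> z. u \<epsilon> (snd z)) \<in> moderate_nets (X \<times> \<Xi>)" if "u \<in> moderate_nets \<Xi>" for u :: "real \<Rightarrow> 'c \<Rightarrow> 'k"
      by (rule moderate_nets_pullback[OF \<Xi> open_Times[OF X \<Xi>] coordinate_projection_snd _ that]) auto
    have a: "?a \<in> moderate_nets \<Xi>"
      by (rule moderate_net_integral[OF \<Xi> Y B(1) moderate_nets_mult[OF open_Times[OF \<Xi> Y] h\<^sub>2(1) fs[OF \<Xi>]]])
    have b: "?b \<in> moderate_nets (X \<times> Y)" by (rule moderate_net_integral[OF XY \<Xi> W(1) k])
    have "?S\<^sub>2 \<inter> (W' \<times> Y) \<subseteq> W' \<times> B" using K(3) B(2) by blast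
    then have va: "(\<lambda>\<epsilon> \<xi>. v \<epsilon> \<xi> - ?a \<epsilon> \<xi>) \<in> negligible_nets W'" by (rule vV[OF W'(1) B(1)])
    \<comment> \<open>The difference of \<open>v\<close> and \<open>?a\<close> is negligible on
      \<open>W'\<close>, and multiplication by the moderate \<open>h\<^sub>1\<close> keeps it
      negligible on \<open>X \<times> W'\<close>, which contains
      \<open>V \<times> closure W\<close>.\<close>
    have "(\<lambda>\<epsilon> x. net_integral W (\<lambda>\<epsilon> z. h\<^sub>1 \<epsilon> z * v \<epsilon> (snd z)) \<epsilon> x
        - net_integral W (\<lambda>\<epsilon> z. h\<^sub>1 \<epsilon> z * ?a \<epsilon> (snd z)) \<epsilon> x) \<in> negligible_nets V"
    proof (rule negligible_net_integral_diff[OF X \<Xi> W(1) _ _ Vp(1,4)])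
      show "(\<lambda>\<epsilon> z. h\<^sub>1 \<epsilon> z * v \<epsilon> (snd z)) \<in> moderate_nets (X \<times> \<Xi>)"
        by (rule moderate_nets_mult[OF open_Times[OF X \<Xi>] h\<^sub>1(1) snds[OF v(1)]])
      show "(\<lambda>\<epsilon> z. h\<^sub>1 \<epsilon> z * ?a \<epsilon> (snd z)) \<in> moderate_nets (X \<times> \<Xi>)"
        by (rule moderate_nets_mult[OF open_Times[OF X \<Xi>] h\<^sub>1(1) snds[OF a]])
      have XW': "open (X \<times> W')" using X Wp'(1) by (rule open_Times)
      have h: "h\<^sub>1 \<in> moderate_nets (X \<times> W')" by (rule moderate_nets_subset[OF h\<^sub>1(1)]) (use Wp'(4) in auto)
      have "(\<lambda>\<epsilon> z. v \<epsilon> (snd z) - ?a \<epsilon> (snd z)) \<in> negligible_nets (X \<times> W')"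
        by (rule negligible_nets_pullback[OF Wp'(1) XW' coordinate_projection_snd _ va]) auto
      from negligible_nets_mult_right[OF XW' h this]
      show "(\<lambda>\<epsilon> z. h\<^sub>1 \<epsilon> z * v \<epsilon> (snd z) - h\<^sub>1 \<epsilon> z * ?a \<epsilon> (snd z)) \<in> negligible_nets (X \<times> W')"
        by (simp only: right_diff_distrib)
      show "V \<times> closure W \<subseteq> X \<times> W'" using Vp(4) W'(2) by auto
    qed
    moreover have "?S\<^sub>1 \<inter> (V \<times> \<Xi>) \<subseteq> V \<times> W" using W(2) VV' by blast
    ultimately have "(\<lambda>\<epsilon> x. w\<^sub>1 \<epsilon> x - net_integral W (\<lambda>\<epsilon> z. h\<^sub>1 \<epsilon> z * ?a \<epsilon> (snd z)) \<epsilon> x) \<in> negligible_nets V"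
      by (intro negligible_nets_diff_trans[OF Vp(1) w\<^sub>1V[OF V W(1)]])
    then have 1: "(\<lambda>\<epsilon> x. w\<^sub>1 \<epsilon> x - net_integral B (\<lambda>\<epsilon> z. ?b \<epsilon> z * f \<epsilon> (snd z)) \<epsilon> x) \<in> negligible_nets V"
    proof (rule negligible_nets_cong[OF Vp(1)])
      fix \<epsilon> :: real and x assume "\<epsilon> \<in> {0<..1}" "x \<in> V"
      then show "w\<^sub>1 \<epsilon> x - net_integral B (\<lambda>\<epsilon> z. ?b \<epsilon> z * f \<epsilon> (snd z)) \<epsilon> x
          = w\<^sub>1 \<epsilon> x - net_integral W (\<lambda>\<epsilon> z. h\<^sub>1 \<epsilon> z * ?a \<epsilon> (snd z)) \<epsilon> x"
        using net_integral_Fubini[OF moderate_nets_smooth[OF h\<^sub>1(1)] moderate_nets_smooth[OF h\<^sub>2(1)]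
            moderate_nets_smooth[OF f(1)] W(1) B(1), of \<epsilon> x] Vp(4) by auto
    qed
    have VB': "open (V' \<times> B')" using Vp'(1) Bp'(1) by (rule open_Times)
    have lb: "(\<lambda>\<epsilon> z. l \<epsilon> z - ?b \<epsilon> z) \<in> negligible_nets (V' \<times> B')"
    \<comment> \<open>Over \<open>V'\<close> the support of the first kernel alone confines \<xi> to
      \<open>W\<close>, whatever \<open>y\<close> is.\<close>
    proof (rule lV[OF rel_compact_open_Times[OF V'(1) B'(1)] W(1)])
      fix x y \<xi> assume "(x, y) \<in> V' \<times> B'" "(x, \<xi>) \<in> ?S\<^sub>1"
      moreover from this have "\<xi> \<in> \<Xi>" by (simp add: gf_supp_def)
      ultimately show "\<xi> \<in> W" using W(2) by blast
    qed
    have "(\<lambda>\<epsilon> x. net_integral B (\<lambda>\<epsilon> z. l \<epsilon> z * f \<epsilon> (snd z)) \<epsilon> x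
        - net_integral B (\<lambda>\<epsilon> z. ?b \<epsilon> z * f \<epsilon> (snd z)) \<epsilon> x) \<in> negligible_nets V"
    proof (rule negligible_net_integral_diff[OF X Y B(1) _ _ Vp(1,4)])
      show "(\<lambda>\<epsilon> z. l \<epsilon> z * f \<epsilon> (snd z)) \<in> moderate_nets (X \<times> Y)"
        by (rule moderate_nets_mult[OF XY l(1) fs[OF X]])
      show "(\<lambda>\<epsilon> z. ?b \<epsilon> z * f \<epsilon> (snd z)) \<in> moderate_nets (X \<times> Y)"
        by (rule moderate_nets_mult[OF XY b fs[OF X]])
      have "(\<lambda>\<epsilon> z. f \<epsilon> (snd z)) \<in> moderate_nets (V' \<times> B')"
        by (rule moderate_nets_subset[OF fs[OF X]]) (use Vp'(4) Bp'(4) in auto)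
      from negligible_nets_mult[OF VB' lb this]
      show "(\<lambda>\<epsilon> z. l \<epsilon> z * f \<epsilon> (snd z) - ?b \<epsilon> z * f \<epsilon> (snd z)) \<in> negligible_nets (V' \<times> B')"
        by (simp only: left_diff_distrib)
      show "V \<times> closure B \<subseteq> V' \<times> B'" using VV' B'(2) by auto
    qed
    moreover have "gf_supp (X \<times> Y) (Cl (X \<times> Y) l) \<inter> (V \<times> Y) \<subseteq> V \<times> B"
    proof -
      \<comment> \<open>Widened from \<open>W\<close> to \<open>W'\<close> to match
        \<open>K\<close>; the composed kernel then lives over \<open>K\<close>, and hence over
        \<open>B\<close>, so that \<open>B\<close> is an admissible domain for it.\<close>
      have "?S\<^sub>1 \<inter> (V \<times> \<Xi>) \<subseteq> V \<times> W'" using W(2) VV' WW' by blast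
      from gf_supp_kernel_comp[OF X Y \<Xi> h\<^sub>1(1) h\<^sub>2(1) ps\<^sub>1 Vp(1,4) K(1) this K(3)]
      show ?thesis unfolding l(2) using B(2) by blast
    qed
    ultimately have "(\<lambda>\<epsilon> x. w\<^sub>2 \<epsilon> x - net_integral B (\<lambda>\<epsilon> z. ?b \<epsilon> z * f \<epsilon> (snd z)) \<epsilon> x) \<in> negligible_nets V"
      by (intro negligible_nets_diff_trans[OF Vp(1) w\<^sub>2V[OF V B(1)]])
    from negligible_nets_diff_trans[OF Vp(1) 1 negligible_nets_diff_commute[OF Vp(1) this]]
    show "(\<lambda>\<epsilon> x. w\<^sub>1 \<epsilon> x - w\<^sub>2 \<epsilon> x) \<in> negligible_nets V" .
  qed
  then show ?thesis unfolding h\<^sub>1(2) h\<^sub>2(2) f(2) l(2) v(2) w\<^sub>1(2) w\<^sub>2(2) .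
qed

theorem theorem30:
  fixes X :: "'a::euclidean_space set"
    and Y :: "'b::euclidean_space set"
    and \<Xi> :: "'c::euclidean_space set"
    and H\<^sub>1 :: "('a \<times> 'c, 'k::{real_normed_field, euclidean_space}) genfun"
    and H\<^sub>2 :: "('c \<times> 'b, 'k) genfun"
  assumes "open X" and "open Y" and "open \<Xi>"
    and "H\<^sub>1 \<in> colombeau_ps X \<Xi>"
    and "H\<^sub>2 \<in> colombeau_ps \<Xi> Y"
  shows "integral_op X \<Xi> H\<^sub>1 \<in> colombeau \<Xi> \<rightarrow> colombeau X \<and>
    integral_op \<Xi> Y H\<^sub>2 \<in> colombeau Y \<rightarrow> colombeau \<Xi> \<and>
    (let L = kernel_comp X \<Xi> Y H\<^sub>1 H\<^sub>2 in
      L \<in> colombeau_ps X Y \<and>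
      (\<forall>f\<in>colombeau Y. (integral_op X \<Xi> H\<^sub>1 \<circ> integral_op \<Xi> Y H\<^sub>2) f = integral_op X Y L f))"
  using integral_op_closed[OF assms(1,3,4)] integral_op_closed[OF assms(3,2,5)]
    kernel_comp_ps[OF assms] integral_op_comp[OF assms]
  by (simp add: Let_def)

end
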